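(* Consider the generated-secret model with a hidden source described in the context. The key-leakage-storage capacity region (the set of all achievable triples $(R_s,R_l,R_m)$) for the generated-secret model is $$\mathcal{R}_1=\bigcup_{P_{U|\widetilde{X}}}\Big\{(R_s,R_l,R_m)\colon 0\le R_s\le I(U;Y),\ R_l\ge I(U;X)-I(U;Y),\ R_m\ge I(U;\widetilde{X})-I(U;Y)\Big\},$$ where the union is over conditional distributions $P_{U|\widetilde{X}}$ of an auxiliary random variable $U$ (taking values in a finite set) and the joint distribution is $P_{U\widetilde{X}XY}=P_{U|\widetilde{X}}\,P_{\widetilde{X}|X}\,Q_X\,P_{Y|X}$, i.e. $U-\widetilde{X}-X-Y$ forms a Markov chain.
   Context: Let $\mathcal{X},\widetilde{\mathcal{X}},\mathcal{Y}$ be finite sets. A discrete memoryless source generates i.i.d. symbols $X^N=X_1\ldots X_N$ according to $Q_X$ on $\mathcal{X}$. The strings $\widetilde{X}^N$ and $Y^N$ are the outputs of memoryless channels $P_{\widetilde{X}|X}$ and $P_{Y|X}$ with input $X^N$, so that $P_{\widetilde{X}^NX^NY^N}(\tilde x^N,x^N,y^N)=\prod_{i=1}^N P_{\widetilde{X}|X}(\tilde x_i|x_i)Q_X(x_i)P_{Y|X}(y_i|x_i)$. In the generated-secret model, an encoder observes $\widetilde{X}^N$ and produces a secret key $S\in\mathcal{S}$ and helper data $M$ via a deterministic mapping $(S,M)=\mathsf{Enc}_1(\widetilde{X}^N)$; a decoder produces $\hat S=\mathsf{Dec}_1(Y^N,M)$. A triple $(R_s,R_l,R_m)$ is achievable if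 for every $\epsilon>0$ there exist $N\ge1$ and an encoder and decoder with $R_s=\frac{\log|\mathcal{S}|}{N}$ and: $\Pr[S\ne\hat S]\le\epsilon$ (reliability); $\frac1N I(S;M)\le\epsilon$ (secrecy); $\frac1N I(X^N;M)\le R_l+\epsilon$ (privacy); $\frac1N H(S)\ge R_s-\epsilon$ (uniformity); $\frac1N H(M)\le R_m+\epsilon$ (storage). The capacity region is the set of achievable triples.
   Formalization: Achievability requires the key rate log|S|/N to be within ε of R_s instead of exactly equal to R_s; with exact equality only countably many values of R_s could be achievable and the claimed equality of regions would fail. *)

theory Defs
  imports "HOL-Probability.Probability"
begin

definition entropy_pmf :: "'a pmf \<Rightarrow> real" where
  "entropy_pmf p = - (\<Sum>a\<in>set_pmf p. pmf p a * log 2 (pmf p a))"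

definition mutual_info_pmf :: "('a \<times> 'b) pmf \<Rightarrow> real" where
  "mutual_info_pmf J = (\<Sum>ab\<in>set_pmf J.
      pmf J ab * log 2 (pmf J ab / (pmf (map_pmf fst J) (fst ab) * pmf (map_pmf snd J) (snd ab))))"

primrec iid_pmf :: "nat \<Rightarrow> 'a pmf \<Rightarrow> 'a list pmf" where
  "iid_pmf 0 p = return_pmf []"
| "iid_pmf (Suc n) p = bind_pmf p (\<lambda>a. map_pmf (\<lambda>as. a # as) (iid_pmf n p))"

definition src_pmf :: "'x pmf \<Rightarrow> ('x \<Rightarrow> 'xt pmf) \<Rightarrow> ('x \<Rightarrow> 'y pmf) \<Rightarrow> ('xt \<times> 'x \<times> 'y) pmf" where
  "src_pmf Q W V = bind_pmf Q (\<lambda>x. bind_pmf (W x) (\<lambda>xt. map_pmf (\<lambda>y. (xt, x, y)) (V x)))"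

definition gs_joint :: "'x pmf \<Rightarrow> ('x \<Rightarrow> 'xt pmf) \<Rightarrow> ('x \<Rightarrow> 'y pmf) \<Rightarrow> nat
    \<Rightarrow> ('xt list \<Rightarrow> nat \<times> nat) \<Rightarrow> ('y list \<Rightarrow> nat \<Rightarrow> nat)
    \<Rightarrow> (nat \<times> nat \<times> nat \<times> 'x list) pmf" where
  "gs_joint Q W V N Enc Dec = map_pmf
     (\<lambda>l. let xt = map fst l; x = map (fst \<circ> snd) l; y = map (snd \<circ> snd) l;
              s = fst (Enc xt); m = snd (Enc xt)
          in (s, m, Dec y m, x))
     (iid_pmf N (src_pmf Q W V))"

text \<open>Achievability in the generated-secret model. Keys and helper data are encoded as
  natural numbers; the key alphabet is a finite set S of naturals.\<close>
definition gs_achievable :: "'x pmf \<Rightarrow> ('x \<Rightarrow> 'xt pmf) \<Rightarrow> ('x \<Rightarrow> 'y pmf) \<Rightarrow> real \<times> real \<times> real \<Rightarrow> bool" where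
  "gs_achievable Q W V r \<longleftrightarrow> (case r of (Rs, Rl, Rm) \<Rightarrow>
     (\<forall>\<epsilon>>0. \<exists>N\<ge>1. \<exists>(S::nat set) Enc Dec.
        finite S \<and> S \<noteq> {} \<and>
        (\<forall>xt. length xt = N \<longrightarrow> fst (Enc xt) \<in> S) \<and>
        (let J = gs_joint Q W V N Enc Dec in
          \<bar>log 2 (real (card S)) / real N - Rs\<bar> \<le> \<epsilon> \<and>
          measure_pmf.prob J {(s, m, sh, x). s \<noteq> sh} \<le> \<epsilon> \<and>
          mutual_info_pmf (map_pmf (\<lambda>(s, m, sh, x). (s, m)) J) / real N \<le> \<epsilon> \<and>
          mutual_info_pmf (map_pmf (\<lambda>(s, m, sh, x). (x, m)) J) / real N \<le> Rl + \<epsilon> \<and>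
          entropy_pmf (map_pmf (\<lambda>(s, m, sh, x). s) J) / real N \<ge> Rs - \<epsilon> \<and>
          entropy_pmf (map_pmf (\<lambda>(s, m, sh, x). m) J) / real N \<le> Rm + \<epsilon>)))"

definition gs_capacity_region :: "'x pmf \<Rightarrow> ('x \<Rightarrow> 'xt pmf) \<Rightarrow> ('x \<Rightarrow> 'y pmf) \<Rightarrow> (real \<times> real \<times> real) set" where
  "gs_capacity_region Q W V = {r. gs_achievable Q W V r}"

definition aux_joint :: "'x pmf \<Rightarrow> ('x \<Rightarrow> 'xt pmf) \<Rightarrow> ('x \<Rightarrow> 'y pmf) \<Rightarrow> ('xt \<Rightarrow> nat pmf)
    \<Rightarrow> (nat \<times> 'xt \<times> 'x \<times> 'y) pmf" where
  "aux_joint Q W V PU = bind_pmf (src_pmf Q W V)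
     (\<lambda>(xt, x, y). map_pmf (\<lambda>u. (u, xt, x, y)) (PU xt))"

definition region_R1 :: "'x pmf \<Rightarrow> ('x \<Rightarrow> 'xt pmf) \<Rightarrow> ('x \<Rightarrow> 'y pmf) \<Rightarrow> (real \<times> real \<times> real) set" where
  "region_R1 Q W V = (\<Union>PU \<in> {PU :: 'xt \<Rightarrow> nat pmf. finite (\<Union>xt. set_pmf (PU xt))}.
     (let P = aux_joint Q W V PU;
          IUY = mutual_info_pmf (map_pmf (\<lambda>(u, xt, x, y). (u, y)) P);
          IUX = mutual_info_pmf (map_pmf (\<lambda>(u, xt, x, y). (u, x)) P);
          IUXt = mutual_info_pmf (map_pmf (\<lambda>(u, xt, x, y). (u, xt)) P)
      in {(Rs, Rl, Rm). 0 \<le> Rs \<and> Rs \<le> IUY \<and> Rl \<ge> IUX - IUY \<and> Rm \<ge> IUXt - IUY}))"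

end

theory Submission
  imports Defs
begin

text \<open>
  Converse: with \<open>T = (S, M)\<close> and \<open>U\<^sub>i = (T, Y\<^sup>i\<^sup>-\<^sup>1)\<close>, the key rate is bounded by the sum of the
  \<open>I(U\<^sub>i; Y\<^sub>i)\<close>. Replacing \<open>Z\<^sup>N\<close> by \<open>Y\<^sup>N\<close> one letter at a time, for \<open>Z\<close> the noisy source
  output or the source itself, gives
  \<open>\<Sum>\<^sub>i I(U\<^sub>i; Z\<^sub>i) - I(U\<^sub>i; Y\<^sub>i) \<le> I(T; Z\<^sup>N) - I(T; Y\<^sup>N)\<close>, because \<open>Y\<^sub>i\<close> depends on the rest only
  through \<open>Z\<^sub>i\<close>; by Fano's inequality the right-hand side is at most the storage or the leakage, up to
  a vanishing term. A test channel is the same thing as a way of writing the law of the noisy source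
  output as a convex combination of input laws, so the tuples of conditional entropies it produces form
  a slice of the convex hull of a compact set. This slice is convex, which makes time sharing free, and
  compact, which allows the error parameter to tend to 0 without any bound on the alphabet of \<open>U\<close>.

  Achievability: draw a random codebook of slightly more than \<open>2 ^ (N I(U; X~))\<close> words and split it into
  bins of slightly fewer than \<open>2 ^ (N I(U; Y))\<close> words; the bin index is the helper data, the position
  within the bin is the key. Secrecy and uniformity come for free: each codeword covers at most a
  \<open>2 ^ (- N I(U; X~))\<close> fraction of the source words, so \<open>H(S, M)\<close> is nearly \<open>log |S| + log |M|\<close>. The
  same covering argument conditioned on \<open>X\<^sup>N\<close>, with Fano's inequality for \<open>H(S | M, X\<^sup>N)\<close>, bounds the
  leakage. Keys of lower rate are obtained by discarding a part of \<open>S\<close>.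
\<close>

section \<open>Entropy and Shannon-type inequalities\<close>

text \<open>All random variables are functions on one finitely supported pmf, and \<open>ent\<close>
  depends on such a function only through the partition of the support that it induces. The Shannon
  inequalities used are thus instances of one submodularity statement about partitions, and
  equivalent tuples are exchanged by \<open>ent_cong\<close>. The bounds on \<open>Rl\<close> and
  \<open>Rm\<close> in the region do not involve \<open>Rs\<close>. The code is therefore built for
  a rate just below \<open>I(U;Y)\<close> whatever the wanted key rate, and a smaller key is cut out
  afterwards without touching the helper data. The obstacle in achievability is that the encoder
  sees neither the source nor the decoder's word, so it cannot select a codeword that is typical
  with them. Asking for typicality with most continuations of the observed word turns this into an
  averaging argument. That argument works for one abstract letter with free exponents; concentration
  enters only when a block is substituted for the letter.\<close>

abbreviation pr :: "'o pmf \<Rightarrow> ('o \<Rightarrow> 'a) \<Rightarrow> 'a \<Rightarrow> real" where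
  "pr p A a \<equiv> pmf (map_pmf A p) a"

definition ent :: "'o pmf \<Rightarrow> ('o \<Rightarrow> 'a) \<Rightarrow> real" where
  "ent p A = entropy_pmf (map_pmf A p)"

lemma sum_set_pmf_eq_expectation:
  fixes g :: "'a \<Rightarrow> real"
  assumes "finite (set_pmf p)"
  shows "(\<Sum>a\<in>set_pmf p. pmf p a * g a) = measure_pmf.expectation p g"
  by (subst integral_measure_pmf_real[of "set_pmf p"]) (auto simp: assms mult.commute)

lemma sum_map_pmf:
  fixes g :: "'a \<Rightarrow> real"
  assumes "finite (set_pmf p)"
  shows "(\<Sum>a\<in>A ` set_pmf p. pr p A a * g a) = (\<Sum>w\<in>set_pmf p. pmf p w * g (A w))"
  using sum_set_pmf_eq_expectation[of "map_pmf A p" g]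
    sum_set_pmf_eq_expectation[of p "\<lambda>w. g (A w)"] assms by simp

lemma pr_eq_sum:
  assumes "finite (set_pmf p)"
  shows "pr p A a = (\<Sum>w\<in>{w\<in>set_pmf p. A w = a}. pmf p w)"
proof -
  have "pr p A a = measure_pmf.prob p (A -` {a} \<inter> set_pmf p)"
    by (simp add: pmf_map measure_Int_set_pmf)
  also have "A -` {a} \<inter> set_pmf p = {w\<in>set_pmf p. A w = a}" by auto
  finally show ?thesis using assms by (simp add: measure_measure_pmf_finite)
qed

lemma prob_eq_sum:
  assumes "finite (set_pmf p)"
  shows "measure_pmf.prob p E = (\<Sum>w\<in>set_pmf p. pmf p w * indicator E w)"
  using sum_set_pmf_eq_expectation[OF assms, of "indicator E"] by simp

lemma pr_pos: "w \<in> set_pmf p \<Longrightarrow> 0 < pr p A (A w)"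
  by (rule pmf_positive) simp

lemma sum_pmf_set [simp]: "finite (set_pmf p) \<Longrightarrow> (\<Sum>w\<in>set_pmf p. pmf p w) = 1"
  by (rule sum_pmf_eq_1) auto

lemma sum_pr_eq_1: "finite (set_pmf p) \<Longrightarrow> (\<Sum>a\<in>A ` set_pmf p. pr p A a) = 1"
  by (rule sum_pmf_eq_1) auto

lemma pr_marginal:
  assumes "finite (set_pmf p)"
  shows "(\<Sum>a\<in>A ` set_pmf p. pr p (\<lambda>w. (A w, C w)) (a, c)) = pr p C c"
proof -
  have "{w \<in> set_pmf p. C w = c} = (\<Union>a\<in>A ` set_pmf p. {w \<in> set_pmf p. (A w, C w) = (a, c)})"
    by auto
  then have "pr p C c = sum (pmf p) (\<Union>a\<in>A ` set_pmf p. {w \<in> set_pmf p. (A w, C w) = (a, c)})"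
    using pr_eq_sum[OF assms, of C c] by simp
  also have "\<dots> = (\<Sum>a\<in>A ` set_pmf p. \<Sum>w\<in>{w \<in> set_pmf p. (A w, C w) = (a, c)}. pmf p w)"
    by (rule sum.UNION_disjoint) (use assms in auto)
  finally show ?thesis by (simp add: pr_eq_sum[OF assms])
qed

lemma ent_alt:
  assumes "finite (set_pmf p)"
  shows "ent p A = - (\<Sum>w\<in>set_pmf p. pmf p w * log 2 (pr p A (A w)))"
  using sum_map_pmf[OF assms, of A "\<lambda>a. log 2 (pr p A a)"]
  by (simp add: ent_def entropy_pmf_def)

lemma mutual_info_map_pmf:
  assumes fin: "finite (set_pmf p)"
  shows "mutual_info_pmf (map_pmf (\<lambda>w. (A w, B w)) p) = ent p A + ent p B - ent p (\<lambda>w. (A w, B w))"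
proof -
  let ?AB = "\<lambda>w. (A w, B w)"
  have "mutual_info_pmf (map_pmf ?AB p)
      = (\<Sum>w\<in>set_pmf p. pmf p w * log 2 (pr p ?AB (?AB w) / (pr p A (A w) * pr p B (B w))))"
    using sum_map_pmf[OF fin, of ?AB
      "\<lambda>ab. log 2 (pr p ?AB ab / (pr p A (fst ab) * pr p B (snd ab)))"]
    by (simp add: mutual_info_pmf_def pmf.map_comp o_def)
  also have "\<dots> = (\<Sum>w\<in>set_pmf p. pmf p w * log 2 (pr p ?AB (?AB w))
      - pmf p w * log 2 (pr p A (A w)) - pmf p w * log 2 (pr p B (B w)))"
  proof (rule sum.cong[OF refl])
    fix w assume "w \<in> set_pmf p"
    then have "0 < pr p A (A w)" "0 < pr p B (B w)" "0 < pr p ?AB (?AB w)"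
      by (auto intro: pr_pos)
    then show "pmf p w * log 2 (pr p ?AB (?AB w) / (pr p A (A w) * pr p B (B w))) =
        pmf p w * log 2 (pr p ?AB (?AB w))
      - pmf p w * log 2 (pr p A (A w)) - pmf p w * log 2 (pr p B (B w))"
      by (simp add: log_divide log_mult algebra_simps)
  qed
  finally show ?thesis by (simp add: ent_alt[OF fin] sum_subtractf)
qed

lemma pr_le_of_refine:
  assumes "finite (set_pmf p)" "w \<in> set_pmf p"
    and "\<And>v. v \<in> set_pmf p \<Longrightarrow> B v = B w \<Longrightarrow> A v = A w"
  shows "pr p B (B w) \<le> pr p A (A w)"
proof -
  have "{v \<in> set_pmf p. B v = B w} \<subseteq> {v \<in> set_pmf p. A v = A w}" using assms(3) by blast
  then show ?thesis unfolding pr_eq_sum[OF assms(1)] using assms(1) by (intro sum_mono2) simp_all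
qed

lemma ent_mono:
  assumes fin: "finite (set_pmf p)"
    and "\<And>v w. v \<in> set_pmf p \<Longrightarrow> w \<in> set_pmf p \<Longrightarrow> B v = B w \<Longrightarrow> A v = A w"
  shows "ent p A \<le> ent p B"
proof -
  have "(\<Sum>w\<in>set_pmf p. pmf p w * log 2 (pr p B (B w))) \<le> (\<Sum>w\<in>set_pmf p. pmf p w * log 2 (pr p A (A w)))"
  proof (intro sum_mono mult_left_mono)
    fix w assume w: "w \<in> set_pmf p"
    then have "pr p B (B w) \<le> pr p A (A w)" using assms(2) by (intro pr_le_of_refine[OF fin]) blast+
    then show "log 2 (pr p B (B w)) \<le> log 2 (pr p A (A w))"
      using pr_pos[OF w, of A] pr_pos[OF w, of B] by simp
  qed simp
  then show ?thesis by (simp add: ent_alt[OF fin])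
qed

lemma ent_cong:
  assumes "finite (set_pmf p)"
    and "\<And>v w. v \<in> set_pmf p \<Longrightarrow> w \<in> set_pmf p \<Longrightarrow> B v = B w \<longleftrightarrow> A v = A w"
  shows "ent p A = ent p B"
  by (intro antisym ent_mono[OF assms(1)]) (use assms(2) in blast)+

lemma ent_const [simp]: "ent p (\<lambda>_. c) = 0"
  by (simp add: ent_def entropy_pmf_def)

section \<open>Gibbs' inequality, submodularity and Fano's inequality\<close>

text \<open>Follows from the tangent bound \<open>ln r \<le> r - 1\<close>. In the uses below
  \<open>r\<close> is a nonnegative weight divided by the true law, so the hypothesis on the sum
  says that the weight has total mass at most 1.\<close>

lemma gibbs:
  assumes fin: "finite (set_pmf p)" and pos: "\<And>w. w \<in> set_pmf p \<Longrightarrow> 0 < r w"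
    and le: "(\<Sum>w\<in>set_pmf p. pmf p w * r w) \<le> 1"
  shows "(\<Sum>w\<in>set_pmf p. pmf p w * log 2 (r w)) \<le> 0"
proof -
  have "(\<Sum>w\<in>set_pmf p. pmf p w * log 2 (r w)) \<le> (\<Sum>w\<in>set_pmf p. pmf p w * ((r w - 1) / ln 2))"
    unfolding log_def
    by (intro sum_mono mult_left_mono divide_right_mono ln_le_minus_one) (auto simp: pos)
  also have "\<dots> = ((\<Sum>w\<in>set_pmf p. pmf p w * r w) - 1) / ln 2"
    using fin by (simp add: right_diff_distrib sum_subtractf flip: sum_divide_distrib)
  also have "\<dots> \<le> 0" using le by (simp add: divide_nonpos_pos)
  finally show ?thesis .
qed

text \<open>Nonnegativity of the mutual information of \<open>A\<close> and \<open>B\<close> given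
  \<open>C\<close>: Gibbs' inequality against the law that keeps both pair marginals and makes
  \<open>A\<close> and \<open>B\<close> conditionally independent.\<close>

lemma ent_submodular:
  assumes fin: "finite (set_pmf p)"
  shows "ent p (\<lambda>w. (A w, B w, C w)) + ent p C \<le> ent p (\<lambda>w. (A w, C w)) + ent p (\<lambda>w. (B w, C w))"
proof -
  let ?S = "set_pmf p"
  let ?ABC = "\<lambda>w. (A w, B w, C w)" and ?AC = "\<lambda>w. (A w, C w)" and ?BC = "\<lambda>w. (B w, C w)"
  define g where "g = (\<lambda>(a, b, c). pr p ?AC (a, c) * pr p ?BC (b, c) / pr p C c)"
  define r where "r w = g (?ABC w) / pr p ?ABC (?ABC w)" for w
  have pos: "0 < pr p C (C w)" "0 < pr p ?AC (?AC w)" "0 < pr p ?BC (?BC w)" "0 < pr p ?ABC (?ABC w)"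
    if "w \<in> ?S" for w using that by (auto intro: pr_pos)
  have "(\<Sum>w\<in>?S. pmf p w * r w) = (\<Sum>x\<in>?ABC ` ?S. pr p ?ABC x * (g x / pr p ?ABC x))"
    unfolding r_def by (rule sum_map_pmf[OF fin, symmetric])
  also have "\<dots> = (\<Sum>x\<in>?ABC ` ?S. g x)"
    using pos(4) by (intro sum.cong) force+
  \<comment> \<open>Enlarging the support of the triple to the full product adds nonnegative terms
    and lets the sum factor over \<open>a\<close> and \<open>b\<close> for each
    \<open>c\<close>.\<close>
  also have "\<dots> \<le> (\<Sum>x\<in>A ` ?S \<times> B ` ?S \<times> C ` ?S. g x)"
    by (rule sum_mono2) (use fin in \<open>auto simp: g_def\<close>)
  also have "\<dots> = (\<Sum>a\<in>A ` ?S. \<Sum>b\<in>B ` ?S. \<Sum>c\<in>C ` ?S. g (a, b, c))"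
    by (simp add: sum.cartesian_product split_def)
  also have "\<dots> = (\<Sum>a\<in>A ` ?S. \<Sum>c\<in>C ` ?S. \<Sum>b\<in>B ` ?S. g (a, b, c))"
    by (intro sum.cong refl sum.swap)
  also have "\<dots> = (\<Sum>c\<in>C ` ?S. \<Sum>a\<in>A ` ?S. \<Sum>b\<in>B ` ?S. g (a, b, c))"
    by (rule sum.swap)
  also have "\<dots> = (\<Sum>c\<in>C ` ?S. (\<Sum>a\<in>A ` ?S. pr p ?AC (a, c)) * (\<Sum>b\<in>B ` ?S. pr p ?BC (b, c)) / pr p C c)"
    by (simp add: g_def sum_product sum_divide_distrib)
  also have "\<dots> = (\<Sum>c\<in>C ` ?S. pr p C c)"
    using pos(1) by (intro sum.cong) (force simp: pr_marginal[OF fin])+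
  also have "\<dots> = 1" by (rule sum_pr_eq_1[OF fin])
  finally have "(\<Sum>w\<in>?S. pmf p w * log 2 (r w)) \<le> 0"
    using pos by (intro gibbs[OF fin]) (auto simp: r_def g_def)
  moreover have "(\<Sum>w\<in>?S. pmf p w * log 2 (r w)) =
      (\<Sum>w\<in>?S. pmf p w * log 2 (pr p ?AC (?AC w)) + pmf p w * log 2 (pr p ?BC (?BC w))
        - pmf p w * log 2 (pr p C (C w)) - pmf p w * log 2 (pr p ?ABC (?ABC w)))"
  proof (rule sum.cong[OF refl])
    fix w assume "w \<in> ?S"
    then show "pmf p w * log 2 (r w) = pmf p w * log 2 (pr p ?AC (?AC w)) + pmf p w * log 2 (pr p ?BC (?BC w))
        - pmf p w * log 2 (pr p C (C w)) - pmf p w * log 2 (pr p ?ABC (?ABC w))"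
      using pos[of w] by (simp add: r_def g_def log_divide log_mult algebra_simps)
  qed
  ultimately show ?thesis
    by (simp add: ent_alt[OF fin] sum_subtractf sum.distrib)
qed

text \<open>Submodularity for partitions: \<open>X\<close> and \<open>Y\<close> may be any variables
  with the level sets of \<open>(A, C)\<close> and \<open>(B, C)\<close>, and \<open>Z\<close> any
  one with those of their common refinement. Reordered or redundant components of tuples are
  absorbed here.\<close>

lemma ent_submodular_refine:
  assumes fin: "finite (set_pmf p)"
    and X: "\<And>v w. v \<in> set_pmf p \<Longrightarrow> w \<in> set_pmf p \<Longrightarrow> X v = X w \<longleftrightarrow> A v = A w \<and> C v = C w"
    and Y: "\<And>v w. v \<in> set_pmf p \<Longrightarrow> w \<in> set_pmf p \<Longrightarrow> Y v = Y w \<longleftrightarrow> B v = B w \<and> C v = C w"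
    and Z: "\<And>v w. v \<in> set_pmf p \<Longrightarrow> w \<in> set_pmf p \<Longrightarrow> Z v = Z w \<longleftrightarrow> X v = X w \<and> Y v = Y w"
  shows "ent p Z + ent p C \<le> ent p X + ent p Y"
proof -
  have "ent p (\<lambda>w. (A w, B w, C w)) = ent p Z" by (rule ent_cong[OF fin]) (simp add: X Y Z, blast)
  moreover have "ent p (\<lambda>w. (A w, C w)) = ent p X" by (rule ent_cong[OF fin]) (simp add: X)
  moreover have "ent p (\<lambda>w. (B w, C w)) = ent p Y" by (rule ent_cong[OF fin]) (simp add: Y)
  ultimately show ?thesis using ent_submodular[OF fin, of A B C] by simp
qed

lemma ent_subadditive:
  assumes "finite (set_pmf p)"
  shows "ent p (\<lambda>w. (A w, B w)) \<le> ent p A + ent p B"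
  using ent_submodular_refine[OF assms, of A A "\<lambda>_. ()" B B "\<lambda>w. (A w, B w)"] by simp

lemma ent_markov_eq:
  assumes fin: "finite (set_pmf p)"
    and eq: "\<And>w. w \<in> set_pmf p \<Longrightarrow> pr p (\<lambda>w. (A w, B w, C w)) (A w, B w, C w) * pr p C (C w)
       = pr p (\<lambda>w. (A w, C w)) (A w, C w) * pr p (\<lambda>w. (B w, C w)) (B w, C w)"
  shows "ent p (\<lambda>w. (A w, B w, C w)) + ent p C = ent p (\<lambda>w. (A w, C w)) + ent p (\<lambda>w. (B w, C w))"
proof -
  let ?ABC = "\<lambda>w. (A w, B w, C w)" and ?AC = "\<lambda>w. (A w, C w)" and ?BC = "\<lambda>w. (B w, C w)"
  have "(\<Sum>w\<in>set_pmf p. pmf p w * (log 2 (pr p ?ABC (?ABC w)) + log 2 (pr p C (C w)))) =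
    (\<Sum>w\<in>set_pmf p. pmf p w * (log 2 (pr p ?AC (?AC w)) + log 2 (pr p ?BC (?BC w))))"
  proof (rule sum.cong[OF refl])
    fix w assume w: "w \<in> set_pmf p"
    have pos: "0 < pr p C (C w)" "0 < pr p ?AC (?AC w)" "0 < pr p ?BC (?BC w)" "0 < pr p ?ABC (?ABC w)"
      using w by (auto intro: pr_pos)
    then have "log 2 (pr p ?ABC (?ABC w)) + log 2 (pr p C (C w))
      = log 2 (pr p ?AC (?AC w)) + log 2 (pr p ?BC (?BC w))"
      using arg_cong[OF eq[OF w], of "log 2"] by (simp add: log_mult)
    then show "pmf p w * (log 2 (pr p ?ABC (?ABC w)) + log 2 (pr p C (C w))) =
      pmf p w * (log 2 (pr p ?AC (?AC w)) + log 2 (pr p ?BC (?BC w)))" by simp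
  qed
  then show ?thesis by (simp add: ent_alt[OF fin] distrib_left sum.distrib)
qed

text \<open>Gibbs' inequality against the uniform law on \<open>S\<close>.\<close>

lemma ent_le_log_card:
  assumes fin: "finite (set_pmf p)" and S: "finite S" "A ` set_pmf p \<subseteq> S"
  shows "ent p A \<le> log 2 (card S)"
proof -
  have "A ` set_pmf p \<noteq> {}" by (simp add: set_pmf_not_empty)
  then have card: "0 < card S" using S by (metis card_gt_0_iff subset_empty)
  have "(\<Sum>w\<in>set_pmf p. pmf p w * (1 / (real (card S) * pr p A (A w))))
    = (\<Sum>a\<in>A ` set_pmf p. pr p A a * (1 / (real (card S) * pr p A a)))"
    by (rule sum_map_pmf[OF fin, symmetric])
  also have "\<dots> = (\<Sum>a\<in>A ` set_pmf p. 1 / real (card S))"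
    using pr_pos[of _ p A] by (intro sum.cong) force+
  also have "\<dots> \<le> 1" using card_mono[OF S] card by (simp add: divide_le_eq)
  finally have "(\<Sum>w\<in>set_pmf p. pmf p w * log 2 (1 / (real (card S) * pr p A (A w)))) \<le> 0"
    using card by (intro gibbs[OF fin]) (simp_all add: pr_pos)
  also have "(\<Sum>w\<in>set_pmf p. pmf p w * log 2 (1 / (real (card S) * pr p A (A w))))
    = (\<Sum>w\<in>set_pmf p. - (pmf p w * log 2 (pr p A (A w))) - pmf p w * log 2 (card S))"
  proof (rule sum.cong[OF refl])
    fix w assume "w \<in> set_pmf p"
    then show "pmf p w * log 2 (1 / (real (card S) * pr p A (A w))) =
       - (pmf p w * log 2 (pr p A (A w))) - pmf p w * log 2 (card S)"
      using card pr_pos[of w p A] by (simp add: log_divide log_mult algebra_simps)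
  qed
  also have "\<dots> = ent p A - log 2 (card S)"
    using fin by (simp add: ent_alt[OF fin] sum_subtractf sum_negf flip: sum_distrib_right)
  finally show ?thesis by simp
qed

text \<open>Gibbs' inequality against a guessed conditional law of \<open>A\<close> given
  \<open>B\<close>: weight \<open>1 - e\<close> on the guess and \<open>e / card S\<close> on every
  other value. Building the given \<open>e\<close> into the guessed law, instead of the true error
  probability, yields a bound in terms of any upper bound on the error.\<close>

lemma fano:
  fixes A B :: "'o \<Rightarrow> 'a"
  assumes fin: "finite (set_pmf p)" and S: "finite S" "A ` set_pmf p \<subseteq> S"
    and e: "0 < e" "e < 1" and err: "measure_pmf.prob p {w. A w \<noteq> B w} \<le> e"
  shows "ent p (\<lambda>w. (A w, B w)) - ent p B \<le> - log 2 (1 - e) - e * log 2 e + e * log 2 (card S)"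
proof -
  let ?S = "set_pmf p" and ?AB = "\<lambda>w. (A w, B w)"
  have "A ` set_pmf p \<noteq> {}" by (simp add: set_pmf_not_empty)
  then have card: "0 < card S" using S by (metis card_gt_0_iff subset_empty)
  define q :: "'a \<times> 'a \<Rightarrow> real" where "q = (\<lambda>(a, b). if a = b then 1 - e else e / card S)"
  have qpos: "0 < q x" for x using e card by (auto simp: q_def split_def)
  define r where "r w = pr p B (B w) * q (?AB w) / pr p ?AB (?AB w)" for w
  have pos: "0 < pr p B (B w)" "0 < pr p ?AB (?AB w)" if "w \<in> ?S" for w
    using that by (auto intro: pr_pos)
  \<comment> \<open>Only an inequality, since the guess \<open>b\<close> may lie outside
    \<open>S\<close>.\<close>
  have qsum: "(\<Sum>a\<in>S. q (a, b)) \<le> 1" for b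
  proof -
    have "(\<Sum>a\<in>S. q (a, b)) \<le> (\<Sum>a\<in>S. (if a = b then 1 - e else 0) + e / card S)"
      using e by (intro sum_mono) (auto simp: q_def)
    also have "\<dots> \<le> 1" using e card S by (simp add: sum.distrib sum.delta)
    finally show ?thesis .
  qed
  have "(\<Sum>w\<in>?S. pmf p w * r w)
      = (\<Sum>x\<in>?AB ` ?S. pr p ?AB x * (pr p B (snd x) * q x / pr p ?AB x))"
    unfolding r_def using sum_map_pmf[OF fin, of ?AB "\<lambda>x. pr p B (snd x) * q x / pr p ?AB x"] by simp
  also have "\<dots> = (\<Sum>x\<in>?AB ` ?S. pr p B (snd x) * q x)"
    using pos(2) by (intro sum.cong) force+
  also have "\<dots> \<le> (\<Sum>x\<in>S \<times> B ` ?S. pr p B (snd x) * q x)"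
    by (rule sum_mono2) (use fin S qpos in \<open>auto simp: less_imp_le\<close>)
  also have "\<dots> = (\<Sum>a\<in>S. \<Sum>b\<in>B ` ?S. pr p B b * q (a, b))"
    by (simp add: sum.cartesian_product split_def)
  also have "\<dots> = (\<Sum>b\<in>B ` ?S. pr p B b * (\<Sum>a\<in>S. q (a, b)))"
    by (subst sum.swap) (simp add: sum_distrib_left)
  also have "\<dots> \<le> (\<Sum>b\<in>B ` ?S. pr p B b)"
    using qsum by (intro sum_mono) (simp add: mult_left_le)
  also have "\<dots> = 1" by (rule sum_pr_eq_1[OF fin])
  finally have "(\<Sum>w\<in>?S. pmf p w * log 2 (r w)) \<le> 0"
    using pos qpos by (intro gibbs[OF fin]) (auto simp: r_def)
  also have "(\<Sum>w\<in>?S. pmf p w * log 2 (r w)) =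
      (\<Sum>w\<in>?S. pmf p w * log 2 (pr p B (B w)) + pmf p w * log 2 (q (?AB w))
        - pmf p w * log 2 (pr p ?AB (?AB w)))"
  proof (rule sum.cong[OF refl])
    fix w assume "w \<in> ?S"
    then show "pmf p w * log 2 (r w) = pmf p w * log 2 (pr p B (B w)) + pmf p w * log 2 (q (?AB w))
        - pmf p w * log 2 (pr p ?AB (?AB w))"
      using pos[of w] qpos[of "?AB w"] by (simp add: r_def log_divide log_mult algebra_simps)
  qed
  finally have "ent p ?AB - ent p B \<le> - (\<Sum>w\<in>?S. pmf p w * log 2 (q (?AB w)))"
    by (simp add: ent_alt[OF fin] sum_subtractf sum.distrib)
  also have "\<dots> = (\<Sum>w\<in>?S. pmf p w * (- log 2 (q (?AB w))))"
    by (simp add: sum_negf)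
  \<comment> \<open>An error adds at most \<open>- log 2 e + log 2 (card S)\<close>; the nonnegative
    term \<open>- log 2 (1 - e)\<close> is charged to every outcome.\<close>
  also have "\<dots> \<le> (\<Sum>w\<in>?S. pmf p w * (- log 2 (1 - e)
      + indicator {w. A w \<noteq> B w} w * (- log 2 e + log 2 (card S))))"
  proof (intro sum_mono mult_left_mono)
    fix w show "- log 2 (q (?AB w)) \<le> - log 2 (1 - e)
      + indicator {w. A w \<noteq> B w} w * (- log 2 e + log 2 (card S))"
      using e card by (auto simp: q_def log_divide)
  qed simp
  also have "\<dots> = (\<Sum>w\<in>?S. pmf p w) * (- log 2 (1 - e))
      + (\<Sum>w\<in>?S. pmf p w * indicator {w. A w \<noteq> B w} w) * (- log 2 e + log 2 (card S))"
    unfolding sum_distrib_right sum.distrib[symmetric] by (simp only: distrib_left mult.assoc)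
  also have "\<dots> = - log 2 (1 - e) + measure_pmf.prob p {w. A w \<noteq> B w} * (- log 2 e + log 2 (card S))"
    unfolding prob_eq_sum[OF fin] using fin by simp
  also have "\<dots> \<le> - log 2 (1 - e) + e * (- log 2 e + log 2 (card S))"
    using e card err by (intro add_left_mono mult_right_mono) (auto intro!: add_nonneg_nonneg)
  finally show ?thesis by (simp add: algebra_simps)
qed

text \<open>The estimate \<open>B\<close> is a function of the side information \<open>V\<close>,
  and conditioning on \<open>V\<close> leaves no more uncertainty about \<open>A\<close> than
  conditioning on \<open>B\<close>.\<close>

lemma fano_side_info:
  assumes fin: "finite (set_pmf p)" and S: "finite S" "A ` set_pmf p \<subseteq> S"
    and e: "0 < e" "e < 1" and err: "measure_pmf.prob p {w. A w \<noteq> B w} \<le> e"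
    and B: "\<And>v w. v \<in> set_pmf p \<Longrightarrow> w \<in> set_pmf p \<Longrightarrow> V v = V w \<Longrightarrow> B v = B w"
  shows "ent p (\<lambda>w. (A w, V w)) - ent p V \<le> - log 2 (1 - e) - e * log 2 e + e * log 2 (card S)"
proof -
  have "ent p (\<lambda>w. (A w, V w)) + ent p B \<le> ent p (\<lambda>w. (A w, B w)) + ent p V"
    by (rule ent_submodular_refine[OF fin, where A = A and B = V]) (use B in blast)+
  then show ?thesis using fano[OF fin S e err] by linarith
qed

section \<open>Product distributions on lists\<close>

lemma ent_map_pmf: "ent (map_pmf f p) A = ent p (\<lambda>w. A (f w))"
  by (simp add: ent_def pmf.map_comp o_def)

lemma sum_pair_pmf:
  fixes g :: "'a \<times> 'b \<Rightarrow> real"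
  shows "(\<Sum>w\<in>set_pmf (pair_pmf p q). pmf (pair_pmf p q) w * g w)
    = (\<Sum>a\<in>set_pmf p. \<Sum>b\<in>set_pmf q. pmf p a * pmf q b * g (a, b))"
proof -
  have "(\<Sum>w\<in>set_pmf (pair_pmf p q). pmf (pair_pmf p q) w * g w)
    = (\<Sum>(a, b)\<in>set_pmf p \<times> set_pmf q. pmf p a * pmf q b * g (a, b))"
    by (intro sum.cong) (auto simp: pmf_pair)
  then show ?thesis by (simp add: sum.cartesian_product)
qed

lemma ent_pair_pmf:
  assumes fin: "finite (set_pmf p)" "finite (set_pmf q)"
  shows "ent (pair_pmf p q) (\<lambda>w. (f (fst w), g (snd w))) = ent p f + ent q g"
proof -
  have map: "map_pmf (\<lambda>w. (f (fst w), g (snd w))) (pair_pmf p q)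
      = pair_pmf (map_pmf f p) (map_pmf g q)"
    using map_pair[of f g p q] by (simp add: split_def)
  have fin': "finite (set_pmf (pair_pmf p q))" using fin by simp
  have "- ent (pair_pmf p q) (\<lambda>w. (f (fst w), g (snd w)))
      = (\<Sum>a\<in>set_pmf p. \<Sum>b\<in>set_pmf q. pmf p a * pmf q b * (log 2 (pr p f (f a)) + log 2 (pr q g (g b))))"
    unfolding ent_alt[OF fin'] map sum_pair_pmf minus_minus
  proof (intro sum.cong refl)
    fix a b assume "a \<in> set_pmf p" "b \<in> set_pmf q"
    then show "pmf p a * pmf q b * log 2 (pmf (pair_pmf (map_pmf f p) (map_pmf g q)) (f (fst (a, b)), g (snd (a, b))))
      = pmf p a * pmf q b * (log 2 (pr p f (f a)) + log 2 (pr q g (g b)))"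
      using pr_pos[of a p f] pr_pos[of b q g] by (simp add: pmf_pair log_mult)
  qed
  also have "\<dots> = (\<Sum>a\<in>set_pmf p. \<Sum>b\<in>set_pmf q. pmf p a * log 2 (pr p f (f a)) * pmf q b)
      + (\<Sum>a\<in>set_pmf p. \<Sum>b\<in>set_pmf q. pmf p a * (pmf q b * log 2 (pr q g (g b))))"
    by (simp only: sum.distrib[symmetric] distrib_left mult_ac)
  also have "\<dots> = - (ent p f + ent q g)"
    using fin by (simp add: ent_alt flip: sum_distrib_left sum_distrib_right)
  finally show ?thesis by simp
qed

lemma iid_pmf_Suc_pair: "iid_pmf (Suc n) p = map_pmf (\<lambda>w. fst w # snd w) (pair_pmf p (iid_pmf n p))"
  by (simp add: pair_pmf_def map_bind_pmf map_pmf_def bind_assoc_pmf bind_return_pmf)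

lemma finite_set_iid_pmf [simp]: "finite (set_pmf p) \<Longrightarrow> finite (set_pmf (iid_pmf n p))"
  by (induction n) auto

lemma length_iid_pmf: "l \<in> set_pmf (iid_pmf n p) \<Longrightarrow> length l = n"
  by (induction n arbitrary: l) auto

lemma set_iid_pmf: "l \<in> set_pmf (iid_pmf n p) \<Longrightarrow> set l \<subseteq> set_pmf p"
  by (induction n arbitrary: l) fastforce+

lemma pmf_iid_pmf: "pmf (iid_pmf (length l) p) l = (\<Prod>x\<leftarrow>l. pmf p x)"
proof (induction l)
  case (Cons a l)
  have "inj (\<lambda>w :: 'a \<times> 'a list. fst w # snd w)" by (auto intro!: injI)
  from pmf_map_inj'[OF this, of "pair_pmf p (iid_pmf (length l) p)" "(a, l)"]
  show ?case using Cons by (simp add: iid_pmf_Suc_pair pmf_pair del: iid_pmf.simps)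
qed simp

lemma map_iid_pmf: "map_pmf (map f) (iid_pmf n p) = iid_pmf n (map_pmf f p)"
proof (induction n)
  case (Suc n)
  then show ?case
    by (simp add: map_bind_pmf pmf.map_comp o_def bind_map_pmf flip: Suc)
qed simp

lemma iid_pmf_append:
  "iid_pmf (m + n) p = bind_pmf (iid_pmf m p) (\<lambda>as. map_pmf (\<lambda>bs. as @ bs) (iid_pmf n p))"
proof (induction m)
  case 0
  have "(@) [] = (\<lambda>bs :: 'a list. bs)" by auto
  then show ?case by (simp add: bind_return_pmf)
next
  case (Suc m)
  have "(@) (a # as) = (\<lambda>bs :: 'a list. a # as @ bs)" for a as by auto
  then show ?case
    by (simp add: Suc map_bind_pmf bind_assoc_pmf bind_map_pmf pmf.map_comp o_def)
qed

text \<open>Isolates the letter at position \<open>i\<close> as an independent last component;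
  single-letterization always plays one letter against all the others.\<close>

lemma iid_pmf_split:
  "iid_pmf (i + Suc k) p
    = map_pmf (\<lambda>w. fst (fst w) @ snd w # snd (fst w)) (pair_pmf (pair_pmf (iid_pmf i p) (iid_pmf k p)) p)"
proof -
  have "iid_pmf (i + Suc k) p
    = bind_pmf (iid_pmf i p) (\<lambda>as. bind_pmf p (\<lambda>a. bind_pmf (iid_pmf k p) (\<lambda>bs. return_pmf (as @ a # bs))))"
    unfolding iid_pmf_append by (simp add: map_bind_pmf pmf.map_comp o_def) (simp add: map_pmf_def)
  also have "\<dots> = bind_pmf (iid_pmf i p) (\<lambda>as. bind_pmf (iid_pmf k p) (\<lambda>bs. bind_pmf p (\<lambda>a. return_pmf (as @ a # bs))))"
    by (subst bind_commute_pmf) (rule refl)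
  finally show ?thesis
    by (simp add: pair_pmf_def map_bind_pmf bind_assoc_pmf bind_return_pmf)
qed

lemma ent_iid_pmf:
  assumes fin: "finite (set_pmf q)"
  shows "ent (iid_pmf n q) (map z) = n * ent q z"
proof (induction n)
  case 0
  then show ?case by (simp add: ent_def entropy_pmf_def)
next
  case (Suc n)
  have "ent (iid_pmf (Suc n) q) (map z) = ent (pair_pmf q (iid_pmf n q)) (\<lambda>w. map z (fst w # snd w))"
    unfolding iid_pmf_Suc_pair ent_map_pmf ..
  also have "\<dots> = ent (pair_pmf q (iid_pmf n q)) (\<lambda>w. (z (fst w), map z (snd w)))"
    by (rule ent_cong) (use fin in auto)
  also have "\<dots> = ent q z + ent (iid_pmf n q) (map z)"
    using fin by (simp add: ent_pair_pmf)
  finally show ?case using Suc by (simp add: algebra_simps)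
qed

section \<open>Second moments and Chebyshev's inequality\<close>

lemma sum_iid_pmf_Suc:
  fixes h :: "'a list \<Rightarrow> real"
  assumes fin: "finite (set_pmf p)"
  shows "(\<Sum>l\<in>set_pmf (iid_pmf (Suc n) p). pmf (iid_pmf (Suc n) p) l * h l)
    = (\<Sum>a\<in>set_pmf p. \<Sum>l\<in>set_pmf (iid_pmf n p). pmf p a * pmf (iid_pmf n p) l * h (a # l))"
proof -
  have "set_pmf (iid_pmf (Suc n) p) = (\<lambda>w. fst w # snd w) ` set_pmf (pair_pmf p (iid_pmf n p))"
    unfolding iid_pmf_Suc_pair by simp
  then show ?thesis
    using sum_map_pmf[of "pair_pmf p (iid_pmf n p)" "\<lambda>w. fst w # snd w" h] fin
    unfolding iid_pmf_Suc_pair[symmetric] sum_pair_pmf by (simp del: iid_pmf.simps)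
qed

lemma iid_pmf_moments:
  fixes g :: "'a \<Rightarrow> real"
  assumes fin: "finite (set_pmf p)" and mean: "(\<Sum>a\<in>set_pmf p. pmf p a * g a) = 0"
  shows "(\<Sum>l\<in>set_pmf (iid_pmf n p). pmf (iid_pmf n p) l * (\<Sum>x\<leftarrow>l. g x)) = 0
    \<and> (\<Sum>l\<in>set_pmf (iid_pmf n p). pmf (iid_pmf n p) l * (\<Sum>x\<leftarrow>l. g x)\<^sup>2)
      = n * (\<Sum>a\<in>set_pmf p. pmf p a * (g a)\<^sup>2)"
proof (induction n)
  case 0
  then show ?case by simp
next
  case (Suc n)
  let ?L = "set_pmf (iid_pmf n p)" and ?P = "pmf (iid_pmf n p)"
  have one: "(\<Sum>l\<in>?L. ?P l) = 1" "(\<Sum>a\<in>set_pmf p. pmf p a) = 1" using fin by simp_all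
  have "(\<Sum>a\<in>set_pmf p. \<Sum>l\<in>?L. pmf p a * ?P l * (\<Sum>x\<leftarrow>a # l. g x))
    = (\<Sum>a\<in>set_pmf p. pmf p a * g a) * (\<Sum>l\<in>?L. ?P l)
      + (\<Sum>a\<in>set_pmf p. pmf p a) * (\<Sum>l\<in>?L. ?P l * (\<Sum>x\<leftarrow>l. g x))"
    unfolding sum_product sum.distrib[symmetric] by (intro sum.cong refl) (simp add: algebra_simps)
  moreover have "(\<Sum>a\<in>set_pmf p. \<Sum>l\<in>?L. pmf p a * ?P l * (\<Sum>x\<leftarrow>a # l. g x)\<^sup>2)
    = (\<Sum>a\<in>set_pmf p. pmf p a * (g a)\<^sup>2) * (\<Sum>l\<in>?L. ?P l)
      + (\<Sum>a\<in>set_pmf p. pmf p a * g a) * (\<Sum>l\<in>?L. ?P l * (2 * (\<Sum>x\<leftarrow>l. g x)))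
      + (\<Sum>a\<in>set_pmf p. pmf p a) * (\<Sum>l\<in>?L. ?P l * (\<Sum>x\<leftarrow>l. g x)\<^sup>2)"
    unfolding sum_product sum.distrib[symmetric]
    by (intro sum.cong refl) (simp add: algebra_simps power2_eq_square)
  ultimately show ?case
    using Suc mean one unfolding sum_iid_pmf_Suc[OF fin] by (simp add: algebra_simps)
qed

lemma iid_pmf_chebyshev:
  fixes f :: "'a \<Rightarrow> real"
  assumes fin: "finite (set_pmf p)" and t: "0 < t" and n: "0 < n"
  defines "\<mu> \<equiv> (\<Sum>a\<in>set_pmf p. pmf p a * f a)"
  shows "measure_pmf.prob (iid_pmf n p) {l. \<bar>(\<Sum>x\<leftarrow>l. f x) - n * \<mu>\<bar> > n * t}
    \<le> (\<Sum>a\<in>set_pmf p. pmf p a * (f a - \<mu>)\<^sup>2) / (n * t\<^sup>2)"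
proof -
  let ?g = "\<lambda>a. f a - \<mu>" and ?P = "iid_pmf n p"
  have mean: "(\<Sum>a\<in>set_pmf p. pmf p a * ?g a) = 0"
    using fin by (simp add: right_diff_distrib sum_subtractf \<mu>_def flip: sum_distrib_right)
  have g: "(\<Sum>x\<leftarrow>l. ?g x) = (\<Sum>x\<leftarrow>l. f x) - length l * \<mu>" for l
    by (induction l) (simp_all add: algebra_simps)
  have "measure_pmf.prob ?P {l. \<bar>(\<Sum>x\<leftarrow>l. f x) - n * \<mu>\<bar> > n * t}
    \<le> (\<Sum>l\<in>set_pmf ?P. pmf ?P l * ((\<Sum>x\<leftarrow>l. ?g x)\<^sup>2 / (n * t)\<^sup>2))"
    unfolding prob_eq_sum[OF finite_set_iid_pmf[OF fin]]
  proof (intro sum_mono mult_left_mono)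
    fix l assume "l \<in> set_pmf ?P"
    then have "length l = n" by (rule length_iid_pmf)
    moreover have "(n * t)\<^sup>2 \<le> x\<^sup>2" if "\<bar>x\<bar> > n * t" for x :: real
      using that t power_mono[of "n * t" "\<bar>x\<bar>" 2] by simp
    ultimately show "indicator {l. \<bar>(\<Sum>x\<leftarrow>l. f x) - n * \<mu>\<bar> > n * t} l \<le> (\<Sum>x\<leftarrow>l. ?g x)\<^sup>2 / (n * t)\<^sup>2"
      using t n unfolding g by (auto simp: indicator_def le_divide_eq)
  qed simp
  also have "\<dots> = (n * (\<Sum>a\<in>set_pmf p. pmf p a * (?g a)\<^sup>2)) / (n * t)\<^sup>2"
    using iid_pmf_moments[OF fin mean, of n] by (simp flip: sum_divide_distrib)
  also have "\<dots> = (\<Sum>a\<in>set_pmf p. pmf p a * (?g a)\<^sup>2) / (n * t\<^sup>2)"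
    using n by (simp add: power_mult_distrib power2_eq_square)
  finally show ?thesis .
qed

section \<open>Single-letterization\<close>

lemma ent_nth_iid_pmf:
  assumes fin: "finite (set_pmf q)" and i: "i < N"
  shows "ent (iid_pmf N q) (\<lambda>l. f (l ! i)) = ent q f"
proof -
  obtain k where N: "N = i + Suc k" using i less_iff_Suc_add by auto
  let ?D = "pair_pmf (pair_pmf (iid_pmf i q) (iid_pmf k q)) q"
  have "ent (iid_pmf N q) (\<lambda>l. f (l ! i)) = ent ?D (\<lambda>w. f (snd w))"
    unfolding N iid_pmf_split ent_map_pmf
    by (rule ent_cong) (use fin in \<open>auto simp: nth_append dest!: length_iid_pmf\<close>)
  also have "\<dots> = ent q f"
    using ent_map_pmf[of snd ?D f] by (simp add: map_snd_pair_pmf)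
  finally show ?thesis .
qed

lemma ent_iid_pmf_indep:
  assumes fin: "finite (set_pmf q)" and i: "i < N"
  shows "ent (iid_pmf N q) (\<lambda>l. ((take i l, drop (Suc i) l), f (l ! i)))
    = ent (iid_pmf N q) (\<lambda>l. (take i l, drop (Suc i) l)) + ent q f"
proof -
  obtain k where N: "N = i + Suc k" using i less_iff_Suc_add by auto
  let ?R = "pair_pmf (iid_pmf i q) (iid_pmf k q)"
  have proj: "take i (fst (fst w) @ snd w # snd (fst w)) = fst (fst w)"
    "drop (Suc i) (fst (fst w) @ snd w # snd (fst w)) = snd (fst w)"
    "(fst (fst w) @ snd w # snd (fst w)) ! i = snd w" if "w \<in> set_pmf (pair_pmf ?R q)" for w
  proof -
    have "length (fst (fst w)) = i" using that by (auto dest: length_iid_pmf)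
    then show "take i (fst (fst w) @ snd w # snd (fst w)) = fst (fst w)"
      "drop (Suc i) (fst (fst w) @ snd w # snd (fst w)) = snd (fst w)"
      "(fst (fst w) @ snd w # snd (fst w)) ! i = snd w" by (simp_all add: nth_append)
  qed
  have "ent (iid_pmf N q) (\<lambda>l. ((take i l, drop (Suc i) l), f (l ! i)))
    = ent (pair_pmf ?R q) (\<lambda>w. (id (fst w), f (snd w)))"
    unfolding N iid_pmf_split ent_map_pmf
    by (rule ent_cong) (use fin in \<open>simp_all add: proj prod_eq_iff del: set_pair_pmf take_append drop_append\<close>, simp)
  moreover have "ent (iid_pmf N q) (\<lambda>l. (take i l, drop (Suc i) l))
    = ent (pair_pmf ?R q) (\<lambda>w. id (fst w))"
    unfolding N iid_pmf_split ent_map_pmf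
    by (rule ent_cong) (use fin in \<open>simp_all add: proj prod_eq_iff del: set_pair_pmf take_append drop_append\<close>, simp)
  moreover have "ent (pair_pmf ?R q) (\<lambda>w. id (fst w)) = ent ?R id"
    using ent_map_pmf[of fst "pair_pmf ?R q" id] by (simp add: map_fst_pair_pmf)
  ultimately show ?thesis using fin by (simp only: ent_pair_pmf set_pair_pmf finite_cartesian_product finite_set_iid_pmf)
qed

text \<open>\<open>A\<close> reads the letter at position \<open>i\<close> only through
  \<open>a\<close>, so the chain from \<open>a\<close> over \<open>z\<close> to \<open>y\<close>
  lifts to one from \<open>A\<close> over \<open>z\<close> to \<open>y\<close> at that position. One
  direction is submodularity. For the other, the remaining letters together with \<open>a\<close>
  and \<open>z\<close> determine \<open>A\<close> and \<open>z\<close>, yet leave as much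
  uncertainty about \<open>y\<close> as \<open>z\<close> alone.\<close>

lemma ent_iid_pmf_markov:
  assumes fin: "finite (set_pmf q)" and i: "i < N"
    and markov: "ent q (\<lambda>l. (a l, z l, y l)) + ent q z = ent q (\<lambda>l. (a l, z l)) + ent q (\<lambda>l. (z l, y l))"
    and A: "\<And>l l'. l \<in> set_pmf (iid_pmf N q) \<Longrightarrow> l' \<in> set_pmf (iid_pmf N q) \<Longrightarrow>
      take i l = take i l' \<Longrightarrow> drop (Suc i) l = drop (Suc i) l' \<Longrightarrow> a (l ! i) = a (l' ! i) \<Longrightarrow> A l = A l'"
  shows "ent (iid_pmf N q) (\<lambda>l. (A l, z (l ! i), y (l ! i))) + ent q z
    = ent (iid_pmf N q) (\<lambda>l. (A l, z (l ! i))) + ent q (\<lambda>l. (z l, y l))"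
proof (rule antisym)
  let ?P = "iid_pmf N q"
  have fin': "finite (set_pmf ?P)" using fin by simp
  have "ent ?P (\<lambda>l. (A l, z (l ! i), y (l ! i))) + ent ?P (\<lambda>l. z (l ! i))
    \<le> ent ?P (\<lambda>l. (A l, z (l ! i))) + ent ?P (\<lambda>l. (z (l ! i), y (l ! i)))"
    by (rule ent_submodular_refine[OF fin', where A = A and B = "\<lambda>l. y (l ! i)"]) auto
  then show "ent ?P (\<lambda>l. (A l, z (l ! i), y (l ! i))) + ent q z
    \<le> ent ?P (\<lambda>l. (A l, z (l ! i))) + ent q (\<lambda>l. (z l, y l))"
    using ent_nth_iid_pmf[OF fin i, of z] ent_nth_iid_pmf[OF fin i, of "\<lambda>l. (z l, y l)"] by simp
  let ?R = "\<lambda>l. (take i l, drop (Suc i) l)"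
  have "ent ?P (\<lambda>l. (?R l, a (l ! i), z (l ! i), y (l ! i))) + ent ?P (\<lambda>l. (A l, z (l ! i)))
    \<le> ent ?P (\<lambda>l. (?R l, a (l ! i), z (l ! i))) + ent ?P (\<lambda>l. (A l, z (l ! i), y (l ! i)))"
    by (rule ent_submodular_refine[OF fin', where A = "\<lambda>l. (?R l, a (l ! i))" and B = "\<lambda>l. y (l ! i)"])
      (auto intro: A)
  then show "ent ?P (\<lambda>l. (A l, z (l ! i))) + ent q (\<lambda>l. (z l, y l))
    \<le> ent ?P (\<lambda>l. (A l, z (l ! i), y (l ! i))) + ent q z"
    using ent_iid_pmf_indep[OF fin i, of "\<lambda>l. (a l, z l)"]
      ent_iid_pmf_indep[OF fin i, of "\<lambda>l. (a l, z l, y l)"] markov by simp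
qed

text \<open>The converse uses the auxiliary variables \<open>U\<^sub>i = (S, M, Y\<^sup>i\<^sup>-\<^sup>1)\<close>; with indices
  starting at 0, \<open>take i\<close> is the past, and \<open>T\<close> stands for the pair of key and helper data.\<close>
definition auxU :: "('l \<Rightarrow> 'a) \<Rightarrow> ('l \<Rightarrow> 'c) \<Rightarrow> ('a list \<Rightarrow> 't) \<Rightarrow> nat \<Rightarrow> 'l list \<Rightarrow> 't \<times> 'c list" where
  "auxU a y T i l = (T (map a l), map y (take i l))"

context
  fixes q :: "'l pmf" and N :: nat and a :: "'l \<Rightarrow> 'a" and y :: "'l \<Rightarrow> 'c" and T :: "'a list \<Rightarrow> 't"
  assumes fin: "finite (set_pmf q)"
begin

text \<open>Chain rule: \<open>auxU\<close> at \<open>i\<close> together with \<open>y\<close> at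
  position \<open>i\<close> has the level sets of \<open>auxU\<close> at \<open>Suc i\<close>, so
  the sum telescopes; the proof in fact gives equality.\<close>

lemma sum_info_auxU_ge:
  "ent (iid_pmf N q) (\<lambda>l. T (map a l)) + ent (iid_pmf N q) (map y)
     - ent (iid_pmf N q) (\<lambda>l. (T (map a l), map y l))
   \<le> (\<Sum>i<N. ent q y - (ent (iid_pmf N q) (\<lambda>l. (auxU a y T i l, y (l ! i))) - ent (iid_pmf N q) (auxU a y T i)))"
proof -
  let ?P = "iid_pmf N q"
  have fin': "finite (set_pmf ?P)" using fin by simp
  have step: "ent ?P (\<lambda>l. (auxU a y T i l, y (l ! i))) = ent ?P (auxU a y T (Suc i))" if "i < N" for i
    by (rule ent_cong[OF fin'])
      (use that in \<open>auto simp: auxU_def take_Suc_conv_app_nth dest!: length_iid_pmf\<close>)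
  have "(\<Sum>i<N. ent q y - (ent ?P (\<lambda>l. (auxU a y T i l, y (l ! i))) - ent ?P (auxU a y T i)))
      = (\<Sum>i<N. ent q y + (ent ?P (auxU a y T i) - ent ?P (auxU a y T (Suc i))))"
    by (rule sum.cong) (auto simp: step)
  also have "\<dots> = N * ent q y + (ent ?P (auxU a y T 0) - ent ?P (auxU a y T N))"
    using sum_lessThan_telescope'[of "\<lambda>i. ent ?P (auxU a y T i)" N] by (simp add: sum.distrib)
  also have "ent ?P (auxU a y T 0) = ent ?P (\<lambda>l. T (map a l))"
    by (rule ent_cong[OF fin']) (auto simp: auxU_def)
  also have "ent ?P (auxU a y T N) = ent ?P (\<lambda>l. (T (map a l), map y l))"
    by (rule ent_cong[OF fin']) (auto simp: auxU_def dest!: length_iid_pmf)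
  finally show ?thesis using ent_iid_pmf[OF fin, of N y] by simp
qed

lemma sum_info_auxU_diff_le:
  assumes markov: "ent q (\<lambda>l. (a l, z l, y l)) + ent q z = ent q (\<lambda>l. (a l, z l)) + ent q (\<lambda>l. (z l, y l))"
  shows "(\<Sum>i<N. (ent q z - (ent (iid_pmf N q) (\<lambda>l. (auxU a y T i l, z (l ! i))) - ent (iid_pmf N q) (auxU a y T i)))
       - (ent q y - (ent (iid_pmf N q) (\<lambda>l. (auxU a y T i l, y (l ! i))) - ent (iid_pmf N q) (auxU a y T i))))
    \<le> (ent (iid_pmf N q) (map z) - ent (iid_pmf N q) (\<lambda>l. (T (map a l), map z l)))
      - (ent (iid_pmf N q) (map y) - ent (iid_pmf N q) (\<lambda>l. (T (map a l), map y l)))"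
proof -
  let ?P = "iid_pmf N q"
  have fin': "finite (set_pmf ?P)" using fin by simp
  \<comment> \<open>Hybrid words: the letters before \<open>i\<close> are seen through
    \<open>y\<close>, those from \<open>i\<close> on through \<open>z\<close>, so \<open>F 0\<close>
    carries \<open>z\<close> everywhere and \<open>F N\<close> carries \<open>y\<close>
    everywhere.\<close>
  define F where "F i = ent ?P (\<lambda>l. (auxU a y T i l, map z (drop i l)))" for i
  have step: "F i - F (Suc i) \<le> ent ?P (\<lambda>l. (auxU a y T i l, z (l ! i))) - ent ?P (\<lambda>l. (auxU a y T i l, y (l ! i)))"
    if i: "i < N" for i
  proof -
    \<comment> \<open>\<open>F i - F (Suc i)\<close> compares \<open>z\<close> and \<open>y\<close>
      at position \<open>i\<close> in the presence of \<open>?A'\<close>. By the Markov chain it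
      equals the uncertainty of \<open>z\<close> given \<open>?A'\<close> and \<open>y\<close>,
      minus the constant uncertainty of \<open>y\<close> given \<open>z\<close>. Removing the later
      letters of \<open>z\<close> from the conditioning only increases the first term.\<close>
    let ?A' = "\<lambda>l. (auxU a y T i l, map z (drop (Suc i) l))"
    have len: "length l = N" if "l \<in> set_pmf ?P" for l using that by (rule length_iid_pmf)
    have split: "l = take i l @ l ! i # drop (Suc i) l" if "l \<in> set_pmf ?P" for l
      using len[OF that] i by (simp add: id_take_nth_drop)
    have drop: "map z (drop i l) = z (l ! i) # map z (drop (Suc i) l)" if "l \<in> set_pmf ?P" for l
      using len[OF that] i Cons_nth_drop_Suc[of i l] by (metis list.simps(9))
    have take: "map y (take (Suc i) l) = map y (take i l) @ [y (l ! i)]" if "l \<in> set_pmf ?P" for l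
      using len[OF that] i by (simp add: take_Suc_conv_app_nth)
    have map_eq: "map a l = map a l'"
      if "l \<in> set_pmf ?P" "l' \<in> set_pmf ?P" "take i l = take i l'" "drop (Suc i) l = drop (Suc i) l'"
        "a (l ! i) = a (l' ! i)" for l l'
    proof -
      have "map a l = map a (take i l @ l ! i # drop (Suc i) l)" using split[OF that(1)] by (rule arg_cong)
      also have "\<dots> = map a (take i l' @ l' ! i # drop (Suc i) l')" using that(3-5) by simp
      also have "\<dots> = map a l'" using split[OF that(2)] by (intro arg_cong[of _ _ "map a"]) (rule sym)
      finally show ?thesis .
    qed
    have "F i = ent ?P (\<lambda>l. (?A' l, z (l ! i)))"
      unfolding F_def
      by (rule ent_cong[OF fin']) (auto simp: drop)
    moreover have "F (Suc i) = ent ?P (\<lambda>l. (?A' l, y (l ! i)))"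
      unfolding F_def
      by (rule ent_cong[OF fin']) (auto simp: auxU_def take)
    moreover have "ent ?P (\<lambda>l. (auxU a y T i l, z (l ! i), y (l ! i))) + ent q z
      = ent ?P (\<lambda>l. (auxU a y T i l, z (l ! i))) + ent q (\<lambda>l. (z l, y l))"
      by (rule ent_iid_pmf_markov[OF fin i markov]) (auto simp: auxU_def intro!: arg_cong[of _ _ T] map_eq)
    moreover have "ent ?P (\<lambda>l. (?A' l, z (l ! i), y (l ! i))) + ent q z
      = ent ?P (\<lambda>l. (?A' l, z (l ! i))) + ent q (\<lambda>l. (z l, y l))"
      by (rule ent_iid_pmf_markov[OF fin i markov]) (auto simp: auxU_def intro!: arg_cong[of _ _ T] map_eq)
    moreover have "ent ?P (\<lambda>l. (?A' l, z (l ! i), y (l ! i))) + ent ?P (\<lambda>l. (auxU a y T i l, y (l ! i)))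
      \<le> ent ?P (\<lambda>l. (auxU a y T i l, z (l ! i), y (l ! i))) + ent ?P (\<lambda>l. (?A' l, y (l ! i)))"
      by (rule ent_submodular_refine[OF fin', where A = "\<lambda>l. z (l ! i)" and B = ?A']) auto
    ultimately show ?thesis by linarith
  qed
  have "(\<Sum>i<N. (ent q z - (ent ?P (\<lambda>l. (auxU a y T i l, z (l ! i))) - ent ?P (auxU a y T i)))
       - (ent q y - (ent ?P (\<lambda>l. (auxU a y T i l, y (l ! i))) - ent ?P (auxU a y T i))))
    \<le> (\<Sum>i<N. (ent q z - ent q y) - (F i - F (Suc i)))"
  proof (rule sum_mono)
    fix i assume "i \<in> {..<N}"
    then show "(ent q z - (ent ?P (\<lambda>l. (auxU a y T i l, z (l ! i))) - ent ?P (auxU a y T i)))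
       - (ent q y - (ent ?P (\<lambda>l. (auxU a y T i l, y (l ! i))) - ent ?P (auxU a y T i)))
      \<le> (ent q z - ent q y) - (F i - F (Suc i))"
      using step[of i] by simp
  qed
  also have "\<dots> = N * ent q z - N * ent q y - (F 0 - F N)"
    unfolding sum_subtractf[of _ "\<lambda>i. F i - F (Suc i)"] sum_lessThan_telescope' by (simp add: algebra_simps)
  also have "F 0 = ent ?P (\<lambda>l. (T (map a l), map z l))"
    unfolding F_def by (rule ent_cong[OF fin']) (auto simp: auxU_def)
  also have "F N = ent ?P (\<lambda>l. (T (map a l), map y l))"
    unfolding F_def by (rule ent_cong[OF fin']) (auto simp: auxU_def dest!: length_iid_pmf)
  finally show ?thesis using ent_iid_pmf[OF fin, of N y] ent_iid_pmf[OF fin, of N z] by linarith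
qed

end

section \<open>Conditional entropies as points of a convex hull\<close>

definition attach_pmf :: "'l pmf \<Rightarrow> ('l \<Rightarrow> 'u pmf) \<Rightarrow> ('u \<times> 'l) pmf" where
  "attach_pmf q K = bind_pmf q (\<lambda>l. map_pmf (\<lambda>u. (u, l)) (K l))"

lemma pmf_attach_pmf: "pmf (attach_pmf q K) (u, l) = pmf q l * pmf (K l) u"
proof -
  have "pmf (map_pmf (\<lambda>u. (u, l')) (K l')) (u, l) = indicator {l} l' * pmf (K l) u" for l'
  proof (cases "l' = l")
    case True
    then show ?thesis using pmf_map_inj'[of "\<lambda>u. (u, l)" "K l" u] by (simp add: inj_on_def)
  next
    case False
    then show ?thesis by (auto simp: pmf_eq_0_set_pmf)
  qed
  then show ?thesis unfolding attach_pmf_def pmf_bind by (simp add: measure_pmf_single)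
qed

lemma map_snd_attach_pmf [simp]: "map_pmf snd (attach_pmf q K) = q"
  by (simp add: attach_pmf_def map_bind_pmf pmf.map_comp o_def bind_return_pmf')

lemma finite_attach_pmf [simp]:
  "finite (set_pmf q) \<Longrightarrow> (\<And>l. l \<in> set_pmf q \<Longrightarrow> finite (set_pmf (K l))) \<Longrightarrow> finite (set_pmf (attach_pmf q K))"
  by (simp add: attach_pmf_def)

lemma map_attach_pmf:
  "map_pmf (\<lambda>w. (fst w, h (snd w))) (attach_pmf q (\<lambda>l. K (h l))) = attach_pmf (map_pmf h q) K"
  by (simp add: attach_pmf_def map_bind_pmf bind_map_pmf pmf.map_comp o_def)

lemma ent_attach_pmf_snd: "ent (attach_pmf q K) (\<lambda>w. f (snd w)) = ent q f"
  using ent_map_pmf[of snd "attach_pmf q K" f] by simp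

text \<open>A letter of probability 0 gets the zero row, by division by 0.\<close>

definition chan :: "'l pmf \<Rightarrow> ('l \<Rightarrow> 'a) \<Rightarrow> ('l \<Rightarrow> 'v) \<Rightarrow> 'a \<Rightarrow> 'v \<Rightarrow> real" where
  "chan q A f a v = pr q (\<lambda>w. (A w, f w)) (a, v) / pr q A a"

text \<open>The output entropy of the channel \<open>chan q A f\<close> as a function of its input
  law \<open>p\<close>, on vectors, so that continuity and convex hulls in Euclidean space
  apply.\<close>

definition out_ent :: "'l pmf \<Rightarrow> ('l \<Rightarrow> 'a) \<Rightarrow> ('l \<Rightarrow> 'v::finite) \<Rightarrow> real ^ 'a::finite \<Rightarrow> real" where
  "out_ent q A f p = - (\<Sum>v\<in>UNIV. (\<Sum>a\<in>UNIV. p $ a * chan q A f a v) * log 2 (\<Sum>a\<in>UNIV. p $ a * chan q A f a v))"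

lemma pr_marginal_UNIV:
  fixes A :: "'o \<Rightarrow> 'a::finite"
  assumes "finite (set_pmf p)"
  shows "(\<Sum>a\<in>UNIV. pr p (\<lambda>w. (A w, C w)) (a, c)) = pr p C c"
proof -
  have "(\<Sum>a\<in>UNIV. pr p (\<lambda>w. (A w, C w)) (a, c)) = (\<Sum>a\<in>A ` set_pmf p. pr p (\<lambda>w. (A w, C w)) (a, c))"
    by (rule sum.mono_neutral_right) (auto simp: pmf_eq_0_set_pmf)
  then show ?thesis using pr_marginal[OF assms] by simp
qed

text \<open>The kernel sees \<open>l\<close> only through \<open>A l\<close>. Hence, given a value
  of the auxiliary variable, \<open>f\<close> is the output of the fixed channel from
  \<open>A\<close> to \<open>f\<close> fed with the posterior law of \<open>A\<close>, and the
  kernel enters only through the posteriors and their weights.\<close>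

lemma cond_ent_attach_pmf:
  fixes A :: "'l \<Rightarrow> 'a::finite" and f :: "'l \<Rightarrow> 'v::finite"
  assumes finq: "finite (set_pmf q)" and finK: "\<And>a. finite (set_pmf (K a))"
  defines "P \<equiv> attach_pmf q (\<lambda>l. K (A l))"
  shows "ent P (\<lambda>w. (fst w, f (snd w))) - ent P fst
    = (\<Sum>u\<in>fst ` set_pmf P. pr P fst u * out_ent q A f (\<chi> a. pr P (\<lambda>w. (fst w, A (snd w))) (u, a) / pr P fst u))"
proof -
  have fin: "finite (set_pmf P)" unfolding P_def using finq finK by simp
  have UA: "pr P (\<lambda>w. (fst w, A (snd w))) (u, a) = pr q A a * pmf (K a) u" for u a
    unfolding P_def map_attach_pmf pmf_attach_pmf ..
  have UAf: "pr P (\<lambda>w. (fst w, A (snd w), f (snd w))) (u, a, v) = pr q (\<lambda>l. (A l, f l)) (a, v) * pmf (K a) u" for u a v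
    using map_attach_pmf[of "\<lambda>l. (A l, f l)" q "\<lambda>b. K (fst b)"] by (simp add: P_def pmf_attach_pmf)
  have chan0: "pr q (\<lambda>l. (A l, f l)) (a, v) = 0" if "pr q A a = 0" for a v
    using that by (auto simp: pmf_eq_0_set_pmf)
  have swap: "pr P (\<lambda>w. (fst w, A (snd w), f (snd w))) (u, a, v)
    = pr P (\<lambda>w. (A (snd w), (fst w, f (snd w)))) (a, (u, v))" for u a v
    unfolding pr_eq_sum[OF fin] by (rule sum.cong) auto
  have out: "(\<Sum>a\<in>UNIV. (\<chi> a. pr P (\<lambda>w. (fst w, A (snd w))) (u, a) / pr P fst u) $ a * chan q A f a v)
    = pr P (\<lambda>w. (fst w, f (snd w))) (u, v) / pr P fst u" for u v
  proof -
    have e: "(\<chi> a. pr P (\<lambda>w. (fst w, A (snd w))) (u, a) / pr P fst u) $ a * chan q A f a v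
      = pr P (\<lambda>w. (A (snd w), (fst w, f (snd w)))) (a, (u, v)) / pr P fst u" for a
      using chan0[of a v] unfolding swap[symmetric] UA UAf chan_def by simp
    show ?thesis
      by (simp only: e sum_divide_distrib[symmetric] pr_marginal_UNIV[OF fin, of "\<lambda>w. A (snd w)"])
  qed
  let ?Uf = "\<lambda>w. (fst w, f (snd w))"
  have "ent P ?Uf - ent P fst
    = - (\<Sum>w\<in>set_pmf P. pmf P w * (log 2 (pr P ?Uf (?Uf w)) - log 2 (pr P fst (fst w))))"
    by (simp add: ent_alt[OF fin] right_diff_distrib sum_subtractf)
  also have "\<dots> = - (\<Sum>w\<in>set_pmf P. pmf P w * log 2 (pr P ?Uf (?Uf w) / pr P fst (fst (?Uf w))))"
  proof (intro arg_cong[of _ _ uminus] sum.cong refl)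
    fix w assume w: "w \<in> set_pmf P"
    show "pmf P w * (log 2 (pr P ?Uf (?Uf w)) - log 2 (pr P fst (fst w)))
      = pmf P w * log 2 (pr P ?Uf (?Uf w) / pr P fst (fst (?Uf w)))"
      using pr_pos[OF w, of ?Uf] pr_pos[OF w, of fst] by (simp add: log_divide)
  qed
  also have "\<dots> = - (\<Sum>x\<in>?Uf ` set_pmf P. pr P ?Uf x * log 2 (pr P ?Uf x / pr P fst (fst x)))"
    by (subst sum_map_pmf[OF fin]) (rule refl)
  also have "(\<Sum>x\<in>?Uf ` set_pmf P. pr P ?Uf x * log 2 (pr P ?Uf x / pr P fst (fst x)))
    = (\<Sum>x\<in>fst ` set_pmf P \<times> UNIV. pr P ?Uf x * log 2 (pr P ?Uf x / pr P fst (fst x)))"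
    by (rule sum.mono_neutral_left) (use fin in \<open>auto simp: pmf_eq_0_set_pmf\<close>)
  also have "\<dots> = (\<Sum>u\<in>fst ` set_pmf P. \<Sum>v\<in>UNIV. pr P ?Uf (u, v) * log 2 (pr P ?Uf (u, v) / pr P fst u))"
    by (simp add: sum.cartesian_product split_def)
  also have "\<dots> = (\<Sum>u\<in>fst ` set_pmf P. pr P fst u * (\<Sum>v\<in>UNIV. pr P ?Uf (u, v) / pr P fst u * log 2 (pr P ?Uf (u, v) / pr P fst u)))"
    unfolding sum_distrib_left by (intro sum.cong refl) (auto dest!: pr_pos[of _ P fst])
  finally show ?thesis by (simp only: out_ent_def out mult_minus_right sum_negf)
qed

section \<open>The compact set of entropy tuples and its realization by test channels\<close>

definition psimplex :: "(real ^ 'a::finite) set" where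
  "psimplex = {p. (\<forall>a. 0 \<le> p $ a) \<and> (\<Sum>a\<in>UNIV. p $ a) = 1}"

lemma compact_psimplex: "compact (psimplex :: (real ^ 'a::finite) set)"
proof (rule compact_eq_bounded_closed[THEN iffD2], intro conjI)
  have "norm p \<le> 1" if "p \<in> psimplex" for p :: "real ^ 'a"
    using norm_le_l1_cart[of p] that by (simp add: psimplex_def)
  then show "bounded (psimplex :: (real ^ 'a) set)" by (auto simp: bounded_iff)
  have "psimplex = (\<Inter>a. {p :: real ^ 'a. 0 \<le> p $ a}) \<inter> {p. (\<Sum>a\<in>UNIV. p $ a) = 1}"
    by (auto simp: psimplex_def)
  also have "closed \<dots>"
    by (intro closed_Int closed_INT ballI closed_Collect_le closed_Collect_eq continuous_intros)
  finally show "closed (psimplex :: (real ^ 'a) set)" .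
qed

lemma continuous_on_mult_log: "continuous_on {0..} (\<lambda>t :: real. t * log 2 t)"
proof (clarsimp simp: continuous_on_eq_continuous_within)
  fix t :: real assume "0 \<le> t"
  show "continuous (at t within {0..}) (\<lambda>t. t * log 2 t)"
  proof (cases "t = 0")
    case False
    then have "isCont (\<lambda>t. t * log 2 t) t" using \<open>0 \<le> t\<close> by (intro continuous_intros) auto
    then show ?thesis by (rule continuous_at_imp_continuous_at_within)
  next
    case True
    \<comment> \<open>From \<open>ln t \<le> t\<close> at \<open>t = 1 / sqrt s\<close>: the square
      root leaves a bound that vanishes at 0.\<close>
    have bound: "\<bar>s * log 2 s\<bar> \<le> 2 * sqrt s / ln 2" if "0 \<le> s" "s < 1" for s :: real
    proof (cases "s = 0")
      case False
      then have s: "0 < s" using that by simp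
      have "- ln s = 2 * ln (1 / sqrt s)" using s by (simp add: ln_div ln_sqrt)
      also have "\<dots> \<le> 2 * (1 / sqrt s)" using ln_bound[of "1 / sqrt s"] s by simp
      finally have "s * - ln s \<le> s * (2 * (1 / sqrt s))" using s by (intro mult_left_mono) auto
      also have "\<dots> = 2 * (s / sqrt s)" by simp
      also have "\<dots> = 2 * sqrt s" using s real_div_sqrt[of s] by simp
      finally have "\<bar>s * ln s\<bar> \<le> 2 * sqrt s" using s that by (simp add: abs_mult)
      then show ?thesis by (simp add: log_def divide_right_mono abs_divide)
    qed simp
    have "((\<lambda>s. s * log 2 s) \<longlongrightarrow> 0) (at 0 within {0..})"
    proof (rule Lim_null_comparison)
      show "\<forall>\<^sub>F s in at 0 within {0..}. norm (s * log 2 s) \<le> 2 * sqrt s / ln 2"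
        unfolding eventually_at using bound by (intro exI[of _ 1]) (auto simp: dist_real_def)
      have "((\<lambda>s :: real. 2 * sqrt s / ln 2) \<longlongrightarrow> 2 * sqrt 0 / ln 2) (at 0 within {0..})"
        by (intro tendsto_intros) auto
      then show "((\<lambda>s :: real. 2 * sqrt s / ln 2) \<longlongrightarrow> 0) (at 0 within {0..})" by simp
    qed
    then show ?thesis using True by (simp add: continuous_within)
  qed
qed

lemma continuous_on_out_ent: "continuous_on psimplex (out_ent q A f)"
proof -
  have "continuous_on psimplex (\<lambda>p. (\<Sum>a\<in>UNIV. p $ a * chan q A f a v) * log 2 (\<Sum>a\<in>UNIV. p $ a * chan q A f a v))" for v
  proof (rule continuous_on_compose2[OF continuous_on_mult_log])
    show "continuous_on psimplex (\<lambda>p. \<Sum>a\<in>UNIV. p $ a * chan q A f a v)"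
      by (intro continuous_intros)
    show "(\<lambda>p. \<Sum>a\<in>UNIV. p $ a * chan q A f a v) ` psimplex \<subseteq> {0..}"
      by (auto simp: psimplex_def chan_def intro!: sum_nonneg)
  qed
  then show ?thesis unfolding out_ent_def by (intro continuous_on_minus continuous_on_sum)
qed

text \<open>Keeping the input law as a coordinate turns the requirement that the posteriors average
  to the law of \<open>A\<close> into a closed slice of the hull.\<close>

definition ent_hull :: "'l pmf \<Rightarrow> ('l \<Rightarrow> 'a::finite) \<Rightarrow> ('l \<Rightarrow> 'b::finite) \<Rightarrow> ('l \<Rightarrow> 'c::finite)
    \<Rightarrow> ((real ^ 'a) \<times> real \<times> real \<times> real) set" where
  "ent_hull q A B C = convex hull ((\<lambda>p. (p, out_ent q A C p, out_ent q A B p, out_ent q A A p)) ` psimplex)"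

lemma compact_ent_hull: "compact (ent_hull q A B C)"
  unfolding ent_hull_def
  by (intro compact_convex_hull compact_continuous_image compact_psimplex continuous_intros continuous_on_out_ent)

lemma sum_triple:
  "sum f S = (\<Sum>i\<in>S. fst (f i), \<Sum>i\<in>S. fst (snd (f i)), \<Sum>i\<in>S. fst (snd (snd (f i))), \<Sum>i\<in>S. snd (snd (snd (f i))))"
  by (induction S rule: infinite_finite_induct) (simp_all add: prod_eq_iff)

text \<open>The convex combination has the posterior laws of \<open>A\<close> as points and the law
  of the auxiliary variable as weights. Its first coordinate averages to the law of
  \<open>A\<close>, the others to conditional entropies.\<close>

lemma attach_pmf_mem_ent_hull:
  fixes A :: "'l \<Rightarrow> 'a::finite" and B :: "'l \<Rightarrow> 'b::finite" and C :: "'l \<Rightarrow> 'c::finite"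
  assumes finq: "finite (set_pmf q)" and finK: "\<And>a. finite (set_pmf (K a))"
  defines "P \<equiv> attach_pmf q (\<lambda>l. K (A l))"
  shows "((\<chi> a. pr q A a), ent P (\<lambda>w. (fst w, C (snd w))) - ent P fst,
     ent P (\<lambda>w. (fst w, B (snd w))) - ent P fst, ent P (\<lambda>w. (fst w, A (snd w))) - ent P fst)
     \<in> ent_hull q A B C"
proof -
  have fin: "finite (set_pmf P)" unfolding P_def using finq finK by simp
  define pu where "pu u = (\<chi> a. pr P (\<lambda>w. (fst w, A (snd w))) (u, a) / pr P fst u)" for u
  let ?F = "\<lambda>p. (p, out_ent q A C p, out_ent q A B p, out_ent q A A p)"
  have pu: "pu u \<in> psimplex" if "u \<in> fst ` set_pmf P" for u
  proof -
    have "(\<Sum>a\<in>UNIV. pr P (\<lambda>w. (fst w, A (snd w))) (u, a)) = (\<Sum>a\<in>UNIV. pr P (\<lambda>w. (A (snd w), fst w)) (a, u))"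
      unfolding pr_eq_sum[OF fin] by (intro sum.cong refl) auto
    moreover have "0 < pr P fst u" using that by (auto intro: pr_pos)
    ultimately show ?thesis using pr_marginal_UNIV[OF fin, of "\<lambda>w. A (snd w)" fst u]
      by (simp add: pu_def psimplex_def flip: sum_divide_distrib)
  qed
  have "(\<Sum>u\<in>fst ` set_pmf P. pr P fst u *\<^sub>R ?F (pu u)) \<in> ent_hull q A B C"
    unfolding ent_hull_def
    by (rule convex_sum) (use fin pu in \<open>auto simp: sum_pr_eq_1 intro!: hull_inc\<close>)
  moreover have "(\<Sum>u\<in>fst ` set_pmf P. pr P fst u *\<^sub>R pu u) = (\<chi> a. pr q A a)"
  proof (simp add: vec_eq_iff, intro allI)
    fix a
    have "(\<Sum>u\<in>fst ` set_pmf P. pr P fst u * pu u $ a) = (\<Sum>u\<in>fst ` set_pmf P. pr P (\<lambda>w. (fst w, A (snd w))) (u, a))"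
      by (intro sum.cong refl) (auto simp: pu_def dest!: pr_pos[of _ P fst])
    also have "\<dots> = pr P (\<lambda>w. A (snd w)) a" by (rule pr_marginal[OF fin])
    also have "\<dots> = pr q A a" by (simp add: P_def flip: pmf.map_comp[unfolded o_def, of A snd])
    finally show "(\<Sum>u\<in>fst ` set_pmf P. pr P fst u * pu u $ a) = pr q A a" .
  qed
  ultimately show ?thesis
    using cond_ent_attach_pmf[where K = K and A = A and f = A, OF finq finK] cond_ent_attach_pmf[where K = K and A = A and f = B, OF finq finK]
      cond_ent_attach_pmf[where K = K and A = A and f = C, OF finq finK]
    unfolding sum_triple P_def[symmetric] pu_def[symmetric] by simp
qed

lemma finite_pmf_exists:
  fixes w :: "'i \<Rightarrow> real"
  assumes S: "finite S" and nn: "\<And>i. i \<in> S \<Longrightarrow> 0 \<le> w i" and one: "sum w S = 1"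
  obtains p where "set_pmf p \<subseteq> S" "\<And>i. i \<in> S \<Longrightarrow> pmf p i = w i"
proof -
  let ?w = "\<lambda>i. if i \<in> S then w i else 0"
  have "(\<integral>\<^sup>+ i. ennreal (?w i) \<partial>count_space UNIV) = (\<Sum>i\<in>S. ennreal (?w i))"
    by (rule nn_integral_count_space'[OF S]) auto
  also have "\<dots> = ennreal (\<Sum>i\<in>S. ?w i)"
    using nn by (subst sum_ennreal) auto
  also have "\<dots> = 1" using one by simp
  finally have *: "pmf (embed_pmf ?w) i = ?w i" for i
    using nn by (intro pmf_embed_pmf) auto
  show ?thesis
  proof (rule that[of "embed_pmf ?w"])
    show "set_pmf (embed_pmf ?w) \<subseteq> S" by (auto simp: set_pmf_eq * split: if_splits)
  qed (simp add: *)
qed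

text \<open>A letter \<open>a\<close> of probability 0 gets an arbitrary kernel; this is harmless because then every
  term \<open>c i * p i $ a\<close> of the mixture vanishes.\<close>
lemma ent_hull_imp_attach_pmf:
  fixes A :: "'l \<Rightarrow> 'a::finite" and B :: "'l \<Rightarrow> 'b::finite" and C :: "'l \<Rightarrow> 'c::finite"
  assumes finq: "finite (set_pmf q)" and x: "x \<in> ent_hull q A B C" and fst: "fst x = (\<chi> a. pr q A a)"
  obtains K :: "'a \<Rightarrow> nat pmf" where "finite (\<Union>a. set_pmf (K a))"
    "let P = attach_pmf q (\<lambda>l. K (A l)) in
      snd x = (ent P (\<lambda>w. (fst w, C (snd w))) - ent P fst,
        ent P (\<lambda>w. (fst w, B (snd w))) - ent P fst, ent P (\<lambda>w. (fst w, A (snd w))) - ent P fst)"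
proof -
  let ?F = "\<lambda>p. (p, out_ent q A C p, out_ent q A B p, out_ent q A A p)"
  obtain k c y where cy: "\<forall>i\<in>{1::nat..k}. 0 \<le> c i \<and> y i \<in> ?F ` psimplex"
    and c1: "sum c {1..k} = 1" and xeq: "(\<Sum>i\<in>{1..k}. c i *\<^sub>R y i) = x"
    using x unfolding ent_hull_def convex_hull_indexed mem_Collect_eq by blast
  have c: "0 \<le> c i" and y: "y i \<in> ?F ` psimplex" if "i \<in> {1..k}" for i
    using cy that by blast+
  define p where "p i = fst (y i)" for i
  have yp: "y i = ?F (p i)" "p i \<in> psimplex" if "i \<in> {1..k}" for i
    using y[OF that] by (auto simp: p_def)
  have xs: "x = (\<Sum>i\<in>{1..k}. c i *\<^sub>R p i, \<Sum>i\<in>{1..k}. c i * out_ent q A C (p i),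
      \<Sum>i\<in>{1..k}. c i * out_ent q A B (p i), \<Sum>i\<in>{1..k}. c i * out_ent q A A (p i))"
    unfolding xeq[symmetric] sum_triple by (simp add: yp)
  have mix: "(\<Sum>i\<in>{1..k}. c i * p i $ a) = pr q A a" for a
    using arg_cong[OF fst, of "\<lambda>v. v $ a"] by (simp add: xs)
  have nn: "0 \<le> c i * p i $ a" if "i \<in> {1..k}" for i a
    using c[OF that] yp(2)[OF that] by (simp add: psimplex_def)
  \<comment> \<open>Bayes' rule: for \<open>c i\<close> and \<open>p i\<close> to become the law of
    the auxiliary variable and its posteriors, the kernel has to be
    \<open>c i * p i $ a / pr q A a\<close>. The default index 0 lies outside
    \<open>{1..k}\<close>.\<close>
  have "\<exists>r :: nat pmf. set_pmf r \<subseteq> {0..k} \<and> (pr q A a \<noteq> 0 \<longrightarrow>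
      set_pmf r \<subseteq> {1..k} \<and> (\<forall>i\<in>{1..k}. pmf r i = c i * p i $ a / pr q A a))" for a
  proof (cases "pr q A a = 0")
    case True
    then show ?thesis by (intro exI[of _ "return_pmf 0"]) auto
  next
    case False
    have "(\<Sum>i\<in>{1..k}. c i * p i $ a / pr q A a) = 1"
      using False mix[of a] by (simp flip: sum_divide_distrib)
    from finite_pmf_exists[OF _ _ this] obtain r
      where "set_pmf r \<subseteq> {1..k}" "\<And>i. i \<in> {1..k} \<Longrightarrow> pmf r i = c i * p i $ a / pr q A a"
      using nn by (metis finite_atLeastAtMost divide_nonneg_nonneg pmf_nonneg)
    then show ?thesis by (intro exI[of _ r]) force
  qed
  then obtain K :: "'a \<Rightarrow> nat pmf" where K: "\<And>a. set_pmf (K a) \<subseteq> {0..k}"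
    "\<And>a. pr q A a \<noteq> 0 \<Longrightarrow> set_pmf (K a) \<subseteq> {1..k}"
    "\<And>a i. pr q A a \<noteq> 0 \<Longrightarrow> i \<in> {1..k} \<Longrightarrow> pmf (K a) i = c i * p i $ a / pr q A a"
    by metis
  have finK: "finite (set_pmf (K a))" for a using K(1)[of a] by (rule finite_subset) simp
  define P where "P = attach_pmf q (\<lambda>l. K (A l))"
  have fin: "finite (set_pmf P)" unfolding P_def using finq finK by simp
  have UA: "pr P (\<lambda>w. (fst w, A (snd w))) (i, a) = c i * p i $ a" if i: "i \<in> {1..k}" for i a
  proof -
    have "pr P (\<lambda>w. (fst w, A (snd w))) (i, a) = pr q A a * pmf (K a) i"
      unfolding P_def map_attach_pmf pmf_attach_pmf ..
    moreover have "c i * p i $ a = 0" if "pr q A a = 0"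
      using mix[of a] sum_nonneg_eq_0_iff[of "{1..k}" "\<lambda>i. c i * p i $ a"] nn i that by auto
    ultimately show ?thesis using K(3)[OF _ i] by (cases "pr q A a = 0") auto
  qed
  have swap: "pr P (\<lambda>w. (fst w, A (snd w))) (i, a) = pr P (\<lambda>w. (A (snd w), fst w)) (a, i)" for i a
    unfolding pr_eq_sum[OF fin] by (intro sum.cong refl) auto
  have U: "pr P fst i = c i" if i: "i \<in> {1..k}" for i
  proof -
    have "pr P fst i = (\<Sum>a\<in>UNIV. c i * p i $ a)"
      using pr_marginal_UNIV[OF fin, of "\<lambda>w. A (snd w)" fst i] by (simp add: UA[OF i] flip: swap)
    then show ?thesis using yp(2)[OF i] by (simp add: psimplex_def flip: sum_distrib_left)
  qed
  have sub: "fst ` set_pmf P \<subseteq> {1..k}"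
  proof
    fix u assume "u \<in> fst ` set_pmf P"
    then obtain l where l: "l \<in> set_pmf q" "u \<in> set_pmf (K (A l))"
      by (auto simp: P_def attach_pmf_def)
    from pr_pos[OF l(1), of A] show "u \<in> {1..k}" using K(2)[of "A l"] l(2) by auto
  qed
  have ce: "ent P (\<lambda>w. (fst w, f (snd w))) - ent P fst = (\<Sum>i\<in>{1..k}. c i * out_ent q A f (p i))"
    for f :: "'l \<Rightarrow> 'v::finite"
  proof -
    have "ent P (\<lambda>w. (fst w, f (snd w))) - ent P fst
      = (\<Sum>u\<in>fst ` set_pmf P. pr P fst u * out_ent q A f (\<chi> a. pr P (\<lambda>w. (fst w, A (snd w))) (u, a) / pr P fst u))"
      unfolding P_def by (rule cond_ent_attach_pmf[OF finq finK])
    also have "\<dots> = (\<Sum>i\<in>fst ` set_pmf P. c i * out_ent q A f (p i))"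
    proof (rule sum.cong[OF refl])
      fix i assume i: "i \<in> fst ` set_pmf P"
      then have i': "i \<in> {1..k}" using sub by auto
      have "c i \<noteq> 0" using i U[OF i'] by (auto dest!: pr_pos[of _ P fst])
      then have "(\<chi> a. pr P (\<lambda>w. (fst w, A (snd w))) (i, a) / pr P fst i) = p i"
        by (simp add: vec_eq_iff UA[OF i'] U[OF i'])
      then show "pr P fst i * out_ent q A f (\<chi> a. pr P (\<lambda>w. (fst w, A (snd w))) (i, a) / pr P fst i)
        = c i * out_ent q A f (p i)" by (simp add: U[OF i'])
    qed
    \<comment> \<open>Components of weight 0 are missing from the support but contribute
      nothing.\<close>
    also have "\<dots> = (\<Sum>i\<in>{1..k}. c i * out_ent q A f (p i))"
    proof (rule sum.mono_neutral_left)
      show "\<forall>i\<in>{1..k} - fst ` set_pmf P. c i * out_ent q A f (p i) = 0"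
      proof
        fix i assume i: "i \<in> {1..k} - fst ` set_pmf P"
        then have "pr P fst i = 0" by (simp add: pmf_eq_0_set_pmf)
        then show "c i * out_ent q A f (p i) = 0" using U[of i] i by simp
      qed
    qed (use sub in auto)
    finally show ?thesis .
  qed
  show ?thesis
  proof (rule that[of K])
    show "finite (\<Union>a. set_pmf (K a))"
      by (rule finite_subset[of _ "{0..k}"]) (use K(1) in auto)
    show "let P = attach_pmf q (\<lambda>l. K (A l)) in
      snd x = (ent P (\<lambda>w. (fst w, C (snd w))) - ent P fst,
        ent P (\<lambda>w. (fst w, B (snd w))) - ent P fst, ent P (\<lambda>w. (fst w, A (snd w))) - ent P fst)"
      unfolding Let_def P_def[symmetric] ce by (simp add: xs)
  qed
qed

text \<open>Everything in \<open>auxU\<close> besides \<open>a (l ! i)\<close> comes from the other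
  letters, which are independent of the one at position \<open>i\<close>. So \<open>auxU\<close> is
  a randomized function of \<open>a (l ! i)\<close> alone, that is, a legitimate test channel
  output.\<close>

lemma iid_pmf_auxU_eq_attach_pmf:
  assumes fin: "finite (set_pmf q)" and i: "i < N"
  obtains K where "\<And>b. finite (set_pmf (K b))"
    "map_pmf (\<lambda>l. (auxU a y T i l, l ! i)) (iid_pmf N q) = attach_pmf q (\<lambda>l. K (a l))"
proof -
  obtain k where N: "N = i + Suc k" using i less_iff_Suc_add by auto
  let ?R = "pair_pmf (iid_pmf i q) (iid_pmf k q)"
  let ?g = "\<lambda>b r. (T (map a (fst r) @ b # map a (snd r)), map y (fst r))"
  define K where "K b = map_pmf (?g b) ?R" for b
  have "map_pmf (\<lambda>l. (auxU a y T i l, l ! i)) (iid_pmf N q)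
    = map_pmf (\<lambda>w. (?g (a (snd w)) (fst w), snd w)) (pair_pmf ?R q)"
    unfolding N iid_pmf_split pmf.map_comp
  proof (rule map_pmf_cong[OF refl])
    fix w assume "w \<in> set_pmf (pair_pmf ?R q)"
    then have "length (fst (fst w)) = i" by (auto dest: length_iid_pmf)
    then show "((\<lambda>l. (auxU a y T i l, l ! i)) \<circ> (\<lambda>w. fst (fst w) @ snd w # snd (fst w))) w
        = (?g (a (snd w)) (fst w), snd w)"
      by (simp add: auxU_def nth_append)
  qed
  also have "\<dots> = bind_pmf ?R (\<lambda>r. bind_pmf q (\<lambda>l. return_pmf (?g (a l) r, l)))"
    by (simp add: pair_pmf_def map_bind_pmf bind_assoc_pmf bind_return_pmf)
  also have "\<dots> = bind_pmf q (\<lambda>l. bind_pmf ?R (\<lambda>r. return_pmf (?g (a l) r, l)))"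
    by (rule bind_commute_pmf)
  also have "\<dots> = attach_pmf q (\<lambda>l. K (a l))"
    by (simp add: attach_pmf_def K_def pmf.map_comp o_def) (simp add: map_pmf_def)
  finally show ?thesis by (intro that[of K]) (use fin in \<open>auto simp: K_def\<close>)
qed

section \<open>Converse\<close>

abbreviation key_rv :: "('xt list \<Rightarrow> nat \<times> nat) \<Rightarrow> ('xt \<times> 'x \<times> 'y) list \<Rightarrow> nat" where
  "key_rv Enc l \<equiv> fst (Enc (map fst l))"

abbreviation help_rv :: "('xt list \<Rightarrow> nat \<times> nat) \<Rightarrow> ('xt \<times> 'x \<times> 'y) list \<Rightarrow> nat" where
  "help_rv Enc l \<equiv> snd (Enc (map fst l))"

lemma gs_joint_quantities:
  fixes Q :: "'x::finite pmf" and W :: "'x \<Rightarrow> 'xt::finite pmf" and V :: "'x \<Rightarrow> 'y::finite pmf" and N :: nat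
  defines "P \<equiv> iid_pmf N (src_pmf Q W V)"
  shows "measure_pmf.prob (gs_joint Q W V N Enc Dec) {(s, m, sh, x). s \<noteq> sh}
      = measure_pmf.prob P {l. key_rv Enc l \<noteq> Dec (map (snd \<circ> snd) l) (help_rv Enc l)}"
    and "mutual_info_pmf (map_pmf (\<lambda>(s, m, sh, x). (s, m)) (gs_joint Q W V N Enc Dec))
      = ent P (key_rv Enc) + ent P (help_rv Enc) - ent P (\<lambda>l. Enc (map fst l))"
    and "mutual_info_pmf (map_pmf (\<lambda>(s, m, sh, x). (x, m)) (gs_joint Q W V N Enc Dec))
      = ent P (map (fst \<circ> snd)) + ent P (help_rv Enc) - ent P (\<lambda>l. (help_rv Enc l, map (fst \<circ> snd) l))"
    and "entropy_pmf (map_pmf (\<lambda>(s, m, sh, x). s) (gs_joint Q W V N Enc Dec)) = ent P (key_rv Enc)"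
    and "entropy_pmf (map_pmf (\<lambda>(s, m, sh, x). m) (gs_joint Q W V N Enc Dec)) = ent P (help_rv Enc)"
proof -
  have fin: "finite (set_pmf P)" by (simp add: P_def)
  show "measure_pmf.prob (gs_joint Q W V N Enc Dec) {(s, m, sh, x). s \<noteq> sh}
      = measure_pmf.prob P {l. key_rv Enc l \<noteq> Dec (map (snd \<circ> snd) l) (help_rv Enc l)}"
    by (simp add: gs_joint_def P_def vimage_def Let_def)
  have "mutual_info_pmf (map_pmf (\<lambda>(s, m, sh, x). (s, m)) (gs_joint Q W V N Enc Dec))
      = mutual_info_pmf (map_pmf (\<lambda>l. (key_rv Enc l, help_rv Enc l)) P)"
    by (simp add: gs_joint_def P_def pmf.map_comp o_def Let_def)
  then show "mutual_info_pmf (map_pmf (\<lambda>(s, m, sh, x). (s, m)) (gs_joint Q W V N Enc Dec))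
      = ent P (key_rv Enc) + ent P (help_rv Enc) - ent P (\<lambda>l. Enc (map fst l))"
    using mutual_info_map_pmf[OF fin, of "key_rv Enc" "help_rv Enc"] by simp
  have "mutual_info_pmf (map_pmf (\<lambda>(s, m, sh, x). (x, m)) (gs_joint Q W V N Enc Dec))
      = mutual_info_pmf (map_pmf (\<lambda>l. (map (fst \<circ> snd) l, help_rv Enc l)) P)"
    by (simp add: gs_joint_def P_def pmf.map_comp o_def Let_def)
  moreover have "ent P (\<lambda>l. (map (fst \<circ> snd) l, help_rv Enc l)) = ent P (\<lambda>l. (help_rv Enc l, map (fst \<circ> snd) l))"
    by (rule ent_cong[OF fin]) auto
  ultimately show "mutual_info_pmf (map_pmf (\<lambda>(s, m, sh, x). (x, m)) (gs_joint Q W V N Enc Dec))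
      = ent P (map (fst \<circ> snd)) + ent P (help_rv Enc) - ent P (\<lambda>l. (help_rv Enc l, map (fst \<circ> snd) l))"
    using mutual_info_map_pmf[OF fin, of "map (fst \<circ> snd)" "help_rv Enc"] by simp
  show "entropy_pmf (map_pmf (\<lambda>(s, m, sh, x). s) (gs_joint Q W V N Enc Dec)) = ent P (key_rv Enc)"
    "entropy_pmf (map_pmf (\<lambda>(s, m, sh, x). m) (gs_joint Q W V N Enc Dec)) = ent P (help_rv Enc)"
    by (simp_all add: gs_joint_def P_def pmf.map_comp o_def Let_def ent_def)
qed

lemma src_pmf_eq_attach_pmf:
  "src_pmf Q W V = map_pmf (\<lambda>w. (fst (fst w), snd w, snd (fst w))) (attach_pmf Q (\<lambda>x. pair_pmf (W x) (V x)))"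
  by (simp add: src_pmf_def attach_pmf_def pair_pmf_def map_bind_pmf bind_return_pmf pmf.map_comp o_def)
    (simp add: map_pmf_def)

lemma src_pmf_markov:
  fixes Q :: "'x::finite pmf" and W :: "'x \<Rightarrow> 'xt::finite pmf" and V :: "'x \<Rightarrow> 'y::finite pmf"
  defines "q \<equiv> src_pmf Q W V"
  shows "ent q (\<lambda>l. (fst l, (fst \<circ> snd) l, (snd \<circ> snd) l)) + ent q (fst \<circ> snd)
    = ent q (\<lambda>l. (fst l, (fst \<circ> snd) l)) + ent q (\<lambda>l. ((fst \<circ> snd) l, (snd \<circ> snd) l))"
proof -
  let ?D = "attach_pmf Q (\<lambda>x. pair_pmf (W x) (V x))"
  have fin: "finite (set_pmf ?D)" by simp
  have D: "pr ?D (\<lambda>w. (fst (fst w), snd (fst w), snd w)) (a, y, x) = pmf ?D ((a, y), x)" for a y x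
    using pmf_map_inj'[of "\<lambda>w. (fst (fst w), snd (fst w), snd w)" ?D "((a, y), x)"]
    by (auto simp: inj_on_def prod_eq_iff)
  have DW: "map_pmf (\<lambda>w. (fst (fst w), snd w)) ?D = attach_pmf Q W"
  proof -
    have "map_pmf (\<lambda>w. (fst (fst w), snd w)) ?D
      = bind_pmf Q (\<lambda>x. map_pmf (\<lambda>u. (u, x)) (map_pmf fst (pair_pmf (W x) (V x))))"
      by (simp add: attach_pmf_def map_bind_pmf pmf.map_comp o_def del: map_fst_pair_pmf)
    then show ?thesis by (simp add: attach_pmf_def map_fst_pair_pmf)
  qed
  have DV: "map_pmf (\<lambda>w. (snd (fst w), snd w)) ?D = attach_pmf Q V"
  proof -
    have "map_pmf (\<lambda>w. (snd (fst w), snd w)) ?D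
      = bind_pmf Q (\<lambda>x. map_pmf (\<lambda>u. (u, x)) (map_pmf snd (pair_pmf (W x) (V x))))"
      by (simp add: attach_pmf_def map_bind_pmf pmf.map_comp o_def del: map_snd_pair_pmf)
    then show ?thesis by (simp add: attach_pmf_def map_snd_pair_pmf)
  qed
  have "ent ?D (\<lambda>w. (fst (fst w), snd (fst w), snd w)) + ent ?D snd
    = ent ?D (\<lambda>w. (fst (fst w), snd w)) + ent ?D (\<lambda>w. (snd (fst w), snd w))"
  proof (rule ent_markov_eq[OF fin])
    fix w :: "('xt \<times> 'y) \<times> 'x"
    obtain a y x where "w = ((a, y), x)" by (metis prod.collapse)
    then show "pr ?D (\<lambda>w. (fst (fst w), snd (fst w), snd w)) (fst (fst w), snd (fst w), snd w) * pr ?D snd (snd w)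
      = pr ?D (\<lambda>w. (fst (fst w), snd w)) (fst (fst w), snd w) * pr ?D (\<lambda>w. (snd (fst w), snd w)) (snd (fst w), snd w)"
      by (simp add: D DW DV pmf_attach_pmf pmf_pair)
  qed
  moreover have "ent ?D (\<lambda>w. (fst (fst w), snd (fst w), snd w)) = ent ?D (\<lambda>w. (fst (fst w), snd w, snd (fst w)))"
    "ent ?D (\<lambda>w. (snd (fst w), snd w)) = ent ?D (\<lambda>w. (snd w, snd (fst w)))"
    by (rule ent_cong[OF fin]; auto)+
  ultimately show ?thesis
    by (simp add: q_def src_pmf_eq_attach_pmf ent_map_pmf o_def)
qed

lemma aux_joint_eq_attach_pmf: "aux_joint Q W V PU = attach_pmf (src_pmf Q W V) (\<lambda>l. PU (fst l))"
  by (simp add: aux_joint_def attach_pmf_def split_def)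

lemma mutual_info_aux_joint:
  fixes Q :: "'x::finite pmf" and W :: "'x \<Rightarrow> 'xt::finite pmf" and V :: "'x \<Rightarrow> 'y::finite pmf"
  assumes finK: "\<And>a. finite (set_pmf (PU a))"
  defines "P \<equiv> attach_pmf (src_pmf Q W V) (\<lambda>l. PU (fst l))"
  shows "mutual_info_pmf (map_pmf (\<lambda>(u, xt, x, y). (u, y)) (aux_joint Q W V PU))
      = ent (src_pmf Q W V) (snd \<circ> snd) - (ent P (\<lambda>w. (fst w, (snd \<circ> snd) (snd w))) - ent P fst)"
    and "mutual_info_pmf (map_pmf (\<lambda>(u, xt, x, y). (u, x)) (aux_joint Q W V PU))
      = ent (src_pmf Q W V) (fst \<circ> snd) - (ent P (\<lambda>w. (fst w, (fst \<circ> snd) (snd w))) - ent P fst)"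
    and "mutual_info_pmf (map_pmf (\<lambda>(u, xt, x, y). (u, xt)) (aux_joint Q W V PU))
      = ent (src_pmf Q W V) fst - (ent P (\<lambda>w. (fst w, fst (snd w))) - ent P fst)"
proof -
  have fin: "finite (set_pmf P)" unfolding P_def using finK by simp
  have *: "mutual_info_pmf (map_pmf (\<lambda>w. (fst w, f (snd w))) P)
    = ent (src_pmf Q W V) f - (ent P (\<lambda>w. (fst w, f (snd w))) - ent P fst)" for f :: "'xt \<times> 'x \<times> 'y \<Rightarrow> 'v"
    using mutual_info_map_pmf[OF fin, of fst "\<lambda>w. f (snd w)"] ent_attach_pmf_snd[of _ _ f]
    by (simp add: P_def)
  show "mutual_info_pmf (map_pmf (\<lambda>(u, xt, x, y). (u, y)) (aux_joint Q W V PU))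
      = ent (src_pmf Q W V) (snd \<circ> snd) - (ent P (\<lambda>w. (fst w, (snd \<circ> snd) (snd w))) - ent P fst)"
    "mutual_info_pmf (map_pmf (\<lambda>(u, xt, x, y). (u, x)) (aux_joint Q W V PU))
      = ent (src_pmf Q W V) (fst \<circ> snd) - (ent P (\<lambda>w. (fst w, (fst \<circ> snd) (snd w))) - ent P fst)"
    "mutual_info_pmf (map_pmf (\<lambda>(u, xt, x, y). (u, xt)) (aux_joint Q W V PU))
      = ent (src_pmf Q W V) fst - (ent P (\<lambda>w. (fst w, fst (snd w))) - ent P fst)"
    unfolding *[symmetric] by (simp_all add: aux_joint_eq_attach_pmf P_def split_def)
qed

text \<open>The loss per letter in the converse: one \<open>e\<close> each for uniformity and
  secrecy, the rest from Fano's inequality with \<open>log 2 (card S) / N\<close> bounded by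
  \<open>\<bar>R\<bar> + e\<close>.\<close>

definition slack :: "real \<Rightarrow> real \<Rightarrow> real" where
  "slack R e = 2 * e - log 2 (1 - e) - e * log 2 e + e * (\<bar>R\<bar> + e)"

lemma slack_tendsto_0: "(slack R \<longlongrightarrow> 0) (at_right 0)"
proof -
  have "((\<lambda>t :: real. t * log 2 t) \<longlongrightarrow> 0 * log 2 0) (at 0 within {0..})"
    using continuous_on_mult_log unfolding continuous_on_def by force
  then have "((\<lambda>t :: real. t * log 2 t) \<longlongrightarrow> 0) (at_right 0)"
    by (rule tendsto_within_subset[THEN tendsto_eq_rhs]) auto
  then have "(slack R \<longlongrightarrow> 2 * 0 - log 2 (1 - 0) - 0 + 0 * (\<bar>R\<bar> + 0)) (at_right 0)"
    unfolding slack_def[abs_def] by (intro tendsto_intros) auto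
  then show ?thesis by simp
qed

definition avg_cond_ent :: "'l pmf \<Rightarrow> nat \<Rightarrow> ('l \<Rightarrow> 'a) \<Rightarrow> ('l \<Rightarrow> 'c) \<Rightarrow> ('a list \<Rightarrow> 't) \<Rightarrow> ('l \<Rightarrow> 'v) \<Rightarrow> real" where
  "avg_cond_ent q N a y T f = (\<Sum>i<N. ent (iid_pmf N q) (\<lambda>l. (auxU a y T i l, f (l ! i)))
     - ent (iid_pmf N q) (auxU a y T i)) / N"

text \<open>Each position contributes a point of the hull with the same first coordinate, and the
  uniform average over positions is again such a point.\<close>

lemma avg_cond_ent_mem_ent_hull:
  fixes A :: "'l \<Rightarrow> 'a::finite" and B :: "'l \<Rightarrow> 'b::finite" and C :: "'l \<Rightarrow> 'c::finite"
  assumes fin: "finite (set_pmf q)" and N: "0 < N"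
  shows "((\<chi> a. pr q A a), avg_cond_ent q N A y T C, avg_cond_ent q N A y T B, avg_cond_ent q N A y T A)
    \<in> ent_hull q A B C"
proof -
  let ?P = "iid_pmf N q" and ?U = "auxU A y T"
  define v where "v i = ((\<chi> a. pr q A a), ent ?P (\<lambda>l. (?U i l, C (l ! i))) - ent ?P (?U i),
     ent ?P (\<lambda>l. (?U i l, B (l ! i))) - ent ?P (?U i), ent ?P (\<lambda>l. (?U i l, A (l ! i))) - ent ?P (?U i))" for i
  have v: "v i \<in> ent_hull q A B C" if i: "i < N" for i
  proof -
    obtain K where K: "\<And>b. finite (set_pmf (K b))"
      and eq: "map_pmf (\<lambda>l. (?U i l, l ! i)) ?P = attach_pmf q (\<lambda>l. K (A l))"
      using iid_pmf_auxU_eq_attach_pmf[OF fin i, where a = A and y = y and T = T] by blast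
    show ?thesis
      using attach_pmf_mem_ent_hull[of q K A C B, OF fin K]
      unfolding v_def eq[symmetric] ent_map_pmf by simp
  qed
  have "(\<Sum>i<N. (1 / real N) *\<^sub>R v i) \<in> ent_hull q A B C"
    unfolding ent_hull_def
    by (rule convex_sum) (use v N in \<open>auto simp: ent_hull_def\<close>)
  moreover have "(\<Sum>i<N. (1 / real N) *\<^sub>R (\<chi> a. pr q A a)) = (\<chi> a. pr q A a)"
    using N by (simp only: sum_constant_scaleR card_lessThan scaleR_scaleR) simp
  ultimately show ?thesis
    unfolding sum_triple by (simp add: v_def avg_cond_ent_def sum_divide_distrib)
qed

lemma avg_cond_ent_mult:
  assumes "0 < N"
  shows "N * (h - avg_cond_ent q N a y T f) = (\<Sum>i<N. h - (ent (iid_pmf N q) (\<lambda>l. (auxU a y T i l, f (l ! i)))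
     - ent (iid_pmf N q) (auxU a y T i)))"
  using assms by (simp add: avg_cond_ent_def right_diff_distrib sum_subtractf[of "\<lambda>_. h"])

lemma avg_cond_ent_key:
  assumes fin: "finite (set_pmf q)" and N: "0 < N"
  shows "ent (iid_pmf N q) (\<lambda>l. T (map a l)) + ent (iid_pmf N q) (map y)
     - ent (iid_pmf N q) (\<lambda>l. (T (map a l), map y l)) \<le> N * (ent q y - avg_cond_ent q N a y T y)"
  unfolding avg_cond_ent_mult[OF N] by (rule sum_info_auxU_ge[OF fin])

lemma avg_cond_ent_diff:
  assumes fin: "finite (set_pmf q)" and N: "0 < N"
    and markov: "ent q (\<lambda>l. (a l, z l, y l)) + ent q z = ent q (\<lambda>l. (a l, z l)) + ent q (\<lambda>l. (z l, y l))"
  shows "N * ((ent q z - avg_cond_ent q N a y T z) - (ent q y - avg_cond_ent q N a y T y))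
    \<le> (ent (iid_pmf N q) (map z) - ent (iid_pmf N q) (\<lambda>l. (T (map a l), map z l)))
      - (ent (iid_pmf N q) (map y) - ent (iid_pmf N q) (\<lambda>l. (T (map a l), map y l)))"
  unfolding right_diff_distrib[of _ "_ - avg_cond_ent _ _ _ _ _ _"] avg_cond_ent_mult[OF N] sum_subtractf[symmetric]
  by (rule sum_info_auxU_diff_le[OF fin markov])

text \<open>One block code yields a single point of the hull that satisfies all three inequalities
  up to \<open>slack Rs e\<close>; it matters that the same point serves all of them.\<close>

lemma gs_achievable_imp_near_hull:
  fixes Q :: "'x::finite pmf" and W :: "'x \<Rightarrow> 'xt::finite pmf" and V :: "'x \<Rightarrow> 'y::finite pmf"
  defines "q \<equiv> src_pmf Q W V"
  assumes ach: "gs_achievable Q W V (Rs, Rl, Rm)" and e: "0 < e" "e < 1"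
  obtains hC hB hA where "((\<chi> a. pr q fst a), hC, hB, hA) \<in> ent_hull q fst (fst \<circ> snd) (snd \<circ> snd)"
    "Rs - (ent q (snd \<circ> snd) - hC) \<le> slack Rs e"
    "(ent q (fst \<circ> snd) - hB) - (ent q (snd \<circ> snd) - hC) - Rl \<le> slack Rs e"
    "(ent q fst - hA) - (ent q (snd \<circ> snd) - hC) - Rm \<le> slack Rs e"
proof -
  obtain N S Enc Dec where N: "1 \<le> N" and S: "finite S" "\<And>xt. length xt = N \<Longrightarrow> fst (Enc xt) \<in> S"
    and code: "let J = gs_joint Q W V N Enc Dec in
          \<bar>log 2 (real (card S)) / real N - Rs\<bar> \<le> e \<and>
          measure_pmf.prob J {(s, m, sh, x). s \<noteq> sh} \<le> e \<and>
          mutual_info_pmf (map_pmf (\<lambda>(s, m, sh, x). (s, m)) J) / real N \<le> e \<and>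
          mutual_info_pmf (map_pmf (\<lambda>(s, m, sh, x). (x, m)) J) / real N \<le> Rl + e \<and>
          entropy_pmf (map_pmf (\<lambda>(s, m, sh, x). s) J) / real N \<ge> Rs - e \<and>
          entropy_pmf (map_pmf (\<lambda>(s, m, sh, x). m) J) / real N \<le> Rm + e"
    using ach e unfolding gs_achievable_def by blast
  define P where "P = iid_pmf N q"
  have finq: "finite (set_pmf q)" by simp
  have fin: "finite (set_pmf P)" by (simp add: P_def)
  note J = gs_joint_quantities[of Q W V N Enc, folded q_def P_def]
  let ?A = "map fst :: ('xt \<times> 'x \<times> 'y) list \<Rightarrow> _" and ?B = "map (fst \<circ> snd) :: ('xt \<times> 'x \<times> 'y) list \<Rightarrow> _"
    and ?C = "map (snd \<circ> snd) :: ('xt \<times> 'x \<times> 'y) list \<Rightarrow> _"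
  let ?T = "\<lambda>l :: ('xt \<times> 'x \<times> 'y) list. Enc (?A l)"
  have card: "\<bar>log 2 (real (card S)) / N - Rs\<bar> \<le> e"
    and err: "measure_pmf.prob P {l. key_rv Enc l \<noteq> Dec (?C l) (help_rv Enc l)} \<le> e"
    and sec: "(ent P (key_rv Enc) + ent P (help_rv Enc) - ent P ?T) / N \<le> e"
    and priv: "(ent P ?B + ent P (help_rv Enc) - ent P (\<lambda>l. (help_rv Enc l, ?B l))) / N \<le> Rl + e"
    and unif: "ent P (key_rv Enc) / N \<ge> Rs - e"
    and stor: "ent P (help_rv Enc) / N \<le> Rm + e"
    using code unfolding Let_def J by auto
  define F where "F = - log 2 (1 - e) - e * log 2 e + e * log 2 (card S)"
  \<comment> \<open>The helper data and the decoder's word determine the key up to Fano's term, so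
    replacing \<open>?T\<close> by the helper data in the presence of that word costs at most
    \<open>F\<close>.\<close>
  have "ent P (\<lambda>l. (key_rv Enc l, (help_rv Enc l, ?C l))) - ent P (\<lambda>l. (help_rv Enc l, ?C l)) \<le> F"
    unfolding F_def
    by (rule fano_side_info[OF fin S(1) _ e err])
      (use S(2) in \<open>auto simp: P_def dest!: length_iid_pmf\<close>)
  moreover have "ent P (\<lambda>l. (key_rv Enc l, (help_rv Enc l, ?C l))) = ent P (\<lambda>l. (?T l, ?C l))"
    by (rule ent_cong[OF fin]) (auto simp: prod_eq_iff)
  ultimately have F: "ent P (\<lambda>l. (?T l, ?C l)) - ent P (\<lambda>l. (help_rv Enc l, ?C l)) \<le> F" by simp
  have sub: "ent P (\<lambda>l. (help_rv Enc l, ?C l)) \<le> ent P (help_rv Enc) + ent P ?C"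
    by (rule ent_subadditive[OF fin])
  have TB: "ent P (\<lambda>l. (help_rv Enc l, ?B l)) \<le> ent P (\<lambda>l. (?T l, ?B l))"
    by (rule ent_mono[OF fin]) auto
  have TA: "ent P (\<lambda>l. (?T l, ?A l)) = ent P ?A"
    by (rule ent_cong[OF fin]) auto
  \<comment> \<open>The block length may be as small as 1: the part of Fano's term that does not
    scale with \<open>N\<close> is nonnegative, so dividing it by \<open>N\<close> does no
    harm.\<close>
  have FN: "F / N \<le> slack Rs e - 2 * e"
  proof -
    have "log 2 (1 - e) \<le> 0" using e by simp
    moreover have "e * log 2 e \<le> 0" using e by (intro mult_nonneg_nonpos) simp_all
    ultimately have "- log 2 (1 - e) - e * log 2 e \<ge> 0" by linarith
    then have "(- log 2 (1 - e) - e * log 2 e) / N \<le> - log 2 (1 - e) - e * log 2 e"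
      using N by (simp add: divide_le_eq mult_left_mono[of 1 "real N"] mult_le_cancel_left1)
    moreover have "e * (log 2 (card S) / N) \<le> e * (\<bar>Rs\<bar> + e)"
      using card e by (intro mult_left_mono) auto
    ultimately show ?thesis by (simp add: F_def slack_def add_divide_distrib)
  qed
  have N0: "0 < N" using N by simp
  show ?thesis
  proof (rule that[OF avg_cond_ent_mem_ent_hull[OF finq N0, where y = "snd \<circ> snd" and T = Enc]])
    have key: "ent P ?T + ent P ?C - ent P (\<lambda>l. (?T l, ?C l))
        \<le> N * (ent q (snd \<circ> snd) - avg_cond_ent q N fst (snd \<circ> snd) Enc (snd \<circ> snd))"
      using avg_cond_ent_key[OF finq N0] unfolding P_def .
    have diffB: "N * ((ent q (fst \<circ> snd) - avg_cond_ent q N fst (snd \<circ> snd) Enc (fst \<circ> snd))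
        - (ent q (snd \<circ> snd) - avg_cond_ent q N fst (snd \<circ> snd) Enc (snd \<circ> snd)))
      \<le> (ent P ?B - ent P (\<lambda>l. (?T l, ?B l))) - (ent P ?C - ent P (\<lambda>l. (?T l, ?C l)))"
      using avg_cond_ent_diff[OF finq N0 src_pmf_markov[of Q W V, folded q_def]] unfolding P_def .
    \<comment> \<open>Storage is the instance where \<open>z\<close> is the encoder's observation
      itself and the Markov chain is trivial.\<close>
    have "ent q (\<lambda>l. (fst l, fst l, (snd \<circ> snd) l)) = ent q (\<lambda>l. (fst l, (snd \<circ> snd) l))"
      "ent q (\<lambda>l. (fst l, fst l)) = ent q fst"
      by (rule ent_cong[OF finq]; auto)+
    then have "ent q (\<lambda>l. (fst l, fst l, (snd \<circ> snd) l)) + ent q fst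
      = ent q (\<lambda>l. (fst l, fst l)) + ent q (\<lambda>l. (fst l, (snd \<circ> snd) l))" by linarith
    from avg_cond_ent_diff[OF finq N0 this]
    have diffA: "N * ((ent q fst - avg_cond_ent q N fst (snd \<circ> snd) Enc fst)
        - (ent q (snd \<circ> snd) - avg_cond_ent q N fst (snd \<circ> snd) Enc (snd \<circ> snd)))
      \<le> (ent P ?A - ent P (\<lambda>l. (?T l, ?A l))) - (ent P ?C - ent P (\<lambda>l. (?T l, ?C l)))"
      unfolding P_def .
    have F': "F \<le> N * (slack Rs e - 2 * e)" using FN N0 by (simp add: divide_le_eq mult.commute)
    have "N * (Rs - e) \<le> ent P (key_rv Enc)"
      "ent P (key_rv Enc) + ent P (help_rv Enc) - ent P ?T \<le> N * e"
      "ent P ?B + ent P (help_rv Enc) - ent P (\<lambda>l. (help_rv Enc l, ?B l)) \<le> N * (Rl + e)"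
      "ent P (help_rv Enc) \<le> N * (Rm + e)"
      using sec priv unif stor N0 by (simp_all add: divide_le_eq le_divide_eq mult.commute)
    note facts = this F F' sub TB TA key diffB diffA
    have "N * Rs \<le> N * ((ent q (snd \<circ> snd) - avg_cond_ent q N fst (snd \<circ> snd) Enc (snd \<circ> snd)) + slack Rs e)"
      using facts by (simp only: distrib_left right_diff_distrib)
    then show "Rs - (ent q (snd \<circ> snd) - avg_cond_ent q N fst (snd \<circ> snd) Enc (snd \<circ> snd)) \<le> slack Rs e"
      using N0 by (simp add: mult_le_cancel_left)
    \<comment> \<open>Leakage and storage consume one \<open>e\<close> of the two contained in
      \<open>slack\<close>; the other one is dropped as nonnegative.\<close>
    have ee: "0 \<le> N * e" using e by simp
    have "N * ((ent q (fst \<circ> snd) - avg_cond_ent q N fst (snd \<circ> snd) Enc (fst \<circ> snd))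
        - (ent q (snd \<circ> snd) - avg_cond_ent q N fst (snd \<circ> snd) Enc (snd \<circ> snd))) \<le> N * (Rl + slack Rs e)"
      using facts ee by (simp only: distrib_left right_diff_distrib)
    then show "(ent q (fst \<circ> snd) - avg_cond_ent q N fst (snd \<circ> snd) Enc (fst \<circ> snd))
        - (ent q (snd \<circ> snd) - avg_cond_ent q N fst (snd \<circ> snd) Enc (snd \<circ> snd)) - Rl \<le> slack Rs e"
      using N0 by (simp add: mult_le_cancel_left)
    have "N * ((ent q fst - avg_cond_ent q N fst (snd \<circ> snd) Enc fst)
        - (ent q (snd \<circ> snd) - avg_cond_ent q N fst (snd \<circ> snd) Enc (snd \<circ> snd))) \<le> N * (Rm + slack Rs e)"
      using facts ee by (simp only: distrib_left right_diff_distrib)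
    then show "(ent q fst - avg_cond_ent q N fst (snd \<circ> snd) Enc fst)
        - (ent q (snd \<circ> snd) - avg_cond_ent q N fst (snd \<circ> snd) Enc (snd \<circ> snd)) - Rm \<le> slack Rs e"
      using N0 by (simp add: mult_le_cancel_left)
  qed
qed

lemma capacity_region_subset:
  fixes Q :: "'x::finite pmf" and W :: "'x \<Rightarrow> 'xt::finite pmf" and V :: "'x \<Rightarrow> 'y::finite pmf"
  shows "gs_capacity_region Q W V \<subseteq> region_R1 Q W V"
proof
  fix r assume "r \<in> gs_capacity_region Q W V"
  moreover obtain Rs Rl Rm where r: "r = (Rs, Rl, Rm)" by (cases r) auto
  ultimately have ach: "gs_achievable Q W V (Rs, Rl, Rm)" by (simp add: gs_capacity_region_def)
  define q where "q = src_pmf Q W V"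
  have finq: "finite (set_pmf q)" by simp
  let ?B = "fst \<circ> snd :: 'xt \<times> 'x \<times> 'y \<Rightarrow> 'x" and ?C = "snd \<circ> snd :: 'xt \<times> 'x \<times> 'y \<Rightarrow> 'y"
  define pA where "pA = (\<chi> a. pr q fst a)"
  define H where "H = ent_hull q fst ?B ?C \<inter> {v. fst v = pA}"
  \<comment> \<open>The largest violation of the three inequalities. A minimizer over the compact
    slice \<open>H\<close> serves all error parameters at once.\<close>
  define f where "f v = max (Rs - (ent q ?C - fst (snd v)))
    (max ((ent q ?B - fst (snd (snd v))) - (ent q ?C - fst (snd v)) - Rl)
      ((ent q fst - snd (snd (snd v))) - (ent q ?C - fst (snd v)) - Rm))"
    for v :: "(real ^ 'xt) \<times> real \<times> real \<times> real"
  have near: "\<exists>v\<in>H. f v \<le> slack Rs e" if e: "0 < e" "e < 1" for e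
  proof -
    obtain hC hB hA where "((\<chi> a. pr q fst a), hC, hB, hA) \<in> ent_hull q fst ?B ?C"
      "Rs - (ent q ?C - hC) \<le> slack Rs e"
      "(ent q ?B - hB) - (ent q ?C - hC) - Rl \<le> slack Rs e"
      "(ent q fst - hA) - (ent q ?C - hC) - Rm \<le> slack Rs e"
      by (rule gs_achievable_imp_near_hull[OF ach e, folded q_def])
    then show ?thesis
      by (intro bexI[of _ "(pA, hC, hB, hA)"]) (auto simp: f_def H_def pA_def)
  qed
  have "compact H" unfolding H_def
    by (intro compact_Int_closed compact_ent_hull closed_Collect_eq continuous_intros)
  moreover have "H \<noteq> {}" using near[of "1/2"] by auto
  moreover have "continuous_on H f" unfolding f_def by (intro continuous_intros)
  ultimately obtain v where v: "v \<in> H" "\<And>w. w \<in> H \<Longrightarrow> f v \<le> f w"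
    using continuous_attains_inf by metis
  have "f v \<le> slack Rs e" if "0 < e" "e < 1" for e
    using near[OF that] v(2) by force
  then have "\<forall>\<^sub>F e in at_right 0. f v \<le> slack Rs e"
    unfolding eventually_at_right_field by (intro exI[of _ 1]) auto
  then have "f v \<le> 0"
    using tendsto_lowerbound[OF slack_tendsto_0] by simp
  then have fv: "Rs \<le> ent q ?C - fst (snd v)"
    "(ent q ?B - fst (snd (snd v))) - (ent q ?C - fst (snd v)) \<le> Rl"
    "(ent q fst - snd (snd (snd v))) - (ent q ?C - fst (snd v)) \<le> Rm"
    by (auto simp: f_def)
  obtain K :: "'xt \<Rightarrow> nat pmf" where K: "finite (\<Union>a. set_pmf (K a))"
    and sv: "let P = attach_pmf q (\<lambda>l. K (fst l)) in
      snd v = (ent P (\<lambda>w. (fst w, ?C (snd w))) - ent P fst,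
        ent P (\<lambda>w. (fst w, ?B (snd w))) - ent P fst, ent P (\<lambda>w. (fst w, fst (snd w))) - ent P fst)"
    using ent_hull_imp_attach_pmf[OF finq, of v fst ?B ?C] v(1) by (auto simp: H_def pA_def)
  have finK: "finite (set_pmf (K a))" for a using K by (rule finite_subset[rotated]) auto
  \<comment> \<open>The sign of the key rate is invisible in the hull; it comes from
    \<open>card S \<ge> 1\<close>.\<close>
  have Rs0: "0 \<le> Rs"
  proof (rule field_le_epsilon)
    fix e :: real assume "0 < e"
    then obtain N and S :: "nat set" where "1 \<le> N" "finite S" "S \<noteq> {}" "\<bar>log 2 (real (card S)) / real N - Rs\<bar> \<le> e"
      using ach unfolding gs_achievable_def Let_def by blast
    moreover from this have "0 \<le> log 2 (real (card S)) / real N"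
      by (simp add: Suc_le_eq card_gt_0_iff)
    ultimately show "0 \<le> Rs + e" by linarith
  qed
  show "r \<in> region_R1 Q W V"
    unfolding region_R1_def r
    by (rule UN_I[of K])
      (use K Rs0 fv sv in \<open>simp_all add: mutual_info_aux_joint[OF finK] Let_def flip: q_def\<close>)
qed

section \<open>One-shot random coding\<close>

text \<open>On the event \<open>G\<close> each outcome contributes at least \<open>a\<close> to the
  conditional entropy, outside \<open>G\<close> at least 0. The loss of 1 is the bit telling whether
  \<open>G\<close> occurred, as the hypothesis bounds only the part of the mass that lies inside
  \<open>G\<close>.\<close>

lemma cond_ent_ge:
  assumes fin: "finite (set_pmf p)"
    and bound: "\<And>w. w \<in> set_pmf p \<Longrightarrow> w \<in> G \<Longrightarrow>
      pr p (\<lambda>w. (T w, B w, w \<in> G)) (T w, B w, True) \<le> 2 powr (- a) * pr p B (B w)"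
  shows "a * measure_pmf.prob p G - 1 \<le> ent p (\<lambda>w. (T w, B w)) - ent p B"
proof -
  let ?X = "\<lambda>w. (T w, B w, w \<in> G)"
  have "ent p (\<lambda>w. w \<in> G) \<le> log 2 (card (UNIV :: bool set))"
    by (rule ent_le_log_card[OF fin]) auto
  then have "ent p (\<lambda>w. w \<in> G) \<le> 1" by simp
  moreover have "ent p ?X = ent p (\<lambda>w. ((T w, B w), w \<in> G))"
    by (rule ent_cong[OF fin]) auto
  moreover have "ent p (\<lambda>w. ((T w, B w), w \<in> G)) \<le> ent p (\<lambda>w. (T w, B w)) + ent p (\<lambda>w. w \<in> G)"
    by (rule ent_subadditive[OF fin])
  moreover have "a * measure_pmf.prob p G \<le> ent p ?X - ent p B"
  proof -
    have "a * measure_pmf.prob p G = (\<Sum>w\<in>set_pmf p. pmf p w * (a * indicator G w))"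
      by (simp only: prob_eq_sum[OF fin] sum_distrib_left mult_ac)
    also have "\<dots> \<le> (\<Sum>w\<in>set_pmf p. pmf p w * (log 2 (pr p B (B w)) - log 2 (pr p ?X (?X w))))"
    proof (intro sum_mono mult_left_mono)
      fix w assume w: "w \<in> set_pmf p"
      have pos: "0 < pr p B (B w)" "0 < pr p ?X (?X w)"
        using pr_pos[OF w, of B] pr_pos[OF w, of ?X] by auto
      show "a * indicator G w \<le> log 2 (pr p B (B w)) - log 2 (pr p ?X (?X w))"
      proof (cases "w \<in> G")
        case True
        then have "log 2 (pr p ?X (?X w)) \<le> log 2 (2 powr (- a) * pr p B (B w))"
          using bound[OF w True] pos by simp
        then show ?thesis using True pos by (simp add: log_mult)
      next
        case False
        have "pr p ?X (?X w) \<le> pr p B (B w)" by (rule pr_le_of_refine[OF fin w]) simp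
        then have "log 2 (pr p ?X (?X w)) \<le> log 2 (pr p B (B w))" using pos by simp
        then show ?thesis using False by simp
      qed
    qed simp
    also have "\<dots> = ent p ?X - ent p B"
      by (simp add: ent_alt[OF fin] right_diff_distrib sum_subtractf)
    finally show ?thesis .
  qed
  ultimately show ?thesis by linarith
qed

lemma exists_le_expectation:
  fixes f :: "'a \<Rightarrow> real"
  assumes "finite (set_pmf p)" and "(\<Sum>w\<in>set_pmf p. pmf p w * f w) \<le> b"
  obtains w where "f w \<le> b"
proof (rule ccontr)
  assume "\<not> thesis"
  then have "b < f w" for w using that[of w] by force
  then have "(\<Sum>w\<in>set_pmf p. pmf p w * b) < (\<Sum>w\<in>set_pmf p. pmf p w * f w)"
    by (intro sum_strict_mono) (auto simp: assms(1) set_pmf_not_empty pmf_positive)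
  then show False using assms by (simp flip: sum_distrib_right)
qed

text \<open>In use, \<open>w\<close> is the chance that one random codeword suits a given
  observation, \<open>v\<close> the chance that the test channel output does, and \<open>b\<close>
  bounds the ratio of the two. Convexity of \<open>exp\<close> separates the loss
  \<open>1 - v\<close> from the effect of the codebook size.\<close>

lemma power_le_covering:
  fixes w v b :: real
  assumes w: "0 \<le> w" "w \<le> 1" and v: "0 \<le> v" "v \<le> 1" and vw: "v * b \<le> w" and b: "0 \<le> b"
  shows "(1 - w) ^ k \<le> 1 - v + exp (- (real k * b))"
proof -
  have "(1 - w) ^ k \<le> exp (- w) ^ k"
    using w exp_ge_add_one_self[of "- w"] by (intro power_mono) auto
  also have "\<dots> = exp (- (real k * w))" by (simp flip: exp_of_nat_mult)
  also have "\<dots> \<le> exp ((1 - v) *\<^sub>R 0 + v *\<^sub>R (- (real k * b)))"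
    using mult_left_mono[OF vw, of "real k"] by (simp add: mult_ac)
  also have "\<dots> \<le> (1 - v) * exp 0 + v * exp (- (real k * b))"
    using convex_onD[OF exp_convex, of v 0 "- (real k * b)"] v by simp
  also have "\<dots> \<le> 1 - v + exp (- (real k * b))"
    using v mult_right_mono[of v 1 "exp (- (real k * b))"] by simp
  finally show ?thesis .
qed

text \<open>A letter of \<open>q\<close> will stand for a whole block. \<open>\<alpha>1\<close> and
  \<open>\<alpha>2\<close> enclose the information density of codeword and observation,
  \<open>\<beta>\<close> bounds the density with the source from above (for the leakage), and
  \<open>\<gamma>\<close> the one with the decoder's word from below (for decoding).\<close>

locale one_shot =
  fixes q :: "'l pmf" and A :: "'l \<Rightarrow> 'a" and B :: "'l \<Rightarrow> 'b" and C :: "'l \<Rightarrow> 'c"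
    and K :: "'a \<Rightarrow> 'u pmf" and \<alpha>1 \<alpha>2 \<beta> \<gamma> \<eta> :: real
  assumes finq: "finite (set_pmf q)" and finK: "\<And>a. finite (set_pmf (K a))"
    and eta: "0 < \<eta>" "\<eta> < 1"
begin

abbreviation "P \<equiv> attach_pmf q (\<lambda>l. K (A l))"
abbreviation "pU \<equiv> map_pmf fst P"

text \<open>Agrees with \<open>ratio A\<close> at letters of positive probability. Written through
  the kernel, its bounds compare \<open>K a\<close> with \<open>pU\<close> directly.\<close>

definition rA :: "'u \<Rightarrow> 'a \<Rightarrow> real" where
  "rA u a = pmf (K a) u / pmf pU u"

definition ratio :: "('l \<Rightarrow> 'v) \<Rightarrow> 'u \<Rightarrow> 'v \<Rightarrow> real" where
  "ratio f u v = pr P (\<lambda>w. (fst w, f (snd w))) (u, v) / (pmf pU u * pr q f v)"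

definition typical :: "('u \<times> 'l) set" where
  "typical = {w. 2 powr \<alpha>1 \<le> rA (fst w) (A (snd w)) \<and> rA (fst w) (A (snd w)) \<le> 2 powr \<alpha>2
     \<and> ratio B (fst w) (B (snd w)) \<le> 2 powr \<beta> \<and> 2 powr \<gamma> \<le> ratio C (fst w) (C (snd w))}"

text \<open>Requiring the pair \<open>(u, a)\<close> to be typical together with most of the continuations of \<open>a\<close> makes
  the other two typicality conditions hold automatically once the encoder has picked \<open>u \<in> G a\<close>; no
  Markov lemma is needed.\<close>
definition badmass :: "'u \<Rightarrow> 'a \<Rightarrow> real" where
  "badmass u a = (\<Sum>l\<in>{l\<in>set_pmf q. A l = a}. pmf q l * indicator (- typical) (u, l))"

definition G :: "'a \<Rightarrow> 'u set" where
  "G a = {u. u \<in> set_pmf (K a) \<and> badmass u a \<le> \<eta> * pr q A a}"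

lemma finP: "finite (set_pmf P)" using finq finK by simp

lemma joint_eq:
  "pr P (\<lambda>w. (fst w, f (snd w))) (u, v) = (\<Sum>l\<in>{l\<in>set_pmf q. f l = v}. pmf q l * pmf (K (A l)) u)"
proof -
  have "pr P (\<lambda>w. (fst w, f (snd w))) (u, v)
      = (\<Sum>w\<in>{w\<in>set_pmf P. (fst w, f (snd w)) = (u, v)}. pmf P w)"
    by (rule pr_eq_sum[OF finP])
  also have "\<dots> = (\<Sum>w\<in>(\<lambda>l. (u, l)) ` {l\<in>set_pmf q. f l = v}. pmf P w)"
    by (rule sum.mono_neutral_left)
      (use finq in \<open>auto simp: pmf_attach_pmf pmf_eq_0_set_pmf image_iff attach_pmf_def\<close>)
  also have "\<dots> = (\<Sum>l\<in>{l\<in>set_pmf q. f l = v}. pmf q l * pmf (K (A l)) u)"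
    by (subst sum.reindex) (auto simp: inj_on_def pmf_attach_pmf)
  finally show ?thesis .
qed

lemma pU_pos: "l \<in> set_pmf q \<Longrightarrow> u \<in> set_pmf (K (A l)) \<Longrightarrow> 0 < pmf pU u"
  by (rule pmf_positive) (force simp: attach_pmf_def)

text \<open>As \<open>\<eta> < 1\<close>, the bad mass of a member of \<open>G\<close> is below the
  full mass of its letter, so some continuation is typical; and the conditions on \<open>rA\<close>
  depend on a continuation only through \<open>A\<close>.\<close>

lemma G_bounds:
  assumes l: "l \<in> set_pmf q" and u: "u \<in> G (A l)"
  shows "2 powr \<alpha>1 * pmf pU u \<le> pmf (K (A l)) u" "pmf (K (A l)) u \<le> 2 powr \<alpha>2 * pmf pU u"
proof -
  have "\<exists>l'\<in>set_pmf q. A l' = A l \<and> (u, l') \<in> typical"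
  proof (rule ccontr)
    assume "\<not> ?thesis"
    then have "badmass u (A l) = pr q A (A l)"
      unfolding badmass_def pr_eq_sum[OF finq] by (intro sum.cong refl) auto
    then show False using u eta pr_pos[OF l, of A] by (simp add: G_def)
  qed
  then have "2 powr \<alpha>1 \<le> rA u (A l)" "rA u (A l) \<le> 2 powr \<alpha>2" by (auto simp: typical_def)
  moreover have "0 < pmf pU u" using u pU_pos[OF l] by (simp add: G_def)
  ultimately show "2 powr \<alpha>1 * pmf pU u \<le> pmf (K (A l)) u" "pmf (K (A l)) u \<le> 2 powr \<alpha>2 * pmf pU u"
    by (simp_all add: rA_def field_simps)
qed

lemma prob_mono_scale:
  fixes p p' :: "'u pmf"
  assumes "finite (set_pmf p)" "finite (set_pmf p')" "\<And>u. u \<in> E \<Longrightarrow> pmf p u \<le> c * pmf p' u"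
  shows "measure_pmf.prob p E \<le> c * measure_pmf.prob p' E"
proof -
  let ?S = "set_pmf p \<union> set_pmf p'"
  have *: "measure_pmf.prob r E = (\<Sum>u\<in>?S. pmf r u * indicator E u)" if "set_pmf r \<subseteq> ?S" for r
  proof -
    have "finite (set_pmf r)" using finite_subset[OF that] assms(1,2) by simp
    from prob_eq_sum[OF this] show ?thesis
      using that assms(1,2) by (simp only:) (rule sum.mono_neutral_left, auto simp: pmf_eq_0_set_pmf)
  qed
  show ?thesis unfolding *[of p, simplified] *[of p', simplified] sum_distrib_left
    by (rule sum_mono) (auto simp: indicator_def assms(3))
qed

lemma fin_pU: "finite (set_pmf pU)" using finP by simp

text \<open>Change of measure from \<open>pU\<close> to \<open>K (A l)\<close>, under which
  \<open>G\<close> has mass at most 1.\<close>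

lemma prob_G_le:
  assumes l: "l \<in> set_pmf q"
  shows "measure_pmf.prob pU (G (A l)) \<le> 2 powr (- \<alpha>1)"
proof -
  have "measure_pmf.prob pU (G (A l)) \<le> 2 powr (- \<alpha>1) * measure_pmf.prob (K (A l)) (G (A l))"
    using G_bounds(1)[OF l] by (intro prob_mono_scale fin_pU finK) (simp add: powr_minus field_simps)
  also have "\<dots> \<le> 2 powr (- \<alpha>1) * 1" by (intro mult_left_mono) auto
  finally show ?thesis by simp
qed

lemma prob_cover:
  assumes l: "l \<in> set_pmf q"
  shows "measure_pmf.prob (K (A l)) (G (A l)) * 2 powr (- \<alpha>2) \<le> measure_pmf.prob pU (G (A l))"
proof -
  have "measure_pmf.prob (K (A l)) (G (A l)) \<le> 2 powr \<alpha>2 * measure_pmf.prob pU (G (A l))"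
    using G_bounds(2)[OF l] by (intro prob_mono_scale fin_pU finK)
  then show ?thesis by (simp add: powr_minus field_simps)
qed

text \<open>Markov's inequality: for a codeword drawn independently of the decoder's word,
  \<open>ratio C\<close> has mean 1.\<close>

lemma prob_confusable:
  assumes l: "l \<in> set_pmf q"
  shows "measure_pmf.prob pU {u. 2 powr \<gamma> \<le> ratio C u (C l)} \<le> 2 powr (- \<gamma>)"
proof -
  have pos: "0 < pr q C (C l)" by (rule pr_pos[OF l])
  have "measure_pmf.prob pU {u. 2 powr \<gamma> \<le> ratio C u (C l)}
    \<le> (\<Sum>u\<in>set_pmf pU. pr P (\<lambda>w. (fst w, C (snd w))) (u, C l) * (2 powr (- \<gamma>) / pr q C (C l)))"
    unfolding prob_eq_sum[OF fin_pU]
  proof (rule sum_mono)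
    fix u assume "u \<in> set_pmf pU"
    then have "0 < pmf pU u" by (rule pmf_positive)
    then show "pmf pU u * indicator {u. 2 powr \<gamma> \<le> ratio C u (C l)} u
      \<le> pr P (\<lambda>w. (fst w, C (snd w))) (u, C l) * (2 powr (- \<gamma>) / pr q C (C l))"
      using pos by (auto simp: ratio_def indicator_def powr_minus field_simps)
  qed
  also have "\<dots> = (\<Sum>u\<in>fst ` set_pmf P. pr P (\<lambda>w. (fst w, C (snd w))) (u, C l)) * (2 powr (- \<gamma>) / pr q C (C l))"
    by (simp only: sum_distrib_right set_map_pmf)
  also have "(\<Sum>u\<in>fst ` set_pmf P. pr P (\<lambda>w. (fst w, C (snd w))) (u, C l)) = pr P (\<lambda>w. C (snd w)) (C l)"
    by (rule pr_marginal[OF finP])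
  also have "\<dots> = pr q C (C l)" by (simp flip: pmf.map_comp[unfolded o_def, of C snd])
  finally show ?thesis using pos by simp
qed

lemma sum_attach:
  "(\<Sum>w\<in>set_pmf P. pmf P w * g w)
    = (\<Sum>l\<in>set_pmf q. \<Sum>u\<in>set_pmf (K (A l)). pmf q l * pmf (K (A l)) u * (g (u, l) :: real))"
proof -
  have "set_pmf P = (\<lambda>(l, u). (u, l)) ` Sigma (set_pmf q) (\<lambda>l. set_pmf (K (A l)))"
    by (auto simp: attach_pmf_def)
  then have "(\<Sum>w\<in>set_pmf P. pmf P w * g w)
    = (\<Sum>(l, u)\<in>Sigma (set_pmf q) (\<lambda>l. set_pmf (K (A l))). pmf P (u, l) * g (u, l))"
    by (simp add: sum.reindex inj_on_def split_def)
  also have "\<dots> = (\<Sum>l\<in>set_pmf q. \<Sum>u\<in>set_pmf (K (A l)). pmf P (u, l) * g (u, l))"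
    by (rule sum.Sigma[symmetric]) (use finq finK in auto)
  finally show ?thesis by (simp add: pmf_attach_pmf)
qed

text \<open>Markov's inequality on each fibre of \<open>A\<close>: a word of the kernel outside
  \<open>G\<close> carries bad mass above \<open>\<eta>\<close> times the mass of the letter. The
  resulting division by \<open>\<eta>\<close> is the reason for the square in the
  hypothesis.\<close>

lemma sum_prob_not_G:
  assumes atypical: "measure_pmf.prob P (- typical) \<le> \<eta>\<^sup>2"
  shows "(\<Sum>l\<in>set_pmf q. pmf q l * (1 - measure_pmf.prob (K (A l)) (G (A l)))) \<le> \<eta>"
proof -
  let ?S = "set_pmf q"
  have fibre: "\<eta> * (\<Sum>l\<in>{l\<in>?S. A l = a}. pmf q l * (1 - measure_pmf.prob (K (A l)) (G (A l))))
    \<le> (\<Sum>l\<in>{l\<in>?S. A l = a}. \<Sum>u\<in>set_pmf (K (A l)). pmf q l * pmf (K (A l)) u * indicator (- typical) (u, l))"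
    (is "_ \<le> ?R") for a
  proof -
    have "1 - measure_pmf.prob (K a) (G a) = measure_pmf.prob (K a) (- G a)"
      using measure_pmf.prob_compl[of "G a" "K a"] by (simp add: Compl_eq_Diff_UNIV)
    then have "\<eta> * (\<Sum>l\<in>{l\<in>?S. A l = a}. pmf q l * (1 - measure_pmf.prob (K (A l)) (G (A l))))
      = \<eta> * pr q A a * measure_pmf.prob (K a) (- G a)"
      by (simp add: pr_eq_sum[OF finq] sum_distrib_right mult.assoc)
    also have "\<dots> = (\<Sum>u\<in>set_pmf (K a). pmf (K a) u * (\<eta> * pr q A a * indicator (- G a) u))"
      by (simp only: prob_eq_sum[OF finK] sum_distrib_left mult_ac)
    also have "\<dots> \<le> (\<Sum>u\<in>set_pmf (K a). pmf (K a) u * badmass u a)"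
    proof (intro sum_mono mult_left_mono)
      fix u assume "u \<in> set_pmf (K a)"
      moreover have "0 \<le> badmass u a" by (auto simp: badmass_def intro: sum_nonneg)
      ultimately show "\<eta> * pr q A a * indicator (- G a) u \<le> badmass u a"
        by (auto simp: G_def indicator_def)
    qed simp
    also have "\<dots> = (\<Sum>u\<in>set_pmf (K a). \<Sum>l\<in>{l\<in>?S. A l = a}. pmf q l * pmf (K (A l)) u * indicator (- typical) (u, l))"
      unfolding badmass_def sum_distrib_left by (intro sum.cong refl) auto
    also have "\<dots> = (\<Sum>l\<in>{l\<in>?S. A l = a}. \<Sum>u\<in>set_pmf (K a). pmf q l * pmf (K (A l)) u * indicator (- typical) (u, l))"
      by (rule sum.swap)
    also have "\<dots> = ?R" by (intro sum.cong refl) auto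
    finally show ?thesis .
  qed
  have "\<eta> * (\<Sum>l\<in>?S. pmf q l * (1 - measure_pmf.prob (K (A l)) (G (A l))))
    = (\<Sum>a\<in>A ` ?S. \<eta> * (\<Sum>l\<in>{l\<in>?S. A l = a}. pmf q l * (1 - measure_pmf.prob (K (A l)) (G (A l)))))"
    by (subst sum.image_gen[OF finq, of _ A]) (simp add: sum_distrib_left)
  also have "\<dots> \<le> (\<Sum>a\<in>A ` ?S. \<Sum>l\<in>{l\<in>?S. A l = a}. \<Sum>u\<in>set_pmf (K (A l)). pmf q l * pmf (K (A l)) u * indicator (- typical) (u, l))"
    by (intro sum_mono fibre)
  also have "\<dots> = measure_pmf.prob P (- typical)"
    unfolding prob_eq_sum[OF finP] sum_attach by (rule sum.image_gen[OF finq, symmetric])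
  also have "\<dots> \<le> \<eta> * \<eta>" using atypical by (simp add: power2_eq_square)
  finally show ?thesis using eta by simp
qed

definition fail :: "(nat \<Rightarrow> 'u) \<Rightarrow> nat \<Rightarrow> real" where
  "fail c k = (\<Sum>l\<in>set_pmf q. pmf q l * indicator {c. \<forall>t<k. c t \<notin> G (A l)} c)"

text \<open>The sum runs over all codewords that could be selected, not over the one that is, so the two
  codewords of a pair stay independent; the price is only the slack in the codebook size.\<close>
definition coll :: "(nat \<Rightarrow> 'u) \<Rightarrow> (nat \<times> nat) set \<Rightarrow> real" where
  "coll c R = (\<Sum>l\<in>set_pmf q. pmf q l * (\<Sum>x\<in>R.
     indicator {c. c (fst x) \<in> G (A l) \<and> 2 powr \<gamma> \<le> ratio C (c (snd x)) (C l)} c))"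

text \<open>First-moment argument over codewords drawn independently from \<open>pU\<close>. Failure
  and collisions are averaged as one sum, so that a single codebook is good for both.\<close>

lemma exists_codebook:
  assumes atypical: "measure_pmf.prob P (- typical) \<le> \<eta>\<^sup>2"
    and R: "R \<subseteq> {(t, t'). t < k \<and> t' < k \<and> t \<noteq> t'}"
  obtains c where "fail c k + coll c R
    \<le> \<eta> + exp (- (real k * 2 powr (- \<alpha>2))) + card R * 2 powr (- \<alpha>1 - \<gamma>)"
proof -
  have finR: "finite R" by (rule finite_subset[OF R, OF finite_subset[of _ "{..<k} \<times> {..<k}"]]) auto
  define M where "M = Pi_pmf {..<k} undefined (\<lambda>_. pU)"
  have finM: "finite (set_pmf M)"
    unfolding M_def by (simp add: set_Pi_pmf) (intro finite_PiE_dflt; use finP in auto)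
  have f1: "measure_pmf.prob M {c. \<forall>t<k. c t \<notin> G (A l)}
    \<le> 1 - measure_pmf.prob (K (A l)) (G (A l)) + exp (- (real k * 2 powr (- \<alpha>2)))"
    if l: "l \<in> set_pmf q" for l
  proof -
    have "{c. \<forall>t<k. c t \<notin> G (A l)} = Pi {..<k} (\<lambda>_. - G (A l))" by (auto simp: Pi_def)
    then have "measure_pmf.prob M {c. \<forall>t<k. c t \<notin> G (A l)} = measure_pmf.prob pU (- G (A l)) ^ k"
      unfolding M_def by (simp add: measure_Pi_pmf_Pi)
    also have "measure_pmf.prob pU (- G (A l)) = 1 - measure_pmf.prob pU (G (A l))"
      using measure_pmf.prob_compl[of "G (A l)" pU] by (simp add: Compl_eq_Diff_UNIV)
    also have "\<dots> ^ k \<le> 1 - measure_pmf.prob (K (A l)) (G (A l)) + exp (- (real k * 2 powr (- \<alpha>2)))"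
      by (rule power_le_covering) (use prob_cover[OF l] in auto)
    finally show ?thesis .
  qed
  have f2: "measure_pmf.prob M {c. c (fst x) \<in> G (A l) \<and> 2 powr \<gamma> \<le> ratio C (c (snd x)) (C l)} \<le> 2 powr (- \<alpha>1 - \<gamma>)"
    if l: "l \<in> set_pmf q" and x: "x \<in> R" for l x
  proof -
    obtain t t' where x': "x = (t, t')" "t < k" "t' < k" "t \<noteq> t'" using x R by auto
    let ?E = "{u. 2 powr \<gamma> \<le> ratio C u (C l)}"
    \<comment> \<open>The positions \<open>t\<close> and \<open>t'\<close> differ, so this is a
      product event over codewords with only two nontrivial factors.\<close>
    let ?X = "\<lambda>i. if i = t then G (A l) else if i = t' then ?E else UNIV"
    have "{c. c (fst x) \<in> G (A l) \<and> 2 powr \<gamma> \<le> ratio C (c (snd x)) (C l)} = Pi {..<k} ?X"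
      using x' by (auto simp: Pi_def split: if_splits)
    then have "measure_pmf.prob M {c. c (fst x) \<in> G (A l) \<and> 2 powr \<gamma> \<le> ratio C (c (snd x)) (C l)}
      = (\<Prod>i<k. measure_pmf.prob pU (?X i))"
      unfolding M_def by (simp add: measure_Pi_pmf_Pi)
    also have "{..<k} = insert t (insert t' ({..<k} - {t, t'}))" using x' by auto
    also have "(\<Prod>i\<in>\<dots>. measure_pmf.prob pU (?X i)) = measure_pmf.prob pU (G (A l)) * measure_pmf.prob pU ?E"
    proof -
      have "(\<Prod>i\<in>{..<k} - {t, t'}. measure_pmf.prob pU (?X i)) = 1"
        by (rule prod.neutral) auto
      then show ?thesis using x'(4) by simp
    qed
    also have "\<dots> \<le> 2 powr (- \<alpha>1) * 2 powr (- \<gamma>)"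
      by (intro mult_mono prob_G_le[OF l] prob_confusable[OF l]) auto
    finally show ?thesis by (simp flip: powr_add)
  qed
  have "(\<Sum>c\<in>set_pmf M. pmf M c * (fail c k + coll c R))
    = (\<Sum>c\<in>set_pmf M. \<Sum>l\<in>set_pmf q. pmf q l * (pmf M c * indicator {c. \<forall>t<k. c t \<notin> G (A l)} c
      + (\<Sum>x\<in>R. pmf M c * indicator {c. c (fst x) \<in> G (A l) \<and> 2 powr \<gamma> \<le> ratio C (c (snd x)) (C l)} c)))"
    unfolding fail_def coll_def sum.distrib[symmetric] distrib_left[symmetric] sum_distrib_left[symmetric]
    by (intro sum.cong refl) (simp only: sum_distrib_left mult.left_commute)
  also have "\<dots> = (\<Sum>l\<in>set_pmf q. pmf q l * (measure_pmf.prob M {c. \<forall>t<k. c t \<notin> G (A l)}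
      + (\<Sum>x\<in>R. measure_pmf.prob M {c. c (fst x) \<in> G (A l) \<and> 2 powr \<gamma> \<le> ratio C (c (snd x)) (C l)})))"
    unfolding prob_eq_sum[OF finM]
    by (subst sum.swap, subst (2) sum.swap) (simp only: sum.distrib sum_distrib_left[symmetric])
  also have "\<dots> \<le> (\<Sum>l\<in>set_pmf q. pmf q l * ((1 - measure_pmf.prob (K (A l)) (G (A l)) + exp (- (real k * 2 powr (- \<alpha>2))))
      + (\<Sum>x\<in>R. 2 powr (- \<alpha>1 - \<gamma>))))"
    by (intro sum_mono mult_left_mono add_mono f1 f2) auto
  also have "\<dots> = (\<Sum>l\<in>set_pmf q. pmf q l * (1 - measure_pmf.prob (K (A l)) (G (A l))))
      + (\<Sum>l\<in>set_pmf q. pmf q l) * (exp (- (real k * 2 powr (- \<alpha>2))) + card R * 2 powr (- \<alpha>1 - \<gamma>))"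
    by (simp only: sum_distrib_right distrib_left sum.distrib sum_constant add.assoc)
  also have "\<dots> \<le> \<eta> + (exp (- (real k * 2 powr (- \<alpha>2))) + card R * 2 powr (- \<alpha>1 - \<gamma>))"
    using sum_prob_not_G[OF atypical] finq by simp
  finally have "(\<Sum>c\<in>set_pmf M. pmf M c * (fail c k + coll c R))
    \<le> \<eta> + exp (- (real k * 2 powr (- \<alpha>2))) + card R * 2 powr (- \<alpha>1 - \<gamma>)" by simp
  from exists_le_expectation[OF finM this] show ?thesis using that by blast
qed

end

section \<open>Binning: encoder, decoder and their analysis\<close>

context one_shot
begin

definition idx :: "(nat \<Rightarrow> 'u) \<Rightarrow> nat \<Rightarrow> 'a \<Rightarrow> nat" where
  "idx c k a = (LEAST t. t < k \<and> c t \<in> G a)"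

text \<open>The index is split in base \<open>n\<close>: the quotient is the bin, the remainder the
  position in it, so both together identify the selected codeword. Uncovered observations share
  \<open>(0, 0)\<close> with codeword 0, which is why the entropy estimates work inside
  \<open>success\<close>.\<close>

definition enc :: "(nat \<Rightarrow> 'u) \<Rightarrow> nat \<Rightarrow> nat \<Rightarrow> 'a \<Rightarrow> nat \<times> nat" where
  "enc c k n a = (if \<exists>t<k. c t \<in> G a then (idx c k a mod n, idx c k a div n) else (0, 0))"

text \<open>If nothing in the bin passes the test the value is unspecified; the error bound counts
  this case as a failure of \<open>success\<close>.\<close>

definition dec :: "(nat \<Rightarrow> 'u) \<Rightarrow> nat \<Rightarrow> 'c \<Rightarrow> nat \<Rightarrow> nat" where
  "dec c n y m = (LEAST s. s < n \<and> 2 powr \<gamma> \<le> ratio C (c (m * n + s)) y)"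

definition success :: "(nat \<Rightarrow> 'u) \<Rightarrow> nat \<Rightarrow> 'l set" where
  "success c k = {l. (\<exists>t<k. c t \<in> G (A l)) \<and> (c (idx c k (A l)), l) \<in> typical}"

definition bin_pairs :: "nat \<Rightarrow> nat \<Rightarrow> (nat \<times> nat) set" where
  "bin_pairs n k = {(t, t'). t < k \<and> t' < k \<and> t \<noteq> t' \<and> t div n = t' div n}"

lemma idx:
  assumes "\<exists>t<k. c t \<in> G a"
  shows "idx c k a < k" "c (idx c k a) \<in> G a"
  using LeastI_ex[OF assms[unfolded Bex_def]] by (auto simp: idx_def)

text \<open>Every position has at most \<open>n - 1\<close> partners in its bin. It matters that
  this is not \<open>n\<close>: with one word per bin nothing can be confused, which settles key
  rates near 0.\<close>

lemma card_bin_pairs: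
  assumes "0 < n"
  shows "card (bin_pairs n k) \<le> k * (n - 1)"
proof -
  have "bin_pairs n k \<subseteq> (SIGMA t:{..<k}. (\<lambda>s. t div n * n + s) ` ({..<n} - {t mod n}))"
  proof
    fix x assume "x \<in> bin_pairs n k"
    then obtain t t' where x: "x = (t, t')" "t < k" "t \<noteq> t'" "t div n = t' div n"
      by (auto simp: bin_pairs_def)
    have "t' = t div n * n + t' mod n" using x(4) by simp
    moreover have "t' mod n \<noteq> t mod n" using x(3,4) by (metis div_mult_mod_eq)
    moreover have "t' mod n < n" using assms by simp
    ultimately show "x \<in> (SIGMA t:{..<k}. (\<lambda>s. t div n * n + s) ` ({..<n} - {t mod n}))"
      using x(1,2) by blast
  qed
  then have "card (bin_pairs n k) \<le> card (SIGMA t:{..<k}. (\<lambda>s. t div n * n + s) ` ({..<n} - {t mod n}))"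
    by (rule card_mono[rotated]) auto
  also have "\<dots> = (\<Sum>t<k. card ((\<lambda>s. t div n * n + s) ` ({..<n} - {t mod n})))"
    by (rule card_SigmaI) auto
  also have "\<dots> = (\<Sum>t<k. n - 1)"
    by (intro sum.cong refl) (subst card_image, auto simp: assms)
  finally show ?thesis by simp
qed

text \<open>The selected codeword is a function of the observation and lies in \<open>G\<close>, so
  its atypical continuations have at most \<open>\<eta>\<close> times the mass of that
  observation.\<close>

lemma prob_success:
  "measure_pmf.prob q (- success c k) \<le> fail c k + \<eta>"
proof -
  let ?ok = "\<lambda>a. \<exists>t<k. c t \<in> G a"
  let ?S = "set_pmf q"
  have "measure_pmf.prob q (- success c k)
    \<le> (\<Sum>l\<in>?S. pmf q l * (indicator {c. \<forall>t<k. c t \<notin> G (A l)} c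
      + (if ?ok (A l) then indicator (- typical) (c (idx c k (A l)), l) else 0)))"
    unfolding prob_eq_sum[OF finq]
    by (intro sum_mono mult_left_mono) (auto simp: success_def indicator_def)
  also have "\<dots> = fail c k + (\<Sum>l\<in>?S. pmf q l * (if ?ok (A l) then indicator (- typical) (c (idx c k (A l)), l) else 0))"
    by (simp only: fail_def distrib_left sum.distrib)
  also have "(\<Sum>l\<in>?S. pmf q l * (if ?ok (A l) then indicator (- typical) (c (idx c k (A l)), l) else 0))
    = (\<Sum>a\<in>A ` ?S. if ?ok a then badmass (c (idx c k a)) a else 0)"
    unfolding sum.image_gen[OF finq, of _ A]
  proof (rule sum.cong[OF refl])
    fix a assume "a \<in> A ` ?S"
    have "(\<Sum>l\<in>{l \<in> ?S. A l = a}. pmf q l * (if ?ok (A l) then indicator (- typical) (c (idx c k (A l)), l) else 0))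
      = (\<Sum>l\<in>{l \<in> ?S. A l = a}. pmf q l * (if ?ok a then indicator (- typical) (c (idx c k a), l) else 0))"
      by (rule sum.cong) auto
    also have "\<dots> = (if ?ok a then badmass (c (idx c k a)) a else 0)"
    proof (cases "?ok a")
      case True
      then show ?thesis by (simp only: badmass_def if_True)
    next
      case False
      then show ?thesis by (simp only: if_False mult_zero_right sum.neutral_const)
    qed
    finally show "(\<Sum>l\<in>{l \<in> ?S. A l = a}. pmf q l * (if ?ok (A l) then indicator (- typical) (c (idx c k (A l)), l) else 0))
      = (if ?ok a then badmass (c (idx c k a)) a else 0)" .
  qed
  also have "\<dots> \<le> (\<Sum>a\<in>A ` ?S. \<eta> * pr q A a)"
    using idx(2) eta by (intro sum_mono) (auto simp: G_def)
  also have "\<dots> = \<eta>" using sum_pr_eq_1[OF finq, of A] by (simp flip: sum_distrib_left)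
  finally show ?thesis by simp
qed

text \<open>On success the true position passes the decoder's test, so the decoder returns a
  position that passes it as well. If that is a different one, the two form a pair counted in
  \<open>coll\<close>.\<close>

lemma prob_error:
  assumes n: "0 < n" and k: "k = n * m"
  shows "measure_pmf.prob q {l. dec c n (C l) (snd (enc c k n (A l))) \<noteq> fst (enc c k n (A l))}
    \<le> fail c k + coll c (bin_pairs n k) + \<eta>"
proof -
  let ?R = "bin_pairs n k"
  have finR: "finite ?R" by (rule finite_subset[of _ "{..<k} \<times> {..<k}"]) (auto simp: bin_pairs_def)
  let ?f = "\<lambda>l x. indicator {c. c (fst x) \<in> G (A l) \<and> 2 powr \<gamma> \<le> ratio C (c (snd x)) (C l)} c :: real"
  have "measure_pmf.prob q {l. dec c n (C l) (snd (enc c k n (A l))) \<noteq> fst (enc c k n (A l))}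
    \<le> (\<Sum>l\<in>set_pmf q. pmf q l * (indicator (- success c k) l + (\<Sum>x\<in>?R. ?f l x)))"
    unfolding prob_eq_sum[OF finq]
  proof (intro sum_mono mult_left_mono)
    fix l assume l: "l \<in> set_pmf q"
    have nn: "0 \<le> (\<Sum>x\<in>?R. ?f l x)" by (intro sum_nonneg) auto
    have one: "1 \<le> (\<Sum>x\<in>?R. ?f l x)"
      if W: "l \<in> success c k" and err: "dec c n (C l) (snd (enc c k n (A l))) \<noteq> fst (enc c k n (A l))"
    proof -
      define t where "t = idx c k (A l)"
      have ok: "\<exists>t<k. c t \<in> G (A l)" and typi: "(c t, l) \<in> typical" using W by (auto simp: success_def t_def)
      have t: "t < k" "c t \<in> G (A l)" using idx[OF ok] by (auto simp: t_def)
      have e: "enc c k n (A l) = (t mod n, t div n)" using ok by (simp add: enc_def t_def)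
      let ?cand = "\<lambda>s. s < n \<and> 2 powr \<gamma> \<le> ratio C (c (t div n * n + s)) (C l)"
      have "?cand (t mod n)" using n typi by (simp add: typical_def)
      then have d: "?cand (dec c n (C l) (t div n))" unfolding dec_def by (rule LeastI)
      define t' where "t' = t div n * n + dec c n (C l) (t div n)"
      have t'n: "t' div n = t div n" "t' mod n = dec c n (C l) (t div n)" using d n by (auto simp: t'_def)
      \<comment> \<open>Since \<open>k = n * m\<close>, all bins are full, so the decoder's choice
        is again an index below \<open>k\<close>.\<close>
      have "t div n < m" using t(1) n unfolding k by (simp add: less_mult_imp_div_less mult.commute)
      then have "t' < k" using t'n(1) n unfolding k by (metis div_less_iff_less_mult mult.commute)
      moreover have "t \<noteq> t'" using err t'n(2) by (auto simp: e)
      ultimately have "(t, t') \<in> ?R" using t(1) t'n(1) by (simp add: bin_pairs_def)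
      moreover have "?f l (t, t') = 1" using t(2) d by (simp add: t'_def)
      ultimately show ?thesis
        using member_le_sum[OF _ _ finR, of "(t, t')" "?f l"] by simp
    qed
    show "indicator {l. dec c n (C l) (snd (enc c k n (A l))) \<noteq> fst (enc c k n (A l))} l
      \<le> indicator (- success c k) l + (\<Sum>x\<in>?R. ?f l x)"
      using nn one by (auto simp: indicator_def)
  qed simp
  also have "\<dots> = measure_pmf.prob q (- success c k) + coll c ?R"
    by (simp only: prob_eq_sum[OF finq] coll_def distrib_left sum.distrib)
  finally show ?thesis using prob_success[of c k] by linarith
qed

text \<open>All source words in one cell select the same \<open>u\<close>, which lies in their
  \<open>G\<close>, so \<open>pmf (K (A v)) u\<close> is at least
  \<open>2 powr \<alpha>1 * pmf pU u\<close>. Inserting the quotient of the two bounds the mass of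
  the cell by a multiple of the joint mass of \<open>u\<close> and \<open>f l\<close>.\<close>

lemma code_mass:
  fixes f :: "'l \<Rightarrow> 'v"
  assumes n: "0 < n" and l: "l \<in> set_pmf q" and W: "l \<in> success c k"
  defines "u \<equiv> c (idx c k (A l))"
  shows "pr q (\<lambda>l. (enc c k n (A l), f l, l \<in> success c k)) (enc c k n (A l), f l, True)
    \<le> 2 powr (- \<alpha>1) * (pr P (\<lambda>w. (fst w, f (snd w))) (u, f l) / pmf pU u)"
    and "u \<in> set_pmf (K (A l))"
proof -
  have ok: "\<exists>t<k. c t \<in> G (A l)" using W by (simp add: success_def)
  have uG: "u \<in> G (A l)" using idx(2)[OF ok] by (simp add: u_def)
  then show u: "u \<in> set_pmf (K (A l))" by (simp add: G_def)
  have pos: "0 < pmf pU u" by (rule pU_pos[OF l u])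
  let ?E = "{v \<in> set_pmf q. (enc c k n (A v), f v, v \<in> success c k) = (enc c k n (A l), f l, True)}"
  have "(\<Sum>v\<in>?E. pmf q v) \<le> (\<Sum>v\<in>?E. 2 powr (- \<alpha>1) / pmf pU u * (pmf q v * pmf (K (A v)) u))"
  proof (rule sum_mono)
    fix v assume v: "v \<in> ?E"
    then have okv: "\<exists>t<k. c t \<in> G (A v)" by (simp add: success_def)
    have "idx c k (A v) mod n = idx c k (A l) mod n" "idx c k (A v) div n = idx c k (A l) div n"
      using v ok okv by (auto simp: enc_def)
    then have "idx c k (A v) = idx c k (A l)" by (metis div_mult_mod_eq)
    then have "u \<in> G (A v)" using idx(2)[OF okv] by (simp add: u_def)
    then have "2 powr \<alpha>1 * pmf pU u \<le> pmf (K (A v)) u" using v by (intro G_bounds(1)) auto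
    then have "1 \<le> 2 powr (- \<alpha>1) / pmf pU u * pmf (K (A v)) u"
      using pos by (simp add: powr_minus field_simps)
    from mult_left_mono[OF this, of "pmf q v"]
    show "pmf q v \<le> 2 powr (- \<alpha>1) / pmf pU u * (pmf q v * pmf (K (A v)) u)"
      by (simp add: mult_ac)
  qed
  also have "\<dots> \<le> (\<Sum>v\<in>{v\<in>set_pmf q. f v = f l}. 2 powr (- \<alpha>1) / pmf pU u * (pmf q v * pmf (K (A v)) u))"
    by (rule sum_mono2) (use finq in auto)
  also have "\<dots> = 2 powr (- \<alpha>1) * (pr P (\<lambda>w. (fst w, f (snd w))) (u, f l) / pmf pU u)"
    unfolding sum_distrib_left[symmetric] joint_eq by simp
  finally show "pr q (\<lambda>l. (enc c k n (A l), f l, l \<in> success c k)) (enc c k n (A l), f l, True)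
    \<le> 2 powr (- \<alpha>1) * (pr P (\<lambda>w. (fst w, f (snd w))) (u, f l) / pmf pU u)"
    unfolding pr_eq_sum[OF finq] .
qed

text \<open>Secrecy, uniformity and leakage are later read off from the two entropy bounds. Of the
  two \<open>\<eta>\<close> in \<open>e\<close>, one comes from the codebook average and one from
  atypical continuations of the selected word.\<close>

lemma one_shot_code:
  assumes atypical: "measure_pmf.prob P (- typical) \<le> \<eta>\<^sup>2" and n: "0 < n" and m: "0 < m"
  defines "e \<equiv> 2 * \<eta> + exp (- (real (n * m) * 2 powr (- \<alpha>2))) + real (n * m) * real (n - 1) * 2 powr (- \<alpha>1 - \<gamma>)"
  obtains Enc Dec where "\<And>a. fst (Enc a) < n" "\<And>a. snd (Enc a) < m"
    "measure_pmf.prob q {l. Dec (C l) (snd (Enc (A l))) \<noteq> fst (Enc (A l))} \<le> e"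
    "\<alpha>1 - e * \<bar>\<alpha>1\<bar> - 1 \<le> ent q (\<lambda>l. Enc (A l))"
    "(\<alpha>1 - \<beta>) - e * \<bar>\<alpha>1 - \<beta>\<bar> - 1 \<le> ent q (\<lambda>l. (Enc (A l), B l)) - ent q B"
proof -
  let ?k = "n * m"
  obtain c where c: "fail c ?k + coll c (bin_pairs n ?k)
    \<le> \<eta> + exp (- (real ?k * 2 powr (- \<alpha>2))) + card (bin_pairs n ?k) * 2 powr (- \<alpha>1 - \<gamma>)"
    using exists_codebook[OF atypical, of "bin_pairs n ?k" ?k] by (auto simp: bin_pairs_def)
  have "real (card (bin_pairs n ?k)) \<le> real ?k * real (n - 1)"
    using card_bin_pairs[OF n, of ?k] by (metis of_nat_le_iff of_nat_mult)
  from mult_right_mono[OF this powr_ge_zero, of 2 "- \<alpha>1 - \<gamma>"]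
  have ce: "fail c ?k + coll c (bin_pairs n ?k) + \<eta> \<le> e" using c unfolding e_def by linarith
  have coll0: "0 \<le> coll c (bin_pairs n ?k)" unfolding coll_def by (intro sum_nonneg mult_nonneg_nonneg) auto
  have "measure_pmf.prob q (- success c ?k) \<le> e" using prob_success[of c ?k] ce coll0 by linarith
  then have succ: "1 - e \<le> measure_pmf.prob q (success c ?k)"
    using measure_pmf.prob_compl[of "success c ?k" q] by (simp add: Compl_eq_Diff_UNIV)
  \<comment> \<open>The exponent may be negative, hence the absolute value.\<close>
  have low: "x - e * \<bar>x\<bar> \<le> x * measure_pmf.prob q (success c ?k)" for x :: real
  proof -
    have "(1 - measure_pmf.prob q (success c ?k)) * x \<le> (1 - measure_pmf.prob q (success c ?k)) * \<bar>x\<bar>"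
      by (intro mult_left_mono) auto
    also have "\<dots> \<le> e * \<bar>x\<bar>" using succ by (intro mult_right_mono) auto
    finally show ?thesis by (simp add: algebra_simps)
  qed
  let ?E = "enc c ?k n"
  show ?thesis
  proof (rule that[of ?E "dec c n"])
    show "fst (?E a) < n" for a using n by (simp add: enc_def)
    show "snd (?E a) < m" for a
      using n m idx(1)[of ?k c a] by (auto simp: enc_def less_mult_imp_div_less mult.commute)
    show "measure_pmf.prob q {l. dec c n (C l) (snd (?E (A l))) \<noteq> fst (?E (A l))} \<le> e"
      using prob_error[OF n refl, of c m] ce by linarith
    \<comment> \<open>Unconditional entropy is treated as entropy given a constant.\<close>
    have "\<alpha>1 * measure_pmf.prob q (success c ?k) - 1 \<le> ent q (\<lambda>l. (?E (A l), ())) - ent q (\<lambda>_. ())"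
    proof (rule cond_ent_ge[OF finq])
      fix l assume l: "l \<in> set_pmf q" "l \<in> success c ?k"
      define u where "u = c (idx c ?k (A l))"
      have u: "0 < pmf pU u" using code_mass(2)[OF n l] pU_pos[OF l(1)] by (simp add: u_def)
      have "map_pmf (\<lambda>w. (fst w, ())) P = map_pmf (\<lambda>u. (u, ())) pU"
        by (simp add: pmf.map_comp o_def del: map_pmf_comp)
      then have "pr P (\<lambda>w. (fst w, ())) (u, ()) = pmf pU u"
        using pmf_map_inj'[of "\<lambda>u. (u, ())" pU u] by (simp add: inj_on_def)
      then show "pr q (\<lambda>l. (?E (A l), (), l \<in> success c ?k)) (?E (A l), (), True)
        \<le> 2 powr (- \<alpha>1) * pr q (\<lambda>_. ()) ()"
        using code_mass(1)[OF n l, of "\<lambda>_. ()"] u by (simp add: u_def)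
    qed
    moreover have "ent q (\<lambda>l. (?E (A l), ())) = ent q (\<lambda>l. ?E (A l))"
      by (rule ent_cong[OF finq]) auto
    ultimately show "\<alpha>1 - e * \<bar>\<alpha>1\<bar> - 1 \<le> ent q (\<lambda>l. ?E (A l))" using low[of \<alpha>1] by simp
    have "(\<alpha>1 - \<beta>) * measure_pmf.prob q (success c ?k) - 1 \<le> ent q (\<lambda>l. (?E (A l), B l)) - ent q B"
    proof (rule cond_ent_ge[OF finq])
      fix l assume l: "l \<in> set_pmf q" "l \<in> success c ?k"
      define u where "u = c (idx c ?k (A l))"
      have u: "0 < pmf pU u" using code_mass(2)[OF n l] pU_pos[OF l(1)] by (simp add: u_def)
      have b: "0 < pr q B (B l)" by (rule pr_pos[OF l(1)])
      have "ratio B u (B l) \<le> 2 powr \<beta>" using l(2) by (simp add: success_def typical_def u_def)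
      then have "pr P (\<lambda>w. (fst w, B (snd w))) (u, B l) / pmf pU u \<le> 2 powr \<beta> * pr q B (B l)"
        using u b by (simp add: ratio_def field_simps)
      from mult_left_mono[OF this, of "2 powr (- \<alpha>1)"]
      have "2 powr (- \<alpha>1) * (pr P (\<lambda>w. (fst w, B (snd w))) (u, B l) / pmf pU u) \<le> 2 powr (- (\<alpha>1 - \<beta>)) * pr q B (B l)"
        by (simp add: powr_diff powr_minus field_simps)
      then show "pr q (\<lambda>l. (?E (A l), B l, l \<in> success c ?k)) (?E (A l), B l, True)
        \<le> 2 powr (- (\<alpha>1 - \<beta>)) * pr q B (B l)"
        using code_mass(1)[OF n l, of B] by (simp add: u_def)
    qed
    then show "(\<alpha>1 - \<beta>) - e * \<bar>\<alpha>1 - \<beta>\<bar> - 1 \<le> ent q (\<lambda>l. (?E (A l), B l)) - ent q B"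
      using low[of "\<alpha>1 - \<beta>"] by simp
  qed
qed

end

section \<open>Block codes for memoryless sources\<close>

primrec kernel_pmf :: "('a \<Rightarrow> 'u pmf) \<Rightarrow> 'a list \<Rightarrow> 'u list pmf" where
  "kernel_pmf K [] = return_pmf []"
| "kernel_pmf K (a # as) = map_pmf (\<lambda>w. fst w # snd w) (pair_pmf (K a) (kernel_pmf K as))"

lemma finite_kernel_pmf: "(\<And>a. finite (set_pmf (K a))) \<Longrightarrow> finite (set_pmf (kernel_pmf K as))"
  by (induction as) auto

text \<open>Codeword and source block are drawn together letter by letter, so the block version of
  \<open>P\<close> is again i.i.d. and Chebyshev's inequality applies to its information
  density.\<close>

lemma attach_iid_pmf:
  "attach_pmf (iid_pmf N q) (\<lambda>l. kernel_pmf K (map a l))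
    = map_pmf (\<lambda>ws. (map fst ws, map snd ws)) (iid_pmf N (attach_pmf q (\<lambda>l. K (a l))))"
proof (induction N)
  case 0
  then show ?case by (simp add: attach_pmf_def bind_return_pmf)
next
  case (Suc N)
  have "attach_pmf (iid_pmf (Suc N) q) (\<lambda>l. kernel_pmf K (map a l))
    = bind_pmf q (\<lambda>x. bind_pmf (iid_pmf N q) (\<lambda>l. bind_pmf (K (a x)) (\<lambda>u. bind_pmf (kernel_pmf K (map a l)) (\<lambda>us. return_pmf (u # us, x # l)))))"
    by (simp add: attach_pmf_def map_pmf_def bind_assoc_pmf bind_return_pmf pair_pmf_def)
  also have "\<dots> = bind_pmf q (\<lambda>x. bind_pmf (K (a x)) (\<lambda>u. bind_pmf (iid_pmf N q) (\<lambda>l. bind_pmf (kernel_pmf K (map a l)) (\<lambda>us. return_pmf (u # us, x # l)))))"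
    by (subst bind_commute_pmf) (rule refl)
  also have "\<dots> = bind_pmf q (\<lambda>x. bind_pmf (K (a x)) (\<lambda>u.
      map_pmf (\<lambda>w. (u # fst w, x # snd w)) (attach_pmf (iid_pmf N q) (\<lambda>l. kernel_pmf K (map a l)))))"
    by (simp add: attach_pmf_def map_pmf_def bind_assoc_pmf bind_return_pmf)
  also have "\<dots> = map_pmf (\<lambda>ws. (map fst ws, map snd ws)) (iid_pmf (Suc N) (attach_pmf q (\<lambda>l. K (a l))))"
    unfolding Suc by (simp add: attach_pmf_def map_pmf_def bind_assoc_pmf bind_return_pmf)
  finally show ?case .
qed

lemma pmf_map_unzip_iid_pmf:
  assumes "length ws = N"
  shows "pmf (map_pmf (\<lambda>ws. (map f ws, map g ws)) (iid_pmf N p)) (map f ws, map g ws)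
    = (\<Prod>w\<leftarrow>ws. pr p (\<lambda>w. (f w, g w)) (f w, g w))"
proof -
  let ?h = "\<lambda>zs :: ('b \<times> 'c) list. (map fst zs, map snd zs)"
  have "inj ?h" by (rule injI) (metis fst_conv snd_conv zip_map_fst_snd)
  moreover have "map_pmf (\<lambda>ws. (map f ws, map g ws)) (iid_pmf N p) = map_pmf ?h (iid_pmf N (map_pmf (\<lambda>w. (f w, g w)) p))"
    unfolding map_iid_pmf[symmetric] pmf.map_comp by (simp add: o_def)
  ultimately show ?thesis
    using pmf_map_inj'[of ?h "iid_pmf N (map_pmf (\<lambda>w. (f w, g w)) p)" "map (\<lambda>w. (f w, g w)) ws"]
      pmf_iid_pmf[of "map (\<lambda>w. (f w, g w)) ws"] assms by (simp add: o_def)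
qed

lemma prod_list_powr_log:
  assumes "\<And>w. w \<in> set ws \<Longrightarrow> 0 < r w"
  shows "(\<Prod>w\<leftarrow>ws. r w) = 2 powr (\<Sum>w\<leftarrow>ws. log 2 (r w))"
  using assms by (induction ws) (simp_all add: powr_add)

section \<open>Information density and its concentration\<close>

definition info_dens :: "'l pmf \<Rightarrow> ('l \<Rightarrow> 'u pmf) \<Rightarrow> ('l \<Rightarrow> 'v) \<Rightarrow> 'u \<times> 'l \<Rightarrow> real" where
  "info_dens q K f w = log 2 (pr (attach_pmf q K) (\<lambda>w. (fst w, f (snd w))) (fst w, f (snd w))
     / (pr (attach_pmf q K) fst (fst w) * pr q f (f (snd w))))"

definition info :: "'l pmf \<Rightarrow> ('l \<Rightarrow> 'u pmf) \<Rightarrow> ('l \<Rightarrow> 'v) \<Rightarrow> real" where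
  "info q K f = ent q f - (ent (attach_pmf q K) (\<lambda>w. (fst w, f (snd w))) - ent (attach_pmf q K) fst)"

context
  fixes q :: "'l pmf" and K :: "'l \<Rightarrow> 'u pmf"
  assumes finq: "finite (set_pmf q)" and finK: "\<And>l. finite (set_pmf (K l))"
begin

private abbreviation "P \<equiv> attach_pmf q K"

lemma finite_attach: "finite (set_pmf P)" using finq finK by simp

lemma pr_snd_attach: "pr P (\<lambda>w. f (snd w)) v = pr q f v"
  by (simp flip: pmf.map_comp[unfolded o_def, of f snd])

lemma mean_info_dens: "(\<Sum>w\<in>set_pmf P. pmf P w * info_dens q K f w) = info q K f"
proof -
  let ?J = "\<lambda>w. (fst w, f (snd w))"
  have "(\<Sum>w\<in>set_pmf P. pmf P w * info_dens q K f w) = (\<Sum>w\<in>set_pmf P. pmf P w * log 2 (pr P ?J (?J w))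
      - pmf P w * log 2 (pr P fst (fst w)) - pmf P w * log 2 (pr P (\<lambda>w. f (snd w)) (f (snd w))))"
  proof (rule sum.cong[OF refl])
    fix w assume w: "w \<in> set_pmf P"
    show "pmf P w * info_dens q K f w = pmf P w * log 2 (pr P ?J (?J w))
      - pmf P w * log 2 (pr P fst (fst w)) - pmf P w * log 2 (pr P (\<lambda>w. f (snd w)) (f (snd w)))"
      using pr_pos[OF w, of fst] pr_pos[OF w, of "\<lambda>w. f (snd w)"] pr_pos[OF w, of ?J]
      unfolding info_dens_def pr_snd_attach by (simp add: log_divide log_mult algebra_simps)
  qed
  then show ?thesis
    using ent_attach_pmf_snd[of q K f] by (simp add: info_def sum_subtractf ent_alt[OF finite_attach])
qed

lemma info_dens_deviation:
  assumes "0 < \<delta>"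
  obtains v where "0 \<le> v" "\<And>N. 0 < N \<Longrightarrow>
    measure_pmf.prob (iid_pmf N P) {ws. \<bar>(\<Sum>w\<leftarrow>ws. info_dens q K f w) - N * info q K f\<bar> > N * \<delta>} \<le> v / N"
proof (rule that)
  let ?v = "(\<Sum>w\<in>set_pmf P. pmf P w * (info_dens q K f w - info q K f)\<^sup>2) / \<delta>\<^sup>2"
  show "0 \<le> ?v" by (intro divide_nonneg_nonneg sum_nonneg mult_nonneg_nonneg) auto
  show "measure_pmf.prob (iid_pmf N P) {ws. \<bar>(\<Sum>w\<leftarrow>ws. info_dens q K f w) - N * info q K f\<bar> > N * \<delta>} \<le> ?v / N"
    if "0 < N" for N
  proof -
    have eq: "?v / N = (\<Sum>w\<in>set_pmf P. pmf P w * (info_dens q K f w - info q K f)\<^sup>2) / (N * \<delta>\<^sup>2)"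
      by (simp add: mult.commute)
    show ?thesis
      unfolding eq by (rule iid_pmf_chebyshev[OF finite_attach assms that, of "info_dens q K f", unfolded mean_info_dens])
  qed
qed

end

text \<open>The kernel reads only \<open>a\<close>, so the auxiliary variable and \<open>f\<close>
  are independent given \<open>a\<close>. Used to see that the number of bins has a nonnegative
  exponent.\<close>

lemma info_data_processing:
  assumes finq: "finite (set_pmf q)" and finK: "\<And>a. finite (set_pmf (K a))"
  shows "info q (\<lambda>l. K (a l)) f \<le> info q (\<lambda>l. K (a l)) a"
proof -
  let ?P = "attach_pmf q (\<lambda>l. K (a l))"
  have fin: "finite (set_pmf ?P)" using finq finK by simp
  have UAf: "pr ?P (\<lambda>w. (fst w, a (snd w), f (snd w))) (u, b, v) = pr q (\<lambda>l. (a l, f l)) (b, v) * pmf (K b) u" for u b v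
    using map_attach_pmf[of "\<lambda>l. (a l, f l)" q "\<lambda>b. K (fst b)"] by (simp add: pmf_attach_pmf)
  have UA: "pr ?P (\<lambda>w. (fst w, a (snd w))) (u, b) = pr q a b * pmf (K b) u" for u b
    unfolding map_attach_pmf pmf_attach_pmf ..
  have swap: "pr ?P (\<lambda>w. (fst w, f (snd w), a (snd w))) (u, v, b) = pr ?P (\<lambda>w. (fst w, a (snd w), f (snd w))) (u, b, v)"
    "pr ?P (\<lambda>w. (f (snd w), a (snd w))) (v, b) = pr ?P (\<lambda>w. (a (snd w), f (snd w))) (b, v)" for u b v
    unfolding pr_eq_sum[OF fin] by (rule sum.cong; auto)+
  have "ent ?P (\<lambda>w. (fst w, f (snd w), a (snd w))) + ent ?P (\<lambda>w. a (snd w))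
    = ent ?P (\<lambda>w. (fst w, a (snd w))) + ent ?P (\<lambda>w. (f (snd w), a (snd w)))"
  proof (rule ent_markov_eq[OF fin])
    fix w
    show "pr ?P (\<lambda>w. (fst w, f (snd w), a (snd w))) (fst w, f (snd w), a (snd w)) * pr ?P (\<lambda>w. a (snd w)) (a (snd w))
      = pr ?P (\<lambda>w. (fst w, a (snd w))) (fst w, a (snd w)) * pr ?P (\<lambda>w. (f (snd w), a (snd w))) (f (snd w), a (snd w))"
      unfolding swap UAf UA
      using pr_snd_attach[of q "\<lambda>l. K (a l)" a "a (snd w)"]
        pr_snd_attach[of q "\<lambda>l. K (a l)" "\<lambda>l. (a l, f l)" "(a (snd w), f (snd w))"] finq finK by simp
  qed
  moreover have "ent ?P (\<lambda>w. (fst w, f (snd w), a (snd w))) + ent ?P (\<lambda>w. f (snd w))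
    \<le> ent ?P (\<lambda>w. (fst w, f (snd w))) + ent ?P (\<lambda>w. (f (snd w), a (snd w)))"
    by (rule ent_submodular_refine[OF fin, where A = fst and B = "\<lambda>w. a (snd w)"]) auto
  ultimately show ?thesis
    using ent_attach_pmf_snd[of q "\<lambda>l. K (a l)" a] ent_attach_pmf_snd[of q "\<lambda>l. K (a l)" f] by (simp add: info_def)
qed

text \<open>The one-shot code for blocks, with exponents \<open>N\<close> times the mean densities
  shifted by \<open>\<delta>\<close>. \<open>N0\<close> is fixed before \<open>n\<close> and
  \<open>m\<close>, which may then grow with \<open>N\<close>.\<close>

lemma block_code:
  fixes A :: "'l \<Rightarrow> 'a" and B :: "'l \<Rightarrow> 'b" and C :: "'l \<Rightarrow> 'c" and K :: "'a \<Rightarrow> 'u pmf"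
  assumes fin_q: "finite (set_pmf q)" and fin_K: "\<And>a. finite (set_pmf (K a))"
    and \<delta>: "0 < \<delta>" and \<eta>: "0 < \<eta>" "\<eta> < 1"
  defines "IA \<equiv> info q (\<lambda>l. K (A l)) A" and "IB \<equiv> info q (\<lambda>l. K (A l)) B" and "IC \<equiv> info q (\<lambda>l. K (A l)) C"
  obtains N0 where "\<And>N n m. N0 \<le> N \<Longrightarrow> 0 < n \<Longrightarrow> 0 < m \<Longrightarrow> \<exists>Enc Dec.
    (\<forall>a. fst (Enc a) < n) \<and> (\<forall>a. snd (Enc a) < m) \<and>
    (let e = 2 * \<eta> + exp (- (real (n * m) * 2 powr (- (N * (IA + \<delta>))))) +
         real (n * m) * real (n - 1) * 2 powr (- (N * (IA - \<delta>)) - N * (IC - \<delta>)) in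
    measure_pmf.prob (iid_pmf N q) {l. Dec (map C l) (snd (Enc (map A l))) \<noteq> fst (Enc (map A l))} \<le> e \<and>
    N * (IA - \<delta>) - e * \<bar>N * (IA - \<delta>)\<bar> - 1 \<le> ent (iid_pmf N q) (\<lambda>l. Enc (map A l)) \<and>
    (N * (IA - \<delta>) - N * (IB + \<delta>)) - e * \<bar>N * (IA - \<delta>) - N * (IB + \<delta>)\<bar> - 1
      \<le> ent (iid_pmf N q) (\<lambda>l. (Enc (map A l), map B l)) - ent (iid_pmf N q) (map B))"
proof -
  let ?K = "\<lambda>l. K (A l)"
  let ?P0 = "attach_pmf q ?K"
  have fin_K': "finite (set_pmf (?K l))" for l by (rule fin_K)
  have fin0: "finite (set_pmf ?P0)" using fin_q fin_K by simp
  note dev = info_dens_deviation[of q ?K, OF fin_q fin_K' \<delta>]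
  obtain vA where vA: "0 \<le> vA" "\<And>N. 0 < N \<Longrightarrow>
    measure_pmf.prob (iid_pmf N ?P0) {ws. \<bar>(\<Sum>w\<leftarrow>ws. info_dens q ?K A w) - N * IA\<bar> > N * \<delta>} \<le> vA / N"
    unfolding IA_def by (rule dev[of A]) blast
  obtain vB where vB: "0 \<le> vB" "\<And>N. 0 < N \<Longrightarrow>
    measure_pmf.prob (iid_pmf N ?P0) {ws. \<bar>(\<Sum>w\<leftarrow>ws. info_dens q ?K B w) - N * IB\<bar> > N * \<delta>} \<le> vB / N"
    unfolding IB_def by (rule dev[of B]) blast
  obtain vC where vC: "0 \<le> vC" "\<And>N. 0 < N \<Longrightarrow>
    measure_pmf.prob (iid_pmf N ?P0) {ws. \<bar>(\<Sum>w\<leftarrow>ws. info_dens q ?K C w) - N * IC\<bar> > N * \<delta>} \<le> vC / N"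
    unfolding IC_def by (rule dev[of C]) blast
  \<comment> \<open>From here on the three Chebyshev bounds sum to at most
    \<open>\<eta>\<^sup>2\<close>; \<open>Suc\<close> keeps \<open>N\<close> positive.\<close>
  define N0 where "N0 = Suc (nat \<lceil>(vA + vB + vC) / \<eta>\<^sup>2\<rceil>)"
  show ?thesis
  proof (rule that[of N0])
    fix N n m :: nat assume N: "N0 \<le> N" and n: "0 < n" and m: "0 < m"
    let ?q = "iid_pmf N q" and ?KN = "\<lambda>as. kernel_pmf K as"
    interpret one_shot ?q "map A" "map B" "map C" ?KN "N * (IA - \<delta>)" "N * (IA + \<delta>)" "N * (IB + \<delta>)" "N * (IC - \<delta>)" \<eta>
      by unfold_locales (use fin_q fin_K \<eta> in \<open>auto intro: finite_kernel_pmf\<close>)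
    have N': "0 < N" "(vA + vB + vC) / \<eta>\<^sup>2 \<le> N" using N by (simp_all add: N0_def) linarith
    have Peq: "P = map_pmf (\<lambda>ws. (map fst ws, map snd ws)) (iid_pmf N ?P0)"
      by (rule attach_iid_pmf)
    have pU: "pU = iid_pmf N (map_pmf fst ?P0)"
      unfolding Peq pmf.map_comp by (simp add: o_def map_iid_pmf)
    \<comment> \<open>The joint law and both marginals are products over positions, so the logarithm
      of the block ratio is a sum of letter densities.\<close>
    have ratio: "ratio (map f) (map fst ws) (map f (map snd ws)) = 2 powr (\<Sum>w\<leftarrow>ws. info_dens q ?K f w)"
      if ws: "ws \<in> set_pmf (iid_pmf N ?P0)" for ws and f :: "'l \<Rightarrow> 'v"
    proof -
      have len: "length ws = N" using ws by (rule length_iid_pmf)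
      let ?r = "\<lambda>w. pr ?P0 (\<lambda>w. (fst w, f (snd w))) (fst w, f (snd w)) / (pr ?P0 fst (fst w) * pr q f (f (snd w)))"
      have 1: "pr P (\<lambda>w. (fst w, map f (snd w))) (map fst ws, map f (map snd ws))
        = (\<Prod>w\<leftarrow>ws. pr ?P0 (\<lambda>w. (fst w, f (snd w))) (fst w, f (snd w)))"
        using pmf_map_unzip_iid_pmf[OF len, of fst "\<lambda>w. f (snd w)" ?P0]
        unfolding Peq pmf.map_comp by (simp add: o_def)
      have 2: "pmf pU (map fst ws) = (\<Prod>w\<leftarrow>ws. pr ?P0 fst (fst w))"
        using pmf_iid_pmf[of "map fst ws" "map_pmf fst ?P0"] len unfolding pU by (simp add: o_def)
      have 3: "pr ?q (map f) (map f (map snd ws)) = (\<Prod>w\<leftarrow>ws. pr q f (f (snd w)))"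
        using pmf_iid_pmf[of "map f (map snd ws)" "map_pmf f q"] len unfolding map_iid_pmf by (simp add: o_def)
      have quot: "(\<Prod>w\<leftarrow>xs. x w) / ((\<Prod>w\<leftarrow>xs. y w) * (\<Prod>w\<leftarrow>xs. z w)) = (\<Prod>w\<leftarrow>xs. x w / (y w * z w))"
        for xs and x y z :: "'u \<times> 'l \<Rightarrow> real"
      proof (induction xs)
        case (Cons w xs)
        show ?case
          by (simp only: list.map prod_list.Cons Cons.IH[symmetric] times_divide_times_eq mult_ac)
      qed simp
      have "0 < ?r w" if "w \<in> set ws" for w
      proof -
        have w: "w \<in> set_pmf ?P0" using set_iid_pmf[OF ws] that by auto
        show ?thesis
          using pr_pos[OF w, of fst] pr_pos[OF w, of "\<lambda>w. f (snd w)"] pr_pos[OF w, of "\<lambda>w. (fst w, f (snd w))"]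
            pr_snd_attach[where K = ?K and f = f and v = "f (snd w)", OF fin_q fin_K'] by simp
      qed
      then have "(\<Prod>w\<leftarrow>ws. ?r w) = 2 powr (\<Sum>w\<leftarrow>ws. info_dens q ?K f w)"
        unfolding info_dens_def by (rule prod_list_powr_log)
      then show ?thesis unfolding ratio_def 1 2 3 quot .
    qed
    have rA: "rA (map fst ws) (map A (map snd ws)) = 2 powr (\<Sum>w\<leftarrow>ws. info_dens q ?K A w)"
      if ws: "ws \<in> set_pmf (iid_pmf N ?P0)" for ws
    proof -
      have len: "length ws = N" using ws by (rule length_iid_pmf)
      let ?l = "map snd ws"
      have "ws \<in> set_pmf (iid_pmf N ?P0)" by fact
      then have "(map fst ws, ?l) \<in> set_pmf P" unfolding Peq by auto
      then have "?l \<in> set_pmf ?q" by (auto simp: attach_pmf_def)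
      then have pos: "0 < pr ?q (map A) (map A ?l)" by (rule pr_pos)
      have "pr P (\<lambda>w. (fst w, map A (snd w))) (map fst ws, map A ?l) = pr ?q (map A) (map A ?l) * pmf (?KN (map A ?l)) (map fst ws)"
        unfolding map_attach_pmf pmf_attach_pmf ..
      then have "ratio (map A) (map fst ws) (map A ?l) = rA (map fst ws) (map A ?l)"
        using pos by (simp add: ratio_def rA_def)
      then show ?thesis using ratio[OF ws, of A] by simp
    qed
    have "measure_pmf.prob P (- typical) = measure_pmf.prob (iid_pmf N ?P0) {ws. (map fst ws, map snd ws) \<notin> typical}"
      unfolding Peq by (simp add: vimage_def Compl_eq)
    also have "\<dots> \<le> measure_pmf.prob (iid_pmf N ?P0) {ws. \<bar>(\<Sum>w\<leftarrow>ws. info_dens q ?K A w) - N * IA\<bar> > N * \<delta>}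
        + measure_pmf.prob (iid_pmf N ?P0) {ws. \<bar>(\<Sum>w\<leftarrow>ws. info_dens q ?K B w) - N * IB\<bar> > N * \<delta>}
        + measure_pmf.prob (iid_pmf N ?P0) {ws. \<bar>(\<Sum>w\<leftarrow>ws. info_dens q ?K C w) - N * IC\<bar> > N * \<delta>}"
      unfolding prob_eq_sum[OF finite_set_iid_pmf[OF fin0]] sum.distrib[symmetric] distrib_left[symmetric]
    proof (intro sum_mono mult_left_mono)
      fix ws assume ws: "ws \<in> set_pmf (iid_pmf N ?P0)"
      show "indicator {ws. (map fst ws, map snd ws) \<notin> typical} ws
        \<le> indicator {ws. \<bar>(\<Sum>w\<leftarrow>ws. info_dens q ?K A w) - N * IA\<bar> > N * \<delta>} ws
        + indicator {ws. \<bar>(\<Sum>w\<leftarrow>ws. info_dens q ?K B w) - N * IB\<bar> > N * \<delta>} ws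
        + (indicator {ws. \<bar>(\<Sum>w\<leftarrow>ws. info_dens q ?K C w) - N * IC\<bar> > N * \<delta>} ws :: real)"
        unfolding typical_def using rA[OF ws] ratio[OF ws, of B] ratio[OF ws, of C]
        by (auto simp: indicator_def algebra_simps abs_le_iff not_less)
    qed simp
    also have "\<dots> \<le> vA / N + vB / N + vC / N" by (intro add_mono vA vB vC N')
    also have "\<dots> = (vA + vB + vC) / N" by (simp add: add_divide_distrib)
    also have "\<dots> \<le> \<eta>\<^sup>2" using N' \<eta> by (simp add: field_simps)
    finally have atypical: "measure_pmf.prob P (- typical) \<le> \<eta>\<^sup>2" .
    show "\<exists>Enc Dec. (\<forall>a. fst (Enc a) < n) \<and> (\<forall>a. snd (Enc a) < m) \<and>
    (let e = 2 * \<eta> + exp (- (real (n * m) * 2 powr (- (N * (IA + \<delta>))))) +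
         real (n * m) * real (n - 1) * 2 powr (- (N * (IA - \<delta>)) - N * (IC - \<delta>)) in
    measure_pmf.prob (iid_pmf N q) {l. Dec (map C l) (snd (Enc (map A l))) \<noteq> fst (Enc (map A l))} \<le> e \<and>
    N * (IA - \<delta>) - e * \<bar>N * (IA - \<delta>)\<bar> - 1 \<le> ent (iid_pmf N q) (\<lambda>l. Enc (map A l)) \<and>
    (N * (IA - \<delta>) - N * (IB + \<delta>)) - e * \<bar>N * (IA - \<delta>) - N * (IB + \<delta>)\<bar> - 1
      \<le> ent (iid_pmf N q) (\<lambda>l. (Enc (map A l), map B l)) - ent (iid_pmf N q) (map B))"
      by (rule one_shot_code[OF atypical n m]) (unfold Let_def, blast)
  qed
qed

section \<open>Achievability\<close>

text \<open>The helper data stay as they are, so the leakage is still bounded through the full key.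
  Secrecy survives because the truncated key is a function of the full one, and uniformity because
  the discarded quotient takes at most \<open>2 * n / n1\<close> values.\<close>

lemma truncated_key_code:
  fixes A :: "'o \<Rightarrow> 'a" and B :: "'o \<Rightarrow> 'b" and C :: "'o \<Rightarrow> 'c"
    and Enc :: "'a \<Rightarrow> nat \<times> nat" and Dec :: "'c \<Rightarrow> nat \<Rightarrow> nat"
  assumes fin: "finite (set_pmf p)"
    and markov: "ent p (\<lambda>w. (A w, B w, C w)) + ent p B = ent p (\<lambda>w. (A w, B w)) + ent p (\<lambda>w. (B w, C w))"
    and Enc: "\<And>a. fst (Enc a) < n" "\<And>a. snd (Enc a) < m" and n1: "0 < n1" "n1 \<le> n"
    and \<theta>: "0 < \<theta>" "\<theta> < 1"
    and err: "measure_pmf.prob p {w. Dec (C w) (snd (Enc (A w))) \<noteq> fst (Enc (A w))} \<le> \<theta>"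
    and hT: "hT \<le> ent p (\<lambda>w. Enc (A w))"
    and hTB: "hTB \<le> ent p (\<lambda>w. (Enc (A w), B w)) - ent p B"
  defines "Enc' \<equiv> \<lambda>a. (fst (Enc a) mod n1, snd (Enc a))" and "Dec' \<equiv> \<lambda>y h. Dec y h mod n1"
  shows "measure_pmf.prob p {w. fst (Enc' (A w)) \<noteq> Dec' (C w) (snd (Enc' (A w)))} \<le> \<theta>"
    and "ent p (\<lambda>w. fst (Enc' (A w))) + ent p (\<lambda>w. snd (Enc' (A w))) - ent p (\<lambda>w. Enc' (A w))
      \<le> log 2 n + log 2 m - hT"
    and "ent p B + ent p (\<lambda>w. snd (Enc' (A w))) - ent p (\<lambda>w. (snd (Enc' (A w)), B w))
      \<le> log 2 m - hTB + (- log 2 (1 - \<theta>) - \<theta> * log 2 \<theta> + \<theta> * log 2 n)"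
    and "hT - log 2 m - (1 + log 2 n - log 2 n1) \<le> ent p (\<lambda>w. fst (Enc' (A w)))"
    and "ent p (\<lambda>w. snd (Enc' (A w))) \<le> log 2 m"
proof -
  let ?T = "\<lambda>w. Enc (A w)" and ?S = "\<lambda>w. fst (Enc (A w))" and ?M = "\<lambda>w. snd (Enc (A w))"
  let ?S1 = "\<lambda>w. fst (Enc (A w)) mod n1" and ?T1 = "\<lambda>w. Enc' (A w)" and ?D = "\<lambda>w. fst (Enc (A w)) div n1"
  have n: "0 < n" using n1 by simp
  have "measure_pmf.prob p {w. ?S1 w \<noteq> Dec (C w) (?M w) mod n1}
    \<le> measure_pmf.prob p {w. Dec (C w) (?M w) \<noteq> ?S w}"
    by (rule measure_pmf.finite_measure_mono) auto
  then show "measure_pmf.prob p {w. fst (Enc' (A w)) \<noteq> Dec' (C w) (snd (Enc' (A w)))} \<le> \<theta>"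
    using err by (simp add: Enc'_def Dec'_def)
  have HM: "ent p ?M \<le> log 2 m"
    using ent_le_log_card[OF fin, of "{..<m}" ?M] Enc(2) by auto
  then show "ent p (\<lambda>w. snd (Enc' (A w))) \<le> log 2 m" by (simp add: Enc'_def)
  have HS: "ent p ?S \<le> log 2 n"
    using ent_le_log_card[OF fin, of "{..<n}" ?S] Enc(1) by auto
  have "ent p ?T + ent p ?S1 \<le> ent p ?S + ent p ?T1"
    by (rule ent_submodular_refine[OF fin, where A = ?S and B = ?M]) (auto simp: Enc'_def prod_eq_iff)
  then show "ent p (\<lambda>w. fst (Enc' (A w))) + ent p (\<lambda>w. snd (Enc' (A w))) - ent p ?T1
      \<le> log 2 n + log 2 m - hT"
    using hT HS HM by (simp add: Enc'_def)
  have "?D w < Suc ((n - 1) div n1)" for w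
    using div_le_mono[of "?S w" "n - 1" n1] Enc(1)[of "A w"] by (simp add: less_Suc_eq_le)
  then have "ent p ?D \<le> log 2 (Suc ((n - 1) div n1))"
    using ent_le_log_card[OF fin, of "{..<Suc ((n - 1) div n1)}" ?D] by auto
  \<comment> \<open>Rounding up costs the factor 2, which becomes the extra bit in
    \<open>1 + log 2 n - log 2 n1\<close>.\<close>
  also have "real (Suc ((n - 1) div n1)) \<le> 2 * real n / real n1"
  proof -
    have "real ((n - 1) div n1) \<le> real (n - 1) / real n1" by (rule of_nat_div_le_of_nat)
    also have "\<dots> \<le> real n / real n1" by (intro divide_right_mono) auto
    finally have "real (Suc ((n - 1) div n1)) \<le> 1 + real n / real n1" by simp
    also have "1 \<le> real n / real n1" using n1 by simp
    finally show ?thesis by simp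
  qed
  then have "log 2 (Suc ((n - 1) div n1)) \<le> log 2 (2 * real n / real n1)"
    by (intro log_mono) auto
  also have "\<dots> = 1 + log 2 n - log 2 n1" using n n1 by (simp add: log_divide log_mult)
  finally have HD: "ent p ?D \<le> 1 + log 2 n - log 2 n1" .
  have "ent p ?T \<le> ent p (\<lambda>w. (?S1 w, (?D w, ?M w)))"
    by (rule ent_mono[OF fin]) (auto simp: prod_eq_iff, metis div_mult_mod_eq)
  also have "\<dots> \<le> ent p ?S1 + ent p (\<lambda>w. (?D w, ?M w))" by (rule ent_subadditive[OF fin])
  also have "ent p (\<lambda>w. (?D w, ?M w)) \<le> ent p ?D + ent p ?M" by (rule ent_subadditive[OF fin])
  finally show "hT - log 2 m - (1 + log 2 n - log 2 n1) \<le> ent p (\<lambda>w. fst (Enc' (A w)))"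
    using hT HM HD by (simp add: Enc'_def)
  \<comment> \<open>Leakage: by the Markov chain the uncertainty of the key given helper data and
    \<open>B\<close> does not change when \<open>C\<close> is added to the conditioning, and
    dropping \<open>B\<close> only increases it. What remains is the decoder's uncertainty, bounded
    by Fano's inequality.\<close>
  have "ent p (\<lambda>w. (?S w, (?M w, C w))) - ent p (\<lambda>w. (?M w, C w))
    \<le> - log 2 (1 - \<theta>) - \<theta> * log 2 \<theta> + \<theta> * log 2 (card {..<n})"
    by (rule fano_side_info[OF fin _ _ \<theta>, where B = "\<lambda>w. Dec (C w) (?M w)"])
      (use Enc(1) err in \<open>auto simp: eq_commute\<close>)
  moreover have "ent p (\<lambda>w. (?S w, (?M w, C w))) = ent p (\<lambda>w. (?T w, C w))"
    by (rule ent_cong[OF fin]) (auto simp: prod_eq_iff)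
  moreover have "ent p (\<lambda>w. (?M w, B w, C w)) + ent p B \<le> ent p (\<lambda>w. (?M w, B w)) + ent p (\<lambda>w. (B w, C w))"
    by (rule ent_submodular_refine[OF fin, where A = ?M and B = C]) auto
  moreover have "ent p (\<lambda>w. (A w, B w, C w)) + ent p (\<lambda>w. (?T w, B w))
    \<le> ent p (\<lambda>w. (A w, B w)) + ent p (\<lambda>w. (?T w, B w, C w))"
    by (rule ent_submodular_refine[OF fin, where A = A and B = C]) auto
  moreover have "ent p (\<lambda>w. (?T w, B w, C w)) + ent p (\<lambda>w. (?M w, C w))
    \<le> ent p (\<lambda>w. (?T w, C w)) + ent p (\<lambda>w. (?M w, B w, C w))"
    by (rule ent_submodular_refine[OF fin, where A = ?T and B = B]) auto
  ultimately have "ent p (\<lambda>w. (?T w, B w)) - ent p (\<lambda>w. (?M w, B w))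
    \<le> - log 2 (1 - \<theta>) - \<theta> * log 2 \<theta> + \<theta> * log 2 n"
    using markov by simp
  then show "ent p B + ent p (\<lambda>w. snd (Enc' (A w))) - ent p (\<lambda>w. (snd (Enc' (A w)), B w))
      \<le> log 2 m - hTB + (- log 2 (1 - \<theta>) - \<theta> * log 2 \<theta> + \<theta> * log 2 n)"
    using hTB HM by (simp add: Enc'_def)
qed

section \<open>Integer code sizes and the choice of rates\<close>

text \<open>Rounding up keeps the size positive for every exponent and makes it exactly 1 for
  nonpositive ones, the range where comparison with \<open>2 * 2 powr x\<close> may fail.\<close>

definition pow_ceil :: "real \<Rightarrow> nat" where
  "pow_ceil x = nat \<lceil>2 powr x\<rceil>"

lemma pow_ceil:
  shows pow_ceil_pos: "0 < pow_ceil x"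
    and pow_ceil_ge: "2 powr x \<le> real (pow_ceil x)"
    and pow_ceil_diff_le: "real (pow_ceil x - 1) \<le> 2 powr x"
    and pow_ceil_eq_1: "x \<le> 0 \<Longrightarrow> pow_ceil x = 1"
    and pow_ceil_le: "0 \<le> x \<Longrightarrow> real (pow_ceil x) \<le> 2 * 2 powr x"
proof -
  have pos: "0 < \<lceil>2 powr x\<rceil>" by simp
  show "0 < pow_ceil x" using pos by (simp add: pow_ceil_def)
  show "2 powr x \<le> real (pow_ceil x)" using pos by (simp add: pow_ceil_def)
  have "real (pow_ceil x) = of_int \<lceil>2 powr x\<rceil>" using pos by (simp add: pow_ceil_def)
  then have *: "real (pow_ceil x) < 2 powr x + 1" by linarith
  then show "real (pow_ceil x - 1) \<le> 2 powr x" using \<open>0 < pow_ceil x\<close> by (simp add: of_nat_diff)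
  show "pow_ceil x = 1" if "x \<le> 0"
  proof -
    have "2 powr x \<le> 2 powr 0" using that by (intro powr_mono) auto
    then have "real (pow_ceil x) < 2" using * by simp
    then show ?thesis using \<open>0 < pow_ceil x\<close> by simp
  qed
  show "real (pow_ceil x) \<le> 2 * 2 powr x" if "0 \<le> x"
    using * ge_one_powr_ge_zero[of 2 x] that by simp
qed

lemma log_pow_ceil_ge: "x \<le> log 2 (pow_ceil x)"
  using pow_ceil_ge[of x] pow_ceil_pos[of x] by (simp add: le_log_iff)

lemma log_pow_ceil_le: "x \<le> y \<Longrightarrow> 0 \<le> y \<Longrightarrow> log 2 (pow_ceil x) \<le> y + 1"
proof -
  assume xy: "x \<le> y" "0 \<le> y"
  have "real (pow_ceil x) \<le> 2 * 2 powr y"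
  proof (cases "0 \<le> x")
    case True
    have "2 * 2 powr x \<le> 2 * 2 powr y" using xy by simp
    then show ?thesis using pow_ceil_le[OF True] by linarith
  next
    case False
    then show ?thesis using pow_ceil_eq_1[of x] ge_one_powr_ge_zero[of 2 y] xy by simp
  qed
  also have "\<dots> = 2 powr (y + 1)" by (simp add: powr_add)
  finally show ?thesis using pow_ceil_pos[of x] by (simp add: log_le_iff)
qed

lemma pow_ceil_mono: "x \<le> y \<Longrightarrow> pow_ceil x \<le> pow_ceil y"
  unfolding pow_ceil_def by (intro nat_mono ceiling_mono powr_mono) auto

text \<open>The total exponent \<open>IA + 2 * \<delta>\<close> exceeds the covering threshold
  \<open>IA + \<delta>\<close> by \<open>\<delta>\<close>. The bin size pays for this excess of 2,
  for the shifts of 1 each in the exponents of \<open>IA\<close> and \<open>IC\<close>, and for a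
  final gap of 1; hence 5, and \<open>7 = 5 + 2\<close> for the bins. The factor on the right is 1
  for covering plus 4 for rounding up \<open>n\<close> and \<open>m\<close>.\<close>

lemma code_error_terms:
  fixes IA IC \<delta> :: real and N :: nat
  assumes I: "IC \<le> IA" and \<delta>: "0 < \<delta>"
  defines "n \<equiv> pow_ceil (N * (IC - 5 * \<delta>))" and "m \<equiv> pow_ceil (N * (IA - IC + 7 * \<delta>))"
  shows "exp (- (real (n * m) * 2 powr (- (N * (IA + \<delta>))))) + real (n * m) * real (n - 1) * 2 powr (- (N * (IA - \<delta>)) - N * (IC - \<delta>))
    \<le> 5 * 2 powr (- (N * \<delta>))"
proof -
  have "2 powr (N * (IC - 5 * \<delta>)) * 2 powr (N * (IA - IC + 7 * \<delta>)) \<le> real (n * m)"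
    unfolding n_def m_def of_nat_mult by (intro mult_mono pow_ceil_ge) auto
  then have "2 powr (N * (IC - 5 * \<delta>)) * 2 powr (N * (IA - IC + 7 * \<delta>)) * 2 powr (- (N * (IA + \<delta>)))
    \<le> real (n * m) * 2 powr (- (N * (IA + \<delta>)))"
    by (intro mult_right_mono) auto
  also have "2 powr (N * (IC - 5 * \<delta>)) * 2 powr (N * (IA - IC + 7 * \<delta>)) * 2 powr (- (N * (IA + \<delta>))) = 2 powr (N * \<delta>)"
    unfolding powr_add[symmetric] by (simp add: algebra_simps)
  finally have x: "2 powr (N * \<delta>) \<le> real (n * m) * 2 powr (- (N * (IA + \<delta>)))" (is "_ \<le> ?x") .
  then have "0 < ?x" by (rule less_le_trans[rotated]) simp
  have "exp (- x) \<le> 1 / x" if "0 < x" for x :: real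
  proof -
    have "x \<le> exp x" using exp_ge_add_one_self[of x] by linarith
    then show ?thesis using that by (simp add: exp_minus le_imp_inverse_le inverse_eq_divide[symmetric])
  qed
  from this[OF \<open>0 < ?x\<close>] have "exp (- ?x) \<le> 1 / ?x" .
  also have "\<dots> \<le> 1 / 2 powr (N * \<delta>)" using x \<open>0 < ?x\<close> by (intro divide_left_mono) auto
  finally have e1: "exp (- ?x) \<le> 2 powr (- (N * \<delta>))" by (simp add: powr_minus_divide)
  have e2: "real (n * m) * real (n - 1) * 2 powr (- (N * (IA - \<delta>)) - N * (IC - \<delta>)) \<le> 4 * 2 powr (- (N * \<delta>))"
  proof (cases "N * (IC - 5 * \<delta>) \<le> 0")
    \<comment> \<open>A single word per bin: the factor \<open>n - 1\<close> is 0.\<close>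
    case True
    then have "n = 1" unfolding n_def by (rule pow_ceil_eq_1)
    then show ?thesis by simp
  next
    case False
    have "0 \<le> N * (IA - IC + 7 * \<delta>)" using I \<delta> by simp
    then have "real (n * m) * real (n - 1) \<le> ((2 * 2 powr (N * (IC - 5 * \<delta>))) * (2 * 2 powr (N * (IA - IC + 7 * \<delta>)))) * 2 powr (N * (IC - 5 * \<delta>))"
      unfolding n_def m_def of_nat_mult using False
      by (intro mult_mono pow_ceil_le pow_ceil_diff_le) auto
    then have "real (n * m) * real (n - 1) * 2 powr (- (N * (IA - \<delta>)) - N * (IC - \<delta>))
      \<le> ((2 * 2 powr (N * (IC - 5 * \<delta>))) * (2 * 2 powr (N * (IA - IC + 7 * \<delta>)))) * 2 powr (N * (IC - 5 * \<delta>))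
        * 2 powr (- (N * (IA - \<delta>)) - N * (IC - \<delta>))"
      by (intro mult_right_mono) auto
    also have "\<dots> = 4 * (2 powr (N * (IC - 5 * \<delta>)) * 2 powr (N * (IA - IC + 7 * \<delta>)) * 2 powr (N * (IC - 5 * \<delta>))
        * 2 powr (- (N * (IA - \<delta>)) - N * (IC - \<delta>)))" by simp
    also have "\<dots> = 4 * 2 powr (- (N * \<delta>))"
      unfolding powr_add[symmetric] by (simp add: algebra_simps)
    finally show ?thesis .
  qed
  show ?thesis using e1 e2 by simp
qed

lemma iid_pmf_src_markov:
  fixes Q :: "'x::finite pmf" and W :: "'x \<Rightarrow> 'xt::finite pmf" and V :: "'x \<Rightarrow> 'y::finite pmf" and N :: nat
  defines "p \<equiv> iid_pmf N (src_pmf Q W V)"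
  shows "ent p (\<lambda>l. (map fst l, map (fst \<circ> snd) l, map (snd \<circ> snd) l)) + ent p (map (fst \<circ> snd))
    = ent p (\<lambda>l. (map fst l, map (fst \<circ> snd) l)) + ent p (\<lambda>l. (map (fst \<circ> snd) l, map (snd \<circ> snd) l))"
proof -
  let ?q = "src_pmf Q W V"
  have finq: "finite (set_pmf ?q)" by simp
  have fin: "finite (set_pmf p)" by (simp add: p_def)
  have eqs: "ent p (\<lambda>l. (map fst l, map (fst \<circ> snd) l, map (snd \<circ> snd) l)) = ent p (map (\<lambda>l. (fst l, (fst \<circ> snd) l, (snd \<circ> snd) l)))"
    "ent p (\<lambda>l. (map fst l, map (fst \<circ> snd) l)) = ent p (map (\<lambda>l. (fst l, (fst \<circ> snd) l)))"
    "ent p (\<lambda>l. (map (fst \<circ> snd) l, map (snd \<circ> snd) l)) = ent p (map (\<lambda>l. ((fst \<circ> snd) l, (snd \<circ> snd) l)))"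
    by (rule ent_cong[OF fin]; auto simp: list_eq_iff_nth_eq prod_eq_iff)+
  show ?thesis
    unfolding eqs unfolding p_def ent_iid_pmf[OF finq] distrib_left[symmetric] src_pmf_markov[of Q W V] ..
qed

lemma gs_achievable_of_info:
  fixes Q :: "'x::finite pmf" and W :: "'x \<Rightarrow> 'xt::finite pmf" and V :: "'x \<Rightarrow> 'y::finite pmf"
    and PU :: "'xt \<Rightarrow> 'u pmf"
  assumes finU: "\<And>a. finite (set_pmf (PU a))"
  defines "q \<equiv> src_pmf Q W V"
  defines "IA \<equiv> info q (\<lambda>l. PU (fst l)) fst" and "IB \<equiv> info q (\<lambda>l. PU (fst l)) (fst \<circ> snd)"
    and "IC \<equiv> info q (\<lambda>l. PU (fst l)) (snd \<circ> snd)"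
  assumes R: "0 \<le> R" "R \<le> IC" and Rl: "IB - IC \<le> Rl" and Rm: "IA - IC \<le> Rm"
  shows "gs_achievable Q W V (R, Rl, Rm)"
proof -
  have fin_q: "finite (set_pmf q)" by simp
  have ICA: "IC \<le> IA" unfolding IC_def IA_def by (rule info_data_processing[OF fin_q finU])
  have IC0: "0 \<le> IC" using R by simp
  have "\<exists>N\<ge>1. \<exists>(S::nat set) Enc Dec.
        finite S \<and> S \<noteq> {} \<and>
        (\<forall>xt. length xt = N \<longrightarrow> fst (Enc xt) \<in> S) \<and>
        (let J = gs_joint Q W V N Enc Dec in
          \<bar>log 2 (real (card S)) / real N - R\<bar> \<le> \<epsilon> \<and>
          measure_pmf.prob J {(s, m, sh, x). s \<noteq> sh} \<le> \<epsilon> \<and>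
          mutual_info_pmf (map_pmf (\<lambda>(s, m, sh, x). (s, m)) J) / real N \<le> \<epsilon> \<and>
          mutual_info_pmf (map_pmf (\<lambda>(s, m, sh, x). (x, m)) J) / real N \<le> Rl + \<epsilon> \<and>
          entropy_pmf (map_pmf (\<lambda>(s, m, sh, x). s) J) / real N \<ge> R - \<epsilon> \<and>
          entropy_pmf (map_pmf (\<lambda>(s, m, sh, x). m) J) / real N \<le> Rm + \<epsilon>)"
    if \<epsilon>: "0 < \<epsilon>" for \<epsilon>
  proof -
    \<comment> \<open>Uniformity spends the most: \<open>1 + 7 + 5 = 13\<close> multiples of
      \<open>N * \<delta>\<close>, from the entropy exponent, the helper data and the truncated key.
      They amount to \<open>N * \<epsilon> / 2\<close>; the terms with \<open>\<theta>\<close> and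
      the constants get \<open>N * \<epsilon> / 4\<close> each.\<close>
    define \<delta> where "\<delta> = \<epsilon> / 26"
    have \<delta>: "0 < \<delta>" using \<epsilon> by (simp add: \<delta>_def)
    \<comment> \<open>Dominates every coefficient of \<open>N * \<theta>\<close>: the exponents lost
      with the success probability, and the size of the key in Fano's inequality.\<close>
    define c where "c = \<bar>IA - \<delta>\<bar> + \<bar>(IA - \<delta>) - (IB + \<delta>)\<bar> + IC + 2"
    have c: "2 \<le> c" using IC0 by (simp add: c_def)
    define \<theta> where "\<theta> = min (1 / 2) (\<epsilon> / (4 * c))"
    have \<theta>: "0 < \<theta>" "\<theta> < 1" using \<epsilon> c by (auto simp: \<theta>_def)
    have "\<theta> \<le> \<epsilon> / (4 * c)" by (simp add: \<theta>_def)
    then have \<theta>c: "\<theta> * c \<le> \<epsilon> / 4" using c by (simp add: field_simps)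
    \<comment> \<open>Two thirds of \<open>\<theta>\<close> pay for \<open>2 * \<eta>\<close>, the
      last third for the error terms that vanish with \<open>N\<close>.\<close>
    define \<eta> where "\<eta> = \<theta> / 3"
    have \<eta>: "0 < \<eta>" "\<eta> < 1" using \<theta> by (auto simp: \<eta>_def)
    define h where "h = - log 2 (1 - \<theta>) - \<theta> * log 2 \<theta>"
    obtain N0 where N0: "\<And>N n m. N0 \<le> N \<Longrightarrow> 0 < n \<Longrightarrow> 0 < m \<Longrightarrow> \<exists>Enc Dec.
      (\<forall>a. fst (Enc a) < n) \<and> (\<forall>a. snd (Enc a) < m) \<and>
      (let e = 2 * \<eta> + exp (- (real (n * m) * 2 powr (- (N * (IA + \<delta>))))) +
           real (n * m) * real (n - 1) * 2 powr (- (N * (IA - \<delta>)) - N * (IC - \<delta>)) in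
      measure_pmf.prob (iid_pmf N q) {l. Dec (map (snd \<circ> snd) l) (snd (Enc (map fst l))) \<noteq> fst (Enc (map fst l))} \<le> e \<and>
      N * (IA - \<delta>) - e * \<bar>N * (IA - \<delta>)\<bar> - 1 \<le> ent (iid_pmf N q) (\<lambda>l. Enc (map fst l)) \<and>
      (N * (IA - \<delta>) - N * (IB + \<delta>)) - e * \<bar>N * (IA - \<delta>) - N * (IB + \<delta>)\<bar> - 1
        \<le> ent (iid_pmf N q) (\<lambda>l. (Enc (map fst l), map (fst \<circ> snd) l)) - ent (iid_pmf N q) (map (fst \<circ> snd)))"
      using block_code[where A = fst and B = "fst \<circ> snd" and C = "snd \<circ> snd" and K = PU, OF fin_q finU \<delta> \<eta>] unfolding IA_def IB_def IC_def by blast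
    have "(\<lambda>N. 5 * (2 powr (- \<delta>)) ^ N) \<longlonglongrightarrow> 5 * 0"
      by (intro tendsto_mult_left LIMSEQ_power_zero) (use \<delta> powr_less_one[of 2 "- \<delta>"] in auto)
    then have "\<forall>\<^sub>F N in sequentially. 5 * (2 powr (- \<delta>)) ^ N < \<eta>"
      using \<eta> by (intro order_tendstoD(2)) auto
    \<comment> \<open>Absorbs at most four units from rounding and from the entropy bounds, and the
      part \<open>h\<close> of Fano's term that does not grow with \<open>N\<close>.\<close>
    moreover have "\<forall>\<^sub>F N in sequentially. (4 + \<bar>h\<bar>) / (\<epsilon> / 4) \<le> real N"
      using filterlim_real_sequentially unfolding filterlim_at_top by blast
    ultimately have "\<forall>\<^sub>F N in sequentially. N0 \<le> N \<and> 1 \<le> N \<and> 5 * (2 powr (- \<delta>)) ^ N < \<eta> \<and> (4 + \<bar>h\<bar>) / (\<epsilon> / 4) \<le> real N"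
      by (intro eventually_conj eventually_ge_at_top)
    then obtain N where N: "N0 \<le> N" "1 \<le> N" "5 * (2 powr (- \<delta>)) ^ N < \<eta>" "(4 + \<bar>h\<bar>) / (\<epsilon> / 4) \<le> real N"
      unfolding eventually_sequentially by blast
    define n where "n = pow_ceil (N * (IC - 5 * \<delta>))"
    define m where "m = pow_ceil (N * (IA - IC + 7 * \<delta>))"
    \<comment> \<open>The same margin as for \<open>n\<close>, so that \<open>R \<le> IC\<close>
      gives \<open>n1 \<le> n\<close>.\<close>
    define n1 where "n1 = pow_ceil (N * (R - 5 * \<delta>))"
    have n1: "0 < n1" "n1 \<le> n"
      using R by (auto simp: n1_def n_def pow_ceil_pos intro!: pow_ceil_mono mult_left_mono)
    have n: "0 < n" and m: "0 < m" by (simp_all add: n_def m_def pow_ceil_pos)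
    define e where "e = 2 * \<eta> + exp (- (real (n * m) * 2 powr (- (N * (IA + \<delta>))))) +
           real (n * m) * real (n - 1) * 2 powr (- (N * (IA - \<delta>)) - N * (IC - \<delta>))"
    obtain Enc Dec where Enc: "\<And>a. fst (Enc a) < n" "\<And>a. snd (Enc a) < m"
      and err: "measure_pmf.prob (iid_pmf N q) {l. Dec (map (snd \<circ> snd) l) (snd (Enc (map fst l))) \<noteq> fst (Enc (map fst l))} \<le> e"
      and hT: "N * (IA - \<delta>) - e * \<bar>N * (IA - \<delta>)\<bar> - 1 \<le> ent (iid_pmf N q) (\<lambda>l. Enc (map fst l))"
      and hTB: "(N * (IA - \<delta>) - N * (IB + \<delta>)) - e * \<bar>N * (IA - \<delta>) - N * (IB + \<delta>)\<bar> - 1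
        \<le> ent (iid_pmf N q) (\<lambda>l. (Enc (map fst l), map (fst \<circ> snd) l)) - ent (iid_pmf N q) (map (fst \<circ> snd))"
      using N0[OF N(1) n m] unfolding Let_def e_def[symmetric] by blast
    have "(2 powr (- \<delta>)) ^ N = 2 powr (- (N * \<delta>))" by (simp add: powr_power mult.commute)
    then have e\<theta>: "e \<le> \<theta>"
      using code_error_terms[OF ICA \<delta>, of N] N(3) unfolding e_def n_def m_def \<eta>_def by simp
    have abs: "e * \<bar>x\<bar> \<le> \<theta> * \<bar>x\<bar>" for x using e\<theta> by (intro mult_right_mono) auto
    define hA where "hA = N * (IA - \<delta>) - \<theta> * (N * \<bar>IA - \<delta>\<bar>) - 1"
    define hB where "hB = N * ((IA - \<delta>) - (IB + \<delta>)) - \<theta> * (N * \<bar>(IA - \<delta>) - (IB + \<delta>)\<bar>) - 1"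
    have hT': "hA \<le> ent (iid_pmf N q) (\<lambda>l. Enc (map fst l))"
      using hT abs[of "N * (IA - \<delta>)"] by (simp add: hA_def abs_mult)
    have hTB': "hB \<le> ent (iid_pmf N q) (\<lambda>l. (Enc (map fst l), map (fst \<circ> snd) l)) - ent (iid_pmf N q) (map (fst \<circ> snd))"
      using hTB abs[of "N * ((IA - \<delta>) - (IB + \<delta>))"]
      unfolding hB_def right_diff_distrib[symmetric] abs_mult by simp
    let ?Enc = "\<lambda>a. (fst (Enc a) mod n1, snd (Enc a))" and ?Dec = "\<lambda>y h. Dec y h mod n1"
    have fin: "finite (set_pmf (iid_pmf N q))" by simp
    note code = truncated_key_code[OF fin iid_pmf_src_markov[of N Q W V, folded q_def] Enc n1 \<theta> order.trans[OF err e\<theta>] hT' hTB']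
    have ln: "log 2 n \<le> N * IC + 1"
      unfolding n_def using \<delta> IC0 by (intro log_pow_ceil_le mult_left_mono) auto
    have lm: "log 2 m \<le> N * (IA - IC + 7 * \<delta>) + 1"
      unfolding m_def using \<delta> ICA by (intro log_pow_ceil_le) auto
    have ln1: "log 2 n1 \<le> N * R + 1" "N * (R - 5 * \<delta>) \<le> log 2 n1"
      unfolding n1_def using \<delta> R by (auto intro!: log_pow_ceil_le log_pow_ceil_ge mult_left_mono)
    have NN: "0 < real N" using N(2) by simp
    have big: "4 + \<bar>h\<bar> \<le> N * (\<epsilon> / 4)" using N(4) \<epsilon> by (simp add: field_simps)
    have \<theta>N: "\<theta> * (N * x) \<le> N * (\<epsilon> / 4)" if "x \<le> c" for x :: real
    proof -
      have "\<theta> * x \<le> \<epsilon> / 4" using mult_left_mono[OF that, of \<theta>] \<theta> \<theta>c by linarith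
      from mult_left_mono[OF this, of N] show ?thesis by (simp add: mult_ac)
    qed
    have N\<delta>: "13 * (N * \<delta>) = N * (\<epsilon> / 2)" "0 \<le> N * \<delta>" using \<delta> by (simp_all add: \<delta>_def)
    have \<theta>A: "\<theta> * (N * \<bar>IA - \<delta>\<bar>) \<le> N * (\<epsilon> / 4)" by (rule \<theta>N) (use IC0 in \<open>simp add: c_def\<close>)
    have \<theta>B: "\<theta> * (N * (\<bar>(IA - \<delta>) - (IB + \<delta>)\<bar> + IC + 1)) \<le> N * (\<epsilon> / 4)"
      by (rule \<theta>N) (simp add: c_def)
    have \<theta>n: "\<theta> * log 2 n \<le> \<theta> * (N * IC + N)"
      using ln N(2) \<theta> by (intro mult_left_mono) auto
    have NR: "N * IB - N * IC \<le> N * Rl" "N * IA - N * IC \<le> N * Rm"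
      using Rl Rm NN by (simp_all flip: right_diff_distrib)
    have expand: "N * (R - 5 * \<delta>) = N * R - 5 * (N * \<delta>)" "N * (IA - IC + 7 * \<delta>) = N * IA - N * IC + 7 * (N * \<delta>)"
      "N * (IA - \<delta>) = N * IA - N * \<delta>" "N * ((IA - \<delta>) - (IB + \<delta>)) = N * IA - N * IB - 2 * (N * \<delta>)"
      "N * (\<epsilon> / 2) = N * \<epsilon> / 2" "N * (\<epsilon> / 4) = N * \<epsilon> / 4"
      "\<theta> * (N * (\<bar>(IA - \<delta>) - (IB + \<delta>)\<bar> + IC + 1)) = \<theta> * (N * \<bar>(IA - \<delta>) - (IB + \<delta>)\<bar>) + \<theta> * (N * IC) + \<theta> * N"
      "\<theta> * (N * IC + N) = \<theta> * (N * IC) + \<theta> * N"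
      by (simp_all add: distrib_left right_diff_distrib)
    note linear = ln lm[unfolded expand] ln1[unfolded expand] \<theta>A[unfolded expand] \<theta>B[unfolded expand]
      \<theta>n[unfolded expand] big[unfolded expand] N\<delta>[unfolded expand] NR hA_def[unfolded expand] hB_def[unfolded expand]
    show ?thesis
    proof (intro exI[of _ N] conjI exI[of _ "{..<n1}"] exI[of _ ?Enc] exI[of _ ?Dec])
      show "1 \<le> N" by (rule N(2))
      show "let J = gs_joint Q W V N ?Enc ?Dec in
          \<bar>log 2 (real (card {..<n1})) / real N - R\<bar> \<le> \<epsilon> \<and>
          measure_pmf.prob J {(s, m, sh, x). s \<noteq> sh} \<le> \<epsilon> \<and>
          mutual_info_pmf (map_pmf (\<lambda>(s, m, sh, x). (s, m)) J) / real N \<le> \<epsilon> \<and>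
          mutual_info_pmf (map_pmf (\<lambda>(s, m, sh, x). (x, m)) J) / real N \<le> Rl + \<epsilon> \<and>
          entropy_pmf (map_pmf (\<lambda>(s, m, sh, x). s) J) / real N \<ge> R - \<epsilon> \<and>
          entropy_pmf (map_pmf (\<lambda>(s, m, sh, x). m) J) / real N \<le> Rm + \<epsilon>"
        unfolding Let_def gs_joint_quantities[of Q W V N ?Enc, folded q_def]
      proof (intro conjI)
        have "log 2 n1 - N * R \<le> N * \<epsilon>" "N * R - log 2 n1 \<le> N * \<epsilon>"
          using linear by linarith+
        then have "\<bar>log 2 n1 - N * R\<bar> \<le> N * \<epsilon>" by linarith
        moreover have "log 2 n1 / N - R = (log 2 n1 - N * R) / N" using NN by (simp add: field_simps)
        ultimately show "\<bar>log 2 (real (card {..<n1})) / real N - R\<bar> \<le> \<epsilon>"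
          using NN by (simp add: abs_divide divide_le_eq mult.commute)
        have "\<theta> * 1 \<le> \<theta> * c" using c \<theta> by (intro mult_left_mono) auto
        then have "\<theta> \<le> \<epsilon>" using \<theta>c \<epsilon> by linarith
        then show "measure_pmf.prob (iid_pmf N q) {l. key_rv ?Enc l \<noteq> ?Dec (map (snd \<circ> snd) l) (help_rv ?Enc l)} \<le> \<epsilon>"
          using code(1) by linarith
        have "ent (iid_pmf N q) (key_rv ?Enc) + ent (iid_pmf N q) (help_rv ?Enc) - ent (iid_pmf N q) (\<lambda>l. ?Enc (map fst l)) \<le> N * \<epsilon>"
          using code(2) linear by linarith
        then show "(ent (iid_pmf N q) (key_rv ?Enc) + ent (iid_pmf N q) (help_rv ?Enc) - ent (iid_pmf N q) (\<lambda>l. ?Enc (map fst l))) / N \<le> \<epsilon>"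
          using NN by (simp add: divide_le_eq mult.commute)
        have "ent (iid_pmf N q) (map (fst \<circ> snd)) + ent (iid_pmf N q) (help_rv ?Enc)
            - ent (iid_pmf N q) (\<lambda>l. (help_rv ?Enc l, map (fst \<circ> snd) l)) \<le> log 2 m - hB + (h + \<theta> * log 2 n)"
          using code(3) by (simp add: h_def)
        also have "\<dots> \<le> N * Rl + N * \<epsilon>"
          using linear by linarith
        finally show "(ent (iid_pmf N q) (map (fst \<circ> snd)) + ent (iid_pmf N q) (help_rv ?Enc)
            - ent (iid_pmf N q) (\<lambda>l. (help_rv ?Enc l, map (fst \<circ> snd) l))) / N \<le> Rl + \<epsilon>"
          using NN by (simp add: divide_le_eq distrib_left mult.commute)
        have "N * R - N * \<epsilon> \<le> hA - log 2 m - (1 + log 2 n - log 2 n1)"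
          using linear by linarith
        also have "\<dots> \<le> ent (iid_pmf N q) (key_rv ?Enc)" by (rule code(4))
        finally show "ent (iid_pmf N q) (key_rv ?Enc) / N \<ge> R - \<epsilon>"
          using NN by (simp add: le_divide_eq right_diff_distrib mult.commute)
        have "ent (iid_pmf N q) (help_rv ?Enc) \<le> N * Rm + N * \<epsilon>"
          using code(5) linear by linarith
        then show "ent (iid_pmf N q) (help_rv ?Enc) / N \<le> Rm + \<epsilon>"
          using NN by (simp add: divide_le_eq distrib_left mult.commute)
      qed
    qed (use n1 in auto)
  qed
  then show ?thesis unfolding gs_achievable_def by simp
qed

theorem theorem1:
  fixes Q :: "'x::finite pmf"
    and W :: "'x \<Rightarrow> 'xt::finite pmf"
    and V :: "'x \<Rightarrow> 'y::finite pmf"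
  shows "gs_capacity_region Q W V = region_R1 Q W V"
proof (rule antisym[OF capacity_region_subset])
  show "region_R1 Q W V \<subseteq> gs_capacity_region Q W V"
  proof
    fix r assume "r \<in> region_R1 Q W V"
    moreover obtain R Rl Rm where r: "r = (R, Rl, Rm)" by (cases r) auto
    ultimately obtain PU :: "'xt \<Rightarrow> nat pmf" where PU: "finite (\<Union>a. set_pmf (PU a))"
      and "let P = aux_joint Q W V PU;
          IUY = mutual_info_pmf (map_pmf (\<lambda>(u, xt, x, y). (u, y)) P);
          IUX = mutual_info_pmf (map_pmf (\<lambda>(u, xt, x, y). (u, x)) P);
          IUXt = mutual_info_pmf (map_pmf (\<lambda>(u, xt, x, y). (u, xt)) P)
      in 0 \<le> R \<and> R \<le> IUY \<and> Rl \<ge> IUX - IUY \<and> Rm \<ge> IUXt - IUY"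
      by (auto simp: region_R1_def Let_def)
    moreover have finU: "finite (set_pmf (PU a))" for a using PU by (rule finite_subset[rotated]) auto
    ultimately show "r \<in> gs_capacity_region Q W V"
      unfolding gs_capacity_region_def r mem_Collect_eq
      by (intro gs_achievable_of_info[where PU = PU, OF finU]) (simp_all add: mutual_info_aux_joint[OF finU] Let_def info_def)
  qed
qed

end
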